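(* For all $h\in\mathbb{R}$ and all $\kappa,\beta>0$, the limit $$p(\kappa,\beta,h)=\lim_{N\to\infty}\mathbb{E}\,p_N(\kappa,\beta,h;J)$$ exists, and $$p_N(\kappa,\beta,h;J)\longrightarrow p(\kappa,\beta,h)\qquad (N\to\infty)$$ for almost every $J$ and in the $L^p$-norm for every $p\in[1,\infty)$.
   Context: Fix a dimension $d\ge 1$ and let $\Lambda_N=\{-N,\dots,N\}^d\subset\mathbb{Z}^d$. Let $K:\mathbb{Z}^d\to\mathbb{R}$ satisfy $|K(i)|\le C_1e^{-C_2|i|}$ for all $i$, for some constants $C_1,C_2>0$ ($K$ is not required to be nonnegative). Let $J=(J_{ij})_{i,j\in\mathbb{Z}^d}$ be i.i.d. standard Gaussian variables $\mathcal{N}(0,1)$, indexed by all ordered pairs $(i,j)$; $\mathbb{E}$ denotes expectation over these variables. For $\sigma\in\{-1,+1\}^{\Lambda_N}$ define $$H^{I}_N(\sigma)=-\frac12\sum_{i,j\in\Lambda_N}K(i-j)\sigma_i\sigma_j,\qquad H^{SK}_N(\sigma;J)=-\frac{1}{\sqrt{2|\Lambda_N|}}\sum_{i,j\in\Lambda_N}J_{ij}\sigma_i\sigma_j .$$ The partition function and the finite-volume pressure are $$Z_N(\kappa,\beta,h;J)=\sum_{\sigma\in\{-1,+1\}^{\Lambda_N}}\exp\Big(-\kappa H^I_N(\sigma)-\beta H^{SK}_N(\sigma;J)+h\sum_{i\in\Lambda_N}\sigma_i\Big),\qquad p_N(\kappa,\beta,h;J)=\frac{1}{|\Lambda_N|}\log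 Z_N(\kappa,\beta,h;J).$$ *)

theory Defs
  imports "HOL-Probability.Probability"
begin

text \<open>The lattice in dimension \<open>CARD('d)\<close> is the type \<^typ>\<open>int ^ 'd\<close>. The Euclidean norm is used on it.\<close>

definition lattice_norm :: "int ^ 'd \<Rightarrow> real" where
  "lattice_norm i = norm (\<chi> k. real_of_int (i $ k))"

definition lattice_box :: "nat \<Rightarrow> (int ^ 'd) set" where
  "lattice_box N = {i. \<forall>k. i $ k \<in> {- int N..int N}}"

definition spins :: "nat \<Rightarrow> (int ^ 'd \<Rightarrow> real) set" where
  "spins N = (lattice_box N \<rightarrow>\<^sub>E {-1, 1})"

definition H_Ising :: "(int ^ 'd \<Rightarrow> real) \<Rightarrow> nat \<Rightarrow> (int ^ 'd \<Rightarrow> real) \<Rightarrow> real" where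
  "H_Ising K N \<sigma> = - (1 / 2) * (\<Sum>i\<in>lattice_box N. \<Sum>j\<in>lattice_box N. K (i - j) * \<sigma> i * \<sigma> j)"

definition H_SK ::
  "((int ^ 'd) \<times> (int ^ 'd) \<Rightarrow> real) \<Rightarrow> nat \<Rightarrow> (int ^ 'd \<Rightarrow> real) \<Rightarrow> real" where
  "H_SK J N \<sigma> =
     - (1 / sqrt (2 * real (card (lattice_box N :: (int ^ 'd) set)))) *
       (\<Sum>i\<in>lattice_box N. \<Sum>j\<in>lattice_box N. J (i, j) * \<sigma> i * \<sigma> j)"

definition partition_function ::
  "(int ^ 'd \<Rightarrow> real) \<Rightarrow> real \<Rightarrow> real \<Rightarrow> real \<Rightarrow> nat \<Rightarrow> ((int ^ 'd) \<times> (int ^ 'd) \<Rightarrow> real) \<Rightarrow> real" where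
  "partition_function K \<kappa> \<beta> h N J =
     (\<Sum>\<sigma>\<in>spins N. exp (- \<kappa> * H_Ising K N \<sigma> - \<beta> * H_SK J N \<sigma> + h * (\<Sum>i\<in>lattice_box N. \<sigma> i)))"

definition pressure ::
  "(int ^ 'd \<Rightarrow> real) \<Rightarrow> real \<Rightarrow> real \<Rightarrow> real \<Rightarrow> nat \<Rightarrow> ((int ^ 'd) \<times> (int ^ 'd) \<Rightarrow> real) \<Rightarrow> real" where
  "pressure K \<kappa> \<beta> h N J =
     1 / real (card (lattice_box N :: (int ^ 'd) set)) * ln (partition_function K \<kappa> \<beta> h N J)"

definition in_Lp :: "'a measure \<Rightarrow> real \<Rightarrow> ('a \<Rightarrow> real) \<Rightarrow> bool" where
  "in_Lp M q f \<longleftrightarrow> f \<in> borel_measurable M \<and> integrable M (\<lambda>x. \<bar>f x\<bar> powr q)"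

definition Lp_norm :: "'a measure \<Rightarrow> real \<Rightarrow> ('a \<Rightarrow> real) \<Rightarrow> real" where
  "Lp_norm M q f = (\<integral>x. \<bar>f x\<bar> powr q \<partial>M) powr (1 / q)"

text \<open>
  Membership in \<open>L\<^sup>q\<close> is part of convergence, because the integral of a non-integrable
  function is 0.
\<close>

definition converges_in_Lp ::
  "'a measure \<Rightarrow> real \<Rightarrow> (nat \<Rightarrow> 'a \<Rightarrow> real) \<Rightarrow> ('a \<Rightarrow> real) \<Rightarrow> bool" where
  "converges_in_Lp M q X Y \<longleftrightarrow>
     (\<forall>n. in_Lp M q (X n)) \<and> in_Lp M q Y \<and>
     (\<lambda>n. Lp_norm M q (\<lambda>x. X n x - Y x)) \<longlonglongrightarrow> 0"

end

theory Submission
  imports Defs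
begin

text \<open>
  Write \<open>F A\<close> for the mean of \<open>ln Z\<close> on a finite set \<open>A\<close> of sites. Two facts give the theorem:
  \<open>F\<close> is superadditive up to the interaction that \<open>K\<close> carries across the cut, and \<open>ln Z\<close> deviates
  from \<open>F A\<close> by an amount of order \<open>sqrt (card A)\<close> only.

  \<^bold>\<open>Superadditivity.\<close> Take disjoint \<open>B\<close> and \<open>C\<close>. The spin glass on \<open>B \<union> C\<close> and the two independent
  spin glasses on \<open>B\<close> and on \<open>C\<close> both have energies of the form \<open>\<Sum>e. sqrt (v e) * J e * s e \<sigma>\<close> with
  the products \<open>s (i, j) \<sigma> = \<sigma> i * \<sigma> j\<close> and different variance profiles \<open>v\<close>. So one family \<open>J\<close> of
  Gaussian variables serves for the whole interpolation between them: it moves \<open>v\<close> along a segment.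
  By Gaussian integration by parts, the derivative of the mean of \<open>ln Z\<close> along the segment is half the
  expected sum of \<open>v' e\<close> times the Gibbs variance of \<open>s e\<close>. With two replicas \<open>\<sigma>, \<tau>\<close> this is
  an average of \<open>\<Sum>e. v' e * (s e \<sigma> - s e \<tau>)\<^sup>2\<close>, up to a positive factor. Hence it suffices
  that each of these sums is nonnegative (\<open>gaussian_comparison\<close>, a statement of Sudakov-Fernique type).
  For the profiles above this is the convexity inequality
  \<open>(y + z)\<^sup>2 / (b + c) \<le> y\<^sup>2 / b + z\<^sup>2 / c\<close> for the overlaps \<open>y, z\<close> on blocks of \<open>b\<close> and \<open>c\<close> sites,
  as in the argument of Guerra and Toninelli. The Ising term between \<open>B\<close> and \<open>C\<close> is dropped at a cost
  bounded by the sum of \<open>\<bar>K\<bar>\<close> over the pairs that are cut (\<open>free_energy_superadditive\<close>).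

  \<^bold>\<open>Limit of the mean.\<close> A large box is cut into translates of a box of side \<open>L\<close> and single leftover
  sites, which are a vanishing fraction. All translates have the same mean because \<open>K\<close> depends on
  differences only and \<open>J\<close> is i.i.d. Since \<open>\<Sum>k. \<bar>K k\<bar> * \<bar>k\<bar>\<close> converges, the cost of cutting is of
  order \<open>1 / L\<close> per site. Thus every mean pressure of a fixed box is, up to an error that tends to 0 with
  the size of that box, a lower bound for all later ones; as the mean pressures are bounded above by the annealed
  bound, they converge (\<open>mean_pressure_converges\<close>).

  \<^bold>\<open>Concentration.\<close> The pressure on \<open>n\<close> sites is Lipschitz in each \<open>J e\<close>, and the squares of the
  Lipschitz constants sum to \<open>\<beta>\<^sup>2 / (2 * n)\<close>. Integrating out one variable at a time gives
  a Gaussian bound on the moment generating function (\<open>gaussian_concentration\<close>), hence the \<open>q\<close>-th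
  absolute moment of the deviation from the mean is of order \<open>n powr (- q / 2)\<close> for every \<open>q\<close>. This
  is convergence in every \<open>L\<^sup>q\<close>; and with \<open>q = 4\<close> the moments are summable over the boxes in
  every dimension, which gives almost sure convergence.
\<close>

section \<open>One standard normal variable\<close>

lemma prob_space_std_normal: "prob_space std_normal_distribution"
  by (rule prob_space_normal_density) simp

interpretation std_normal: prob_space std_normal_distribution
  by (rule prob_space_std_normal)

lemma measure_std_normal_UNIV [simp]: "measure std_normal_distribution UNIV = 1"
  using std_normal.prob_space by simp

lemma std_normal_density_tendsto_0:
  "(std_normal_density \<longlongrightarrow> 0) at_top" "(std_normal_density \<longlongrightarrow> 0) at_bot"
proof -
  have sq: "filterlim (\<lambda>x::real. - x\<^sup>2 / 2) at_bot at_infinity"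
  proof -
    have "filterlim (\<lambda>x::real. (norm x)^2 * (1/2)) at_top at_infinity"
      by (intro filterlim_at_top_mult_tendsto_pos[of _ "1/2"] filterlim_pow_at_top filterlim_norm_at_top tendsto_const) auto
    then show ?thesis by (simp add: filterlim_uminus_at_top)
  qed
  have "((\<lambda>x::real. exp (- x\<^sup>2 / 2)) \<longlongrightarrow> 0) at_infinity"
    by (rule filterlim_compose[OF exp_at_bot sq])
  then have "(std_normal_density \<longlongrightarrow> 1 / sqrt (2 * pi) * 0) at_infinity"
    unfolding std_normal_density_def by (intro tendsto_intros)
  then have *: "(std_normal_density \<longlongrightarrow> 0) at_infinity" by simp
  show "(std_normal_density \<longlongrightarrow> 0) at_top" "(std_normal_density \<longlongrightarrow> 0) at_bot"
    using * by (auto intro: tendsto_mono at_top_le_at_infinity at_bot_le_at_infinity)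
qed

lemma DERIV_std_normal_density:
  "(std_normal_density has_real_derivative - y * std_normal_density y) (at y)"
  unfolding std_normal_density_def
  by (auto intro!: derivative_eq_intros simp: field_simps)

lemma integrable_std_normal_abs: "integrable std_normal_distribution (\<lambda>y. \<bar>y\<bar>)"
  using integrable_std_normal_distribution_moment[of 1] by simp

text \<open>
  The density \<open>\<phi>\<close> satisfies \<open>\<phi>' y = - y * \<phi> y\<close>, so
  \<open>\<phi> y * (G' y - y * G y)\<close> is the derivative of \<open>\<phi> * G\<close>, which
  vanishes at both ends of the line.
\<close>

lemma std_normal_integration_by_parts:
  fixes G G' :: "real \<Rightarrow> real"
  assumes deriv: "\<And>y. (G has_real_derivative G' y) (at y)"
    and cont: "\<And>y. isCont G' y"
    and bound: "\<And>y. \<bar>G y\<bar> \<le> A" and bound': "\<And>y. \<bar>G' y\<bar> \<le> B"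
  shows "(\<integral>y. y * G y \<partial>std_normal_distribution) = (\<integral>y. G' y \<partial>std_normal_distribution)"
proof -
  have contG: "isCont G y" for y using deriv DERIV_isCont by blast
  have [measurable]: "G \<in> borel_measurable borel" "G' \<in> borel_measurable borel"
    using cont contG by (auto intro!: borel_measurable_continuous_onI simp: continuous_at_imp_continuous_on)
  have i1: "integrable std_normal_distribution G'"
    by (rule std_normal.integrable_const_bound[of _ B]) (use bound' in auto)
  have i2: "integrable std_normal_distribution (\<lambda>y. y * G y)"
  proof (rule Bochner_Integration.integrable_bound)
    show "integrable std_normal_distribution (\<lambda>y. A * \<bar>y\<bar>)"
      using integrable_std_normal_abs by simp
    show "AE y in std_normal_distribution. norm (y * G y) \<le> norm (A * \<bar>y\<bar>)"
    proof (rule AE_I2)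
      fix y show "norm (y * G y) \<le> norm (A * \<bar>y\<bar>)"
        using mult_right_mono[OF bound[of y], of "\<bar>y\<bar>"] bound[of y]
        by (simp add: abs_mult mult.commute)
    qed
  qed simp
  define F where "F y = std_normal_density y * G y" for y
  define f where "f y = std_normal_density y * (G' y - y * G y)" for y
  have int_f: "integrable lborel f"
    using Bochner_Integration.integrable_diff[OF i1 i2] unfolding f_def
    by (subst (asm) integrable_density) (auto simp: normal_density_nonneg)
  have dF: "(F has_real_derivative f y) (at y)" for y
    unfolding F_def f_def
    by (rule derivative_eq_intros DERIV_std_normal_density deriv refl)+ (simp add: algebra_simps)
  have contf: "isCont f y" for y unfolding f_def
    by (intro continuous_intros cont contG DERIV_isCont[OF DERIV_std_normal_density])
  have lim: "(F \<longlongrightarrow> 0) at_top" "(F \<longlongrightarrow> 0) at_bot"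
  proof -
    have le: "norm (F y) \<le> A * std_normal_density y" for y
      using mult_right_mono[OF bound[of y], of "std_normal_density y"]
      unfolding F_def by (simp add: abs_mult mult.commute normal_density_nonneg)
    have "((\<lambda>y. A * std_normal_density y) \<longlongrightarrow> A * 0) at_top"
         "((\<lambda>y. A * std_normal_density y) \<longlongrightarrow> A * 0) at_bot"
      by (intro tendsto_intros std_normal_density_tendsto_0)+
    then show "(F \<longlongrightarrow> 0) at_top" "(F \<longlongrightarrow> 0) at_bot"
      by (auto intro!: Lim_null_comparison[of F "\<lambda>y. A * std_normal_density y"] always_eventually le)
  qed
  have "(LBINT y=-\<infinity>..\<infinity>. f y) = 0 - 0"
  proof (rule interval_integral_FTC_integrable[where F=F])
    show "set_integrable lborel (einterval (- \<infinity>) \<infinity>) f"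
      using int_f by (simp add: set_integrable_def einterval_def)
    show "((F \<circ> real_of_ereal) \<longlongrightarrow> 0) (at_right (- \<infinity>))" "((F \<circ> real_of_ereal) \<longlongrightarrow> 0) (at_left \<infinity>)"
      using lim by (simp_all add: ereal_tendsto_simps)
    show "(F has_vector_derivative f y) (at y)" for y
      using dF by (simp add: has_real_derivative_iff_has_vector_derivative)
  qed (use contf in auto)
  then have "integral\<^sup>L lborel f = 0"
    by (simp add: interval_lebesgue_integral_def einterval_def set_lebesgue_integral_def)
  then have "(\<integral>y. G' y - y * G y \<partial>std_normal_distribution) = 0"
    unfolding f_def by (subst integral_density) (auto simp: normal_density_nonneg)
  with i1 i2 show ?thesis by simp
qed

text \<open>
  Completing the square turns the integrand into a multiple of the normal density with mean \<open>c\<close>.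
\<close>

lemma nn_integral_exp_std_normal:
  "(\<integral>\<^sup>+y. ennreal (exp (c * y)) \<partial>std_normal_distribution) = ennreal (exp (c\<^sup>2 / 2))"
proof -
  have "(\<integral>\<^sup>+y. ennreal (exp (c * y)) \<partial>std_normal_distribution)
      = (\<integral>\<^sup>+y. ennreal (exp (c\<^sup>2 / 2)) * ennreal (normal_density c 1 y) \<partial>lborel)"
  proof (subst nn_integral_density, simp, simp, rule nn_integral_cong)
    fix y :: real
    have "- y\<^sup>2 / 2 + c * y = c\<^sup>2 / 2 + (- (y - c)\<^sup>2 / 2)"
      by (simp add: power2_eq_square field_simps)
    then have "exp (- y\<^sup>2 / 2) * exp (c * y) = exp (c\<^sup>2 / 2) * exp (- (y - c)\<^sup>2 / 2)"
      by (simp add: exp_add[symmetric])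
    then have "std_normal_density y * exp (c * y) = exp (c\<^sup>2 / 2) * normal_density c 1 y"
      unfolding normal_density_def by simp
    then show "ennreal (std_normal_density y) * ennreal (exp (c * y))
        = ennreal (exp (c\<^sup>2 / 2)) * ennreal (normal_density c 1 y)"
      by (simp add: ennreal_mult[symmetric] normal_density_nonneg)
  qed
  also have "\<dots> = ennreal (exp (c\<^sup>2 / 2)) * (\<integral>\<^sup>+y. ennreal (normal_density c 1 y) \<partial>lborel)"
    by (rule nn_integral_cmult) simp
  also have "(\<integral>\<^sup>+y. ennreal (normal_density c 1 y) \<partial>lborel) = ennreal 1"
    by (subst nn_integral_eq_integral) (auto simp: normal_density_nonneg)
  finally show ?thesis by simp
qed

lemma nn_integral_exp_diff_std_normal:
  "(\<integral>\<^sup>+y. \<integral>\<^sup>+z. ennreal (exp (c * (y - z))) \<partial>std_normal_distribution \<partial>std_normal_distribution)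
   = ennreal (exp (c\<^sup>2))"
proof -
  have *: "ennreal (exp (c * (y - z))) = ennreal (exp (c * y)) * ennreal (exp ((-c) * z))" for y z
    by (simp add: ennreal_mult[symmetric] exp_add[symmetric] algebra_simps)
  have "(\<integral>\<^sup>+z. ennreal (exp (c * (y - z))) \<partial>std_normal_distribution)
      = ennreal (exp (c * y)) * ennreal (exp (c\<^sup>2 / 2))" for y
    unfolding * by (subst nn_integral_cmult) (simp_all add: nn_integral_exp_std_normal[of "- c", simplified])
  then have "(\<integral>\<^sup>+y. \<integral>\<^sup>+z. ennreal (exp (c * (y - z))) \<partial>std_normal_distribution \<partial>std_normal_distribution)
      = ennreal (exp (c\<^sup>2 / 2)) * ennreal (exp (c\<^sup>2 / 2))"
    by (simp only:) (simp add: nn_integral_multc nn_integral_exp_std_normal)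
  then show ?thesis by (simp add: ennreal_mult[symmetric] exp_add[symmetric])
qed

lemma lipschitz_borel_measurable:
  fixes g :: "real \<Rightarrow> real"
  assumes "\<And>y z. \<bar>g y - g z\<bar> \<le> L * \<bar>y - z\<bar>"
  shows "g \<in> borel_measurable borel"
proof -
  have "0 \<le> L" using order_trans[OF abs_ge_zero assms[of 1 0]] by simp
  then have "L-lipschitz_on UNIV g" using assms by (intro lipschitz_onI) (auto simp: dist_real_def)
  then show ?thesis by (intro borel_measurable_continuous_onI lipschitz_on_continuous_on)
qed

lemma lipschitz_integrable_std_normal:
  fixes g :: "real \<Rightarrow> real"
  assumes lip: "\<And>y z. \<bar>g y - g z\<bar> \<le> L * \<bar>y - z\<bar>"
  shows "integrable std_normal_distribution g"
proof (rule Bochner_Integration.integrable_bound)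
  show "integrable std_normal_distribution (\<lambda>y. \<bar>g 0\<bar> + L * \<bar>y\<bar>)"
    using integrable_std_normal_abs by simp
  show "g \<in> borel_measurable std_normal_distribution"
    using lipschitz_borel_measurable[OF lip] by simp
  show "AE y in std_normal_distribution. norm (g y) \<le> norm (\<bar>g 0\<bar> + L * \<bar>y\<bar>)"
    using lip[of _ 0] by (intro AE_I2) (smt (verit) diff_zero real_norm_def)
qed

text \<open>
  By convexity the mean of \<open>g\<close> can be replaced by the value of \<open>g\<close> at an independent
  copy. The difference of the two copies is symmetric, so its exponential may be replaced by a hyperbolic
  cosine, to which the Lipschitz bound applies. Working with the cosine avoids a factor 2, which would be
  raised to the number of variables in the product.
\<close>

lemma gaussian_concentration_one_variable:
  fixes g :: "real \<Rightarrow> real"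
  assumes lip: "\<And>y z. \<bar>g y - g z\<bar> \<le> L * \<bar>y - z\<bar>"
  shows "(\<integral>\<^sup>+y. ennreal (exp (t * (g y - (\<integral>z. g z \<partial>std_normal_distribution)))) \<partial>std_normal_distribution)
         \<le> ennreal (exp (t\<^sup>2 * L\<^sup>2))"
proof -
  let ?N = "std_normal_distribution"
  define m where "m = (\<integral>z. g z \<partial>?N)"
  define D where "D = (\<integral>\<^sup>+y. \<integral>\<^sup>+z. ennreal (exp (t * (g y - g z))) \<partial>?N \<partial>?N)"
  have g[measurable]: "g \<in> borel_measurable borel" by (rule lipschitz_borel_measurable[OF lip])
  have int_g: "integrable ?N g" by (rule lipschitz_integrable_std_normal[OF lip])
  have jensen: "ennreal (exp (- t * m)) \<le> (\<integral>\<^sup>+z. ennreal (exp (- t * g z)) \<partial>?N)"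
  proof -
    have tangent: "exp (- t * m) * (1 + (- t * g z - (- t * m))) \<le> exp (- t * g z)" for z
    proof -
      have "exp (- t * m) * (1 + (- t * g z - (- t * m))) \<le> exp (- t * m) * exp (- t * g z - (- t * m))"
        using exp_ge_add_one_self by (intro mult_left_mono) auto
      then show ?thesis by (simp add: exp_add[symmetric])
    qed
    have "exp (- t * m) = (\<integral>z. exp (- t * m) * (1 + (- t * g z - (- t * m))) \<partial>?N)"
      using int_g by (simp add: m_def[symmetric] std_normal.prob_space algebra_simps)
    also have "\<dots> \<le> (\<integral>z. max 0 (exp (- t * m) * (1 + (- t * g z - (- t * m)))) \<partial>?N)"
      using int_g by (intro integral_mono Bochner_Integration.integrable_max) auto
    finally have "ennreal (exp (- t * m)) \<le> ennreal (\<integral>z. max 0 (exp (- t * m) * (1 + (- t * g z - (- t * m)))) \<partial>?N)"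
      by (rule ennreal_leI)
    also have "\<dots> = (\<integral>\<^sup>+z. ennreal (max 0 (exp (- t * m) * (1 + (- t * g z - (- t * m))))) \<partial>?N)"
      using int_g by (intro nn_integral_eq_integral[symmetric] Bochner_Integration.integrable_max) auto
    also have "\<dots> \<le> (\<integral>\<^sup>+z. ennreal (exp (- t * g z)) \<partial>?N)"
      using tangent by (intro nn_integral_mono ennreal_leI max.boundedI exp_ge_zero)
    finally show ?thesis .
  qed
  have "(\<integral>\<^sup>+y. ennreal (exp (t * (g y - m))) \<partial>?N)
      = (\<integral>\<^sup>+y. ennreal (exp (t * g y)) * ennreal (exp (- t * m)) \<partial>?N)"
    by (simp add: ennreal_mult[symmetric] exp_add[symmetric] algebra_simps)
  also have "\<dots> \<le> (\<integral>\<^sup>+y. ennreal (exp (t * g y)) * (\<integral>\<^sup>+z. ennreal (exp (- t * g z)) \<partial>?N) \<partial>?N)"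
    using jensen by (intro nn_integral_mono mult_left_mono) auto
  also have "\<dots> = D"
    unfolding D_def
    by (subst nn_integral_cmult[symmetric])
       (auto simp: ennreal_mult[symmetric] exp_add[symmetric] algebra_simps)
  finally have le_D: "(\<integral>\<^sup>+y. ennreal (exp (t * (g y - m))) \<partial>?N) \<le> D" .
  have pair: "pair_sigma_finite ?N ?N"
    by (simp add: pair_sigma_finite_def std_normal.sigma_finite_measure_axioms)
  have sym: "D = (\<integral>\<^sup>+y. \<integral>\<^sup>+z. ennreal (exp (- (t * (g y - g z)))) \<partial>?N \<partial>?N)"
    unfolding D_def
    by (subst pair_sigma_finite.Fubini'[OF pair]) (auto simp: algebra_simps)
  have cosh_mono: "exp u + exp (- u) \<le> exp v + exp (- v)" if "\<bar>u\<bar> \<le> \<bar>v\<bar>" for u v :: real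
    using cosh_real_nonneg_le_iff[of "\<bar>u\<bar>" "\<bar>v\<bar>"] that by (auto simp: cosh_def abs_if split: if_splits)
  (* By symmetry, D is half of the integral of the sum of both exponentials. *)
  have "D + D = (\<integral>\<^sup>+y. \<integral>\<^sup>+z. ennreal (exp (t * (g y - g z)) + exp (- (t * (g y - g z)))) \<partial>?N \<partial>?N)"
    by (subst (2) sym) (simp add: D_def nn_integral_add)
  also have "\<dots> \<le> (\<integral>\<^sup>+y. \<integral>\<^sup>+z. ennreal (exp (t * L * (y - z)) + exp (- (t * L * (y - z)))) \<partial>?N \<partial>?N)"
  proof (intro nn_integral_mono ennreal_leI cosh_mono)
    fix y z :: real
    have "0 \<le> L" using order_trans[OF abs_ge_zero lip[of 1 0]] by simp
    then show "\<bar>t * (g y - g z)\<bar> \<le> \<bar>t * L * (y - z)\<bar>"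
      using mult_left_mono[OF lip[of y z], of "\<bar>t\<bar>"] by (simp add: abs_mult mult.assoc)
  qed
  also have "\<dots> = (\<integral>\<^sup>+y. \<integral>\<^sup>+z. ennreal (exp (t * L * (y - z))) \<partial>?N \<partial>?N)
      + (\<integral>\<^sup>+y. \<integral>\<^sup>+z. ennreal (exp ((- t * L) * (y - z))) \<partial>?N \<partial>?N)"
    by (simp add: nn_integral_add)
  also have "\<dots> = ennreal (exp (t\<^sup>2 * L\<^sup>2)) + ennreal (exp (t\<^sup>2 * L\<^sup>2))"
    unfolding nn_integral_exp_diff_std_normal by (simp add: power_mult_distrib)
  finally have "D + D \<le> ennreal (exp (t\<^sup>2 * L\<^sup>2)) + ennreal (exp (t\<^sup>2 * L\<^sup>2))" .
  then have "D \<le> ennreal (exp (t\<^sup>2 * L\<^sup>2))"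
    by (metis add_strict_mono leD leI)
  with le_D show ?thesis unfolding m_def by simp
qed

section \<open>Concentration for functions of independent normal variables\<close>

abbreviation gauss :: "'i set \<Rightarrow> ('i \<Rightarrow> real) measure" where
  "gauss I \<equiv> PiM I (\<lambda>_. std_normal_distribution)"

interpretation gauss: product_sigma_finite "\<lambda>_. std_normal_distribution"
  by unfold_locales

lemma sets_gauss [measurable_cong]: "sets (gauss I) = sets (PiM I (\<lambda>_. borel))"
  by (intro sets_PiM_cong) auto

lemma prob_space_gauss: "prob_space (gauss I)"
  by (intro prob_space_PiM prob_space_std_normal)

text \<open>
  One constant per coordinate: the concentration bound depends on the sum of their squares.
\<close>

definition coord_lipschitz :: "'i set \<Rightarrow> ('i \<Rightarrow> real) \<Rightarrow> (('i \<Rightarrow> real) \<Rightarrow> real) \<Rightarrow> bool" where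
  "coord_lipschitz I L f \<longleftrightarrow> (\<forall>x. \<forall>i\<in>I. \<forall>y z. \<bar>f (x(i := y)) - f (x(i := z))\<bar> \<le> L i * \<bar>y - z\<bar>)"

lemma coord_lipschitzD:
  "coord_lipschitz I L f \<Longrightarrow> i \<in> I \<Longrightarrow> \<bar>f (x(i := y)) - f (x(i := z))\<bar> \<le> L i * \<bar>y - z\<bar>"
  unfolding coord_lipschitz_def by blast

lemma coord_lipschitz_nonneg: "coord_lipschitz I L f \<Longrightarrow> i \<in> I \<Longrightarrow> 0 \<le> L i"
  using order_trans[OF abs_ge_zero coord_lipschitzD[of I L f i undefined 1 0]] by simp

lemma coord_lipschitz_scale:
  assumes "coord_lipschitz I L f" "0 \<le> c"
  shows "coord_lipschitz I (\<lambda>i. c * L i) (\<lambda>x. c * f x)"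
  unfolding coord_lipschitz_def
proof (intro allI ballI)
  fix x i y z assume "i \<in> I"
  from mult_left_mono[OF coord_lipschitzD[OF assms(1) this] assms(2)]
  show "\<bar>c * f (x(i := y)) - c * f (x(i := z))\<bar> \<le> c * L i * \<bar>y - z\<bar>"
    using assms(2) by (simp add: right_diff_distrib[symmetric] abs_mult mult.assoc)
qed

lemma coord_lipschitz_fix:
  assumes "coord_lipschitz (insert i I) L f" "i \<notin> I"
  shows "coord_lipschitz I L (\<lambda>x. f (x(i := y)))"
  unfolding coord_lipschitz_def
proof (intro allI ballI)
  fix x j u v assume j: "j \<in> I"
  then have "j \<noteq> i" using assms(2) by auto
  then show "\<bar>f (x(j := u, i := y)) - f (x(j := v, i := y))\<bar> \<le> L j * \<bar>u - v\<bar>"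
    using coord_lipschitzD[OF assms(1), of j "x(i := y)" u v] j by (simp add: fun_upd_twist)
qed

lemma coord_lipschitz_integrate:
  assumes lip: "coord_lipschitz (insert i I) L f" and i: "i \<notin> I"
  shows "coord_lipschitz I L (\<lambda>x. \<integral>y. f (x(i := y)) \<partial>std_normal_distribution)"
  unfolding coord_lipschitz_def
proof (intro allI ballI)
  fix x j u v assume j: "j \<in> I"
  have int: "integrable std_normal_distribution (\<lambda>y. f (x(i := y)))" for x
    by (rule lipschitz_integrable_std_normal[of _ "L i"]) (rule coord_lipschitzD[OF lip], simp)
  have "\<bar>(\<integral>y. f (x(j := u, i := y)) \<partial>std_normal_distribution) - (\<integral>y. f (x(j := v, i := y)) \<partial>std_normal_distribution)\<bar>
     = \<bar>\<integral>y. f (x(j := u, i := y)) - f (x(j := v, i := y)) \<partial>std_normal_distribution\<bar>"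
    by (simp add: int)
  also have "\<dots> \<le> (\<integral>y. \<bar>f (x(j := u, i := y)) - f (x(j := v, i := y))\<bar> \<partial>std_normal_distribution)"
    by (rule integral_abs_bound)
  also have "\<dots> \<le> (\<integral>y. L j * \<bar>u - v\<bar> \<partial>std_normal_distribution)"
    by (intro integral_mono Bochner_Integration.integrable_abs Bochner_Integration.integrable_diff int
          coord_lipschitzD[OF coord_lipschitz_fix[OF lip i] j]) auto
  finally show "\<bar>(\<integral>y. f (x(j := u, i := y)) \<partial>std_normal_distribution) - (\<integral>y. f (x(j := v, i := y)) \<partial>std_normal_distribution)\<bar>
     \<le> L j * \<bar>u - v\<bar>" by simp
qed

text \<open>
  In one more variable, \<open>f\<close> differs from its section at 0 by at most a multiple of the modulus of
  that variable.
\<close>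

lemma coord_lipschitz_integrable:
  assumes "finite I" "f \<in> borel_measurable (gauss I)" "coord_lipschitz I L f"
  shows "integrable (gauss I) f"
  using assms
proof (induction I arbitrary: f rule: finite_induct)
  case empty
  have sp: "space (gauss {}) = {\<lambda>_. undefined}" by (simp add: space_PiM)
  interpret prob_space "gauss ({} :: 'a set)" by (rule prob_space_gauss)
  show ?case
    by (rule integrable_const_bound[of _ "\<bar>f (\<lambda>_. undefined)\<bar>"]) (use empty in \<open>auto intro!: AE_I2 simp: sp\<close>)
next
  case (insert i I)
  note [measurable] = insert.prems(1)
  have meas0: "(\<lambda>x. f (x(i := 0))) \<in> borel_measurable (gauss I)"
    by measurable
  have int0: "integrable (gauss I) (\<lambda>x. f (x(i := 0)))"
    by (intro insert.IH meas0 coord_lipschitz_fix[OF insert.prems(2) insert.hyps(2)])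
  let ?c = "(\<integral>\<^sup>+y. ennreal (L i * \<bar>y\<bar>) \<partial>std_normal_distribution)"
  have c: "?c < \<infinity>"
    using integrable_std_normal_abs coord_lipschitz_nonneg[OF insert.prems(2), of i]
    by (subst nn_integral_eq_integral) auto
  have "(\<integral>\<^sup>+x. ennreal \<bar>f x\<bar> \<partial>gauss (insert i I))
      = (\<integral>\<^sup>+x. \<integral>\<^sup>+y. ennreal \<bar>f (x(i := y))\<bar> \<partial>std_normal_distribution \<partial>gauss I)"
    by (subst gauss.product_nn_integral_insert) (use insert.hyps in auto)
  also have "\<dots> \<le> (\<integral>\<^sup>+x. \<integral>\<^sup>+y. ennreal \<bar>f (x(i := 0))\<bar> + ennreal (L i * \<bar>y\<bar>) \<partial>std_normal_distribution \<partial>gauss I)"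
  proof (intro nn_integral_mono)
    fix x y
    have "\<bar>f (x(i := y))\<bar> \<le> \<bar>f (x(i := 0))\<bar> + L i * \<bar>y\<bar>"
      using coord_lipschitzD[OF insert.prems(2) insertI1, of x y 0] unfolding diff_zero by linarith
    then have "ennreal \<bar>f (x(i := y))\<bar> \<le> ennreal (\<bar>f (x(i := 0))\<bar> + L i * \<bar>y\<bar>)"
      by (rule ennreal_leI)
    also have "\<dots> = ennreal \<bar>f (x(i := 0))\<bar> + ennreal (L i * \<bar>y\<bar>)"
      using coord_lipschitz_nonneg[OF insert.prems(2), of i] by (intro ennreal_plus) auto
    finally show "ennreal \<bar>f (x(i := y))\<bar> \<le> ennreal \<bar>f (x(i := 0))\<bar> + ennreal (L i * \<bar>y\<bar>)" .
  qed
  also have "\<dots> = (\<integral>\<^sup>+x. ennreal \<bar>f (x(i := 0))\<bar> \<partial>gauss I) + ?c"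
    using std_normal.emeasure_space_1
    by (simp add: nn_integral_add meas0 prob_space.emeasure_space_1[OF prob_space_gauss])
  also have "\<dots> < \<infinity>"
    using c int0 by (simp add: integrable_iff_bounded)
  finally show ?case by (simp add: integrable_iff_bounded insert.prems(1))
qed

text \<open>
  The martingale method: \<open>g\<close>, the mean of \<open>f\<close> over one variable, inherits the
  Lipschitz constants in the other variables. The fluctuation of \<open>f\<close> about \<open>g\<close> is
  handled by the one-variable estimate for each value of the others, and that of \<open>g\<close> about its
  mean by induction.
\<close>

lemma gaussian_concentration:
  assumes "finite I" "f \<in> borel_measurable (gauss I)" "coord_lipschitz I L f"
  shows "(\<integral>\<^sup>+x. ennreal (exp (t * (f x - (\<integral>z. f z \<partial>gauss I)))) \<partial>gauss I)
     \<le> ennreal (exp (t\<^sup>2 * (\<Sum>i\<in>I. (L i)\<^sup>2)))"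
  using assms
proof (induction I arbitrary: f rule: finite_induct)
  case empty
  then show ?case
    by (simp add: PiM_empty lebesgue_integral_count_space_finite nn_integral_count_space_finite)
next
  case (insert i I)
  note lip = insert.prems(2)
  note [measurable] = insert.prems(1)
  define g where "g x = (\<integral>y. f (x(i := y)) \<partial>std_normal_distribution)" for x
  have g[measurable]: "g \<in> borel_measurable (gauss I)"
    unfolding g_def by measurable
  have lip_g: "coord_lipschitz I L g"
    unfolding g_def by (rule coord_lipschitz_integrate[OF lip insert.hyps(2)])
  have int_f: "integrable (gauss (insert i I)) f"
    by (rule coord_lipschitz_integrable) (use insert in auto)
  define m where "m = (\<integral>z. f z \<partial>gauss (insert i I))"
  have m: "m = (\<integral>x. g x \<partial>gauss I)"
    unfolding m_def g_def by (rule gauss.product_integral_insert[OF insert.hyps int_f])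
  have split: "t * (f x - m) = t * (g y - m) + t * (f x - g y)" for x y
    by (simp add: algebra_simps)
  have "(\<integral>\<^sup>+x. ennreal (exp (t * (f x - m))) \<partial>gauss (insert i I))
      = (\<integral>\<^sup>+x. \<integral>\<^sup>+y. ennreal (exp (t * (f (x(i := y)) - m))) \<partial>std_normal_distribution \<partial>gauss I)"
    by (subst gauss.product_nn_integral_insert) (use insert.hyps in auto)
  also have "\<dots> = (\<integral>\<^sup>+x. \<integral>\<^sup>+y. ennreal (exp (t * (g x - m))) * ennreal (exp (t * (f (x(i := y)) - g x)))
        \<partial>std_normal_distribution \<partial>gauss I)"
    by (intro nn_integral_cong, subst split) (simp add: exp_add ennreal_mult)
  also have "\<dots> = (\<integral>\<^sup>+x. ennreal (exp (t * (g x - m))) *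
        (\<integral>\<^sup>+y. ennreal (exp (t * (f (x(i := y)) - g x))) \<partial>std_normal_distribution) \<partial>gauss I)"
  proof (intro nn_integral_cong nn_integral_cmult)
    fix x
    have "(\<lambda>y. f (x(i := y))) \<in> borel_measurable borel"
      by (rule lipschitz_borel_measurable[of _ "L i"], rule coord_lipschitzD[OF lip]) simp
    then show "(\<lambda>y. ennreal (exp (t * (f (x(i := y)) - g x)))) \<in> borel_measurable std_normal_distribution"
      by simp
  qed
  also have "\<dots> \<le> (\<integral>\<^sup>+x. ennreal (exp (t * (g x - m))) * ennreal (exp (t\<^sup>2 * (L i)\<^sup>2)) \<partial>gauss I)"
    unfolding g_def
    by (intro nn_integral_mono mult_left_mono gaussian_concentration_one_variable
        coord_lipschitzD[OF lip]) auto
  also have "\<dots> = (\<integral>\<^sup>+x. ennreal (exp (t * (g x - m))) \<partial>gauss I) * ennreal (exp (t\<^sup>2 * (L i)\<^sup>2))"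
    by (simp add: nn_integral_multc)
  also have "\<dots> \<le> ennreal (exp (t\<^sup>2 * (\<Sum>i\<in>I. (L i)\<^sup>2))) * ennreal (exp (t\<^sup>2 * (L i)\<^sup>2))"
    using insert.IH[OF g lip_g] unfolding m by (rule mult_right_mono) simp
  also have "\<dots> = ennreal (exp (t\<^sup>2 * (\<Sum>i\<in>insert i I. (L i)\<^sup>2)))"
    using insert.hyps by (simp add: ennreal_mult[symmetric] exp_add[symmetric] algebra_simps)
  finally show ?case unfolding m_def .
qed

section \<open>Finite Gibbs measures\<close>

text \<open>
  The mean value theorem bounds all difference quotients by \<open>g\<close>, so dominated convergence applies
  along every sequence tending to \<open>t0\<close>.
\<close>

lemma DERIV_integral_dominated:
  fixes f f' :: "real \<Rightarrow> 'b \<Rightarrow> real"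
  assumes t0: "t0 \<in> {l<..<r}"
    and deriv: "\<And>t x. t \<in> {l<..<r} \<Longrightarrow> ((\<lambda>t. f t x) has_real_derivative f' t x) (at t)"
    and bound: "\<And>t x. t \<in> {l<..<r} \<Longrightarrow> \<bar>f' t x\<bar> \<le> g x"
    and g: "integrable M g"
    and f: "\<And>t. t \<in> {l<..<r} \<Longrightarrow> integrable M (f t)"
    and f': "f' t0 \<in> borel_measurable M"
  shows "((\<lambda>t. \<integral>x. f t x \<partial>M) has_real_derivative (\<integral>x. f' t0 x \<partial>M)) (at t0)"
  unfolding has_field_derivative_iff tendsto_at_iff_sequentially
proof (intro allI impI)
  fix X :: "nat \<Rightarrow> real"
  assume ne: "\<forall>i. X i \<in> UNIV - {t0}" and lim: "X \<longlonglongrightarrow> t0"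
  have "eventually (\<lambda>n. X n \<in> {l<..<r}) sequentially"
    using topological_tendstoD[OF lim open_greaterThanLessThan t0] .
  then obtain N where N: "\<And>n. n \<ge> N \<Longrightarrow> X n \<in> {l<..<r}" by (auto simp: eventually_sequentially)
  define Y where "Y n = X (n + N)" for n
  have Y: "Y n \<in> {l<..<r}" "Y n \<noteq> t0" for n using N[of "n + N"] ne by (auto simp: Y_def)
  have limY: "Y \<longlonglongrightarrow> t0" unfolding Y_def by (rule LIMSEQ_ignore_initial_segment[OF lim])
  have "(\<lambda>n. \<integral>x. (f (Y n) x - f t0 x) / (Y n - t0) \<partial>M) \<longlonglongrightarrow> (\<integral>x. f' t0 x \<partial>M)"
  proof (rule integral_dominated_convergence[where w = g])
    show "AE x in M. (\<lambda>n. (f (Y n) x - f t0 x) / (Y n - t0)) \<longlonglongrightarrow> f' t0 x"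
      using deriv[OF t0] limY Y(2)
      unfolding has_field_derivative_iff tendsto_at_iff_sequentially
      by (intro AE_I2) (auto simp: comp_def)
    show "AE x in M. norm ((f (Y n) x - f t0 x) / (Y n - t0)) \<le> g x" for n
    proof (rule AE_I2)
      fix x
      have "norm (f (Y n) x - f t0 x) \<le> g x * norm (Y n - t0)"
        by (rule field_differentiable_bound[where S = "{l<..<r}" and f = "\<lambda>t. f t x" and f' = "\<lambda>t. f' t x"])
           (use deriv bound Y t0 in \<open>auto intro: has_field_derivative_at_within\<close>)
      then show "norm ((f (Y n) x - f t0 x) / (Y n - t0)) \<le> g x"
        using Y(2)[of n] by (simp add: divide_le_eq)
    qed
  qed (use f' g f[OF t0] f[OF Y(1)] in auto)
  then have "(\<lambda>n. ((\<integral>x. f (Y n) x \<partial>M) - (\<integral>x. f t0 x \<partial>M)) / (Y n - t0)) \<longlonglongrightarrow> (\<integral>x. f' t0 x \<partial>M)"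
    using f[OF t0] f[OF Y(1)] by simp
  then have "(\<lambda>n. ((\<lambda>t. ((\<integral>x. f t x \<partial>M) - (\<integral>x. f t0 x \<partial>M)) / (t - t0)) \<circ> X) (n + N)) \<longlonglongrightarrow> (\<integral>x. f' t0 x \<partial>M)"
    by (simp add: Y_def comp_def)
  then show "((\<lambda>t. ((\<integral>x. f t x \<partial>M) - (\<integral>x. f t0 x \<partial>M)) / (t - t0)) \<circ> X) \<longlonglongrightarrow> (\<integral>x. f' t0 x \<partial>M)"
    by (rule LIMSEQ_offset)
qed

text \<open>
  A finite set of states \<open>S\<close> with a positive reference weight \<open>w\<close>. The energies are
  a parameter of the notions below, because they depend on the random couplings and on the interpolation.
\<close>

locale finite_gibbs =
  fixes S :: "'s set" and w :: "'s \<Rightarrow> real"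
  assumes finite_S: "finite S" and nonempty_S: "S \<noteq> {}"
    and weight_pos: "\<sigma> \<in> S \<Longrightarrow> 0 < w \<sigma>"
begin

definition logsumexp :: "('s \<Rightarrow> real) \<Rightarrow> real" where
  "logsumexp u = ln (\<Sum>\<sigma>\<in>S. w \<sigma> * exp (u \<sigma>))"

definition gibbs_mean :: "('s \<Rightarrow> real) \<Rightarrow> ('s \<Rightarrow> real) \<Rightarrow> real" where
  "gibbs_mean u X = (\<Sum>\<sigma>\<in>S. w \<sigma> * exp (u \<sigma>) * X \<sigma>) / (\<Sum>\<sigma>\<in>S. w \<sigma> * exp (u \<sigma>))"

lemma Z_pos: "0 < (\<Sum>\<sigma>\<in>S. w \<sigma> * exp (u \<sigma>))"
  by (intro sum_pos finite_S nonempty_S mult_pos_pos weight_pos) auto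

lemma logsumexp_mono_shift:
  assumes "\<And>\<sigma>. \<sigma> \<in> S \<Longrightarrow> u \<sigma> \<le> v \<sigma> + d"
  shows "logsumexp u \<le> logsumexp v + d"
proof -
  have "(\<Sum>\<sigma>\<in>S. w \<sigma> * exp (u \<sigma>)) \<le> (\<Sum>\<sigma>\<in>S. w \<sigma> * exp (v \<sigma>) * exp d)"
  proof (rule sum_mono)
    fix \<sigma> assume "\<sigma> \<in> S"
    then show "w \<sigma> * exp (u \<sigma>) \<le> w \<sigma> * exp (v \<sigma>) * exp d"
      using assms weight_pos by (simp add: exp_add[symmetric] mult.assoc)
  qed
  then have "ln (\<Sum>\<sigma>\<in>S. w \<sigma> * exp (u \<sigma>)) \<le> ln ((\<Sum>\<sigma>\<in>S. w \<sigma> * exp (v \<sigma>)) * exp d)"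
    using Z_pos[of u] by (simp add: sum_distrib_right)
  also have "\<dots> = ln (\<Sum>\<sigma>\<in>S. w \<sigma> * exp (v \<sigma>)) + d"
    using Z_pos[of v] by (simp add: ln_mult)
  finally show ?thesis by (simp add: logsumexp_def)
qed

lemma logsumexp_lipschitz:
  assumes "\<And>\<sigma>. \<sigma> \<in> S \<Longrightarrow> \<bar>u \<sigma> - v \<sigma>\<bar> \<le> d"
  shows "\<bar>logsumexp u - logsumexp v\<bar> \<le> d"
proof -
  have "logsumexp u \<le> logsumexp v + d" "logsumexp v \<le> logsumexp u + d"
    by (rule logsumexp_mono_shift, use assms in fastforce)+
  then show ?thesis by linarith
qed

lemma gibbs_mean_abs_le:
  assumes "\<And>\<sigma>. \<sigma> \<in> S \<Longrightarrow> \<bar>X \<sigma>\<bar> \<le> B"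
  shows "\<bar>gibbs_mean u X\<bar> \<le> B"
proof -
  have "\<bar>\<Sum>\<sigma>\<in>S. w \<sigma> * exp (u \<sigma>) * X \<sigma>\<bar> \<le> (\<Sum>\<sigma>\<in>S. \<bar>w \<sigma> * exp (u \<sigma>) * X \<sigma>\<bar>)" by (rule sum_abs)
  also have "\<dots> \<le> (\<Sum>\<sigma>\<in>S. w \<sigma> * exp (u \<sigma>) * B)"
  proof (rule sum_mono)
    fix \<sigma> assume \<sigma>: "\<sigma> \<in> S"
    have "w \<sigma> * exp (u \<sigma>) * \<bar>X \<sigma>\<bar> \<le> w \<sigma> * exp (u \<sigma>) * B"
      using weight_pos[OF \<sigma>] by (intro mult_left_mono assms \<sigma>) simp
    then show "\<bar>w \<sigma> * exp (u \<sigma>) * X \<sigma>\<bar> \<le> w \<sigma> * exp (u \<sigma>) * B"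
      using weight_pos[OF \<sigma>] by (simp add: abs_mult)
  qed
  also have "\<dots> = B * (\<Sum>\<sigma>\<in>S. w \<sigma> * exp (u \<sigma>))"
    by (simp add: sum_distrib_left mult.commute)
  finally show ?thesis using Z_pos[of u]
    by (simp add: gibbs_mean_def divide_le_eq)
qed

lemma gibbs_mean_sum: "gibbs_mean u (\<lambda>\<sigma>. \<Sum>e\<in>E. c e * X e \<sigma>) = (\<Sum>e\<in>E. c e * gibbs_mean u (X e))"
proof -
  have "(\<Sum>\<sigma>\<in>S. w \<sigma> * exp (u \<sigma>) * (\<Sum>e\<in>E. c e * X e \<sigma>)) = (\<Sum>e\<in>E. c e * (\<Sum>\<sigma>\<in>S. w \<sigma> * exp (u \<sigma>) * X e \<sigma>))"
    by (simp add: sum_distrib_left sum.swap[of _ E] algebra_simps)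
  then show ?thesis by (simp add: gibbs_mean_def sum_divide_distrib[where A = E])
qed

lemma DERIV_logsumexp:
  assumes "\<And>\<sigma>. \<sigma> \<in> S \<Longrightarrow> ((\<lambda>t. u t \<sigma>) has_real_derivative u' \<sigma>) (at t)"
  shows "((\<lambda>t. logsumexp (u t)) has_real_derivative gibbs_mean (u t) u') (at t)"
  unfolding logsumexp_def gibbs_mean_def
  by (rule derivative_eq_intros refl assms Z_pos | assumption)+ (simp add: algebra_simps)

lemma DERIV_gibbs_mean:
  assumes "\<And>\<sigma>. \<sigma> \<in> S \<Longrightarrow> ((\<lambda>t. u t \<sigma>) has_real_derivative u' \<sigma>) (at t)"
  shows "((\<lambda>t. gibbs_mean (u t) X) has_real_derivative
     gibbs_mean (u t) (\<lambda>\<sigma>. X \<sigma> * u' \<sigma>) - gibbs_mean (u t) X * gibbs_mean (u t) u') (at t)"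
  unfolding gibbs_mean_def
  apply (rule derivative_eq_intros refl assms Z_pos[THEN less_imp_neq, symmetric] | assumption)+
  subgoal using Z_pos[of "u t"] by (simp add: field_simps)
  done

text \<open>
  The variance is half the mean square difference of two independent replicas.
\<close>

lemma gibbs_variance_double_sum:
  "gibbs_mean u (\<lambda>\<sigma>. (X \<sigma>)\<^sup>2) - (gibbs_mean u X)\<^sup>2
   = (\<Sum>\<sigma>\<in>S. \<Sum>\<tau>\<in>S. w \<sigma> * exp (u \<sigma>) * (w \<tau> * exp (u \<tau>)) * (X \<sigma> - X \<tau>)\<^sup>2)
      / (2 * (\<Sum>\<sigma>\<in>S. w \<sigma> * exp (u \<sigma>))\<^sup>2)"
proof -
  define p where "p \<sigma> = w \<sigma> * exp (u \<sigma>)" for \<sigma>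
  define Z where "Z = (\<Sum>\<sigma>\<in>S. p \<sigma>)"
  define A where "A = (\<Sum>\<sigma>\<in>S. p \<sigma> * X \<sigma>)"
  define Q where "Q = (\<Sum>\<sigma>\<in>S. p \<sigma> * (X \<sigma>)\<^sup>2)"
  have Z: "Z > 0" using Z_pos[of u] by (simp add: Z_def p_def)
  have "(\<Sum>\<sigma>\<in>S. \<Sum>\<tau>\<in>S. p \<sigma> * p \<tau> * (X \<sigma> - X \<tau>)\<^sup>2)
      = (\<Sum>\<sigma>\<in>S. \<Sum>\<tau>\<in>S. (p \<sigma> * (X \<sigma>)\<^sup>2) * p \<tau> + p \<sigma> * (p \<tau> * (X \<tau>)\<^sup>2) - 2 * ((p \<sigma> * X \<sigma>) * (p \<tau> * X \<tau>)))"
    by (intro sum.cong refl) (simp add: power2_eq_square algebra_simps)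
  also have "\<dots> = Q * Z + Z * Q - 2 * (A * A)"
    unfolding Q_def Z_def A_def sum_product
    by (simp only: sum.distrib sum_subtractf sum_distrib_left)
  finally have *: "(\<Sum>\<sigma>\<in>S. \<Sum>\<tau>\<in>S. p \<sigma> * p \<tau> * (X \<sigma> - X \<tau>)\<^sup>2) = 2 * (Q * Z - A\<^sup>2)"
    by (simp add: power2_eq_square)
  have "gibbs_mean u (\<lambda>\<sigma>. (X \<sigma>)\<^sup>2) - (gibbs_mean u X)\<^sup>2 = Q / Z - (A / Z)\<^sup>2"
    by (simp add: gibbs_mean_def p_def Q_def Z_def A_def)
  also have "\<dots> = 2 * (Q * Z - A\<^sup>2) / (2 * Z\<^sup>2)"
    using Z by (simp add: field_simps power2_eq_square)
  finally show ?thesis unfolding *[symmetric] by (simp add: p_def Z_def)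
qed

text \<open>
  The coefficients \<open>c\<close> may have both signs: only the combination for each pair of replicas has to
  be nonnegative.
\<close>

lemma weighted_gibbs_variance_nonneg:
  assumes "\<And>\<sigma> \<tau>. \<sigma> \<in> S \<Longrightarrow> \<tau> \<in> S \<Longrightarrow> 0 \<le> (\<Sum>e\<in>E. c e * (X e \<sigma> - X e \<tau>)\<^sup>2)"
  shows "0 \<le> (\<Sum>e\<in>E. c e * (gibbs_mean u (\<lambda>\<sigma>. (X e \<sigma>)\<^sup>2) - (gibbs_mean u (X e))\<^sup>2))"
proof -
  have "(\<Sum>e\<in>E. c e * (gibbs_mean u (\<lambda>\<sigma>. (X e \<sigma>)\<^sup>2) - (gibbs_mean u (X e))\<^sup>2))
     = (\<Sum>e\<in>E. c e * (\<Sum>\<sigma>\<in>S. \<Sum>\<tau>\<in>S. w \<sigma> * exp (u \<sigma>) * (w \<tau> * exp (u \<tau>)) * (X e \<sigma> - X e \<tau>)\<^sup>2))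
        / (2 * (\<Sum>\<sigma>\<in>S. w \<sigma> * exp (u \<sigma>))\<^sup>2)"
    by (simp add: gibbs_variance_double_sum sum_divide_distrib[where A = E])
  also have "(\<Sum>e\<in>E. c e * (\<Sum>\<sigma>\<in>S. \<Sum>\<tau>\<in>S. w \<sigma> * exp (u \<sigma>) * (w \<tau> * exp (u \<tau>)) * (X e \<sigma> - X e \<tau>)\<^sup>2))
     = (\<Sum>\<sigma>\<in>S. \<Sum>\<tau>\<in>S. w \<sigma> * exp (u \<sigma>) * (w \<tau> * exp (u \<tau>)) * (\<Sum>e\<in>E. c e * (X e \<sigma> - X e \<tau>)\<^sup>2))"
    by (simp add: sum_distrib_left sum.swap[of _ _ E] mult.left_commute)
  also have "\<dots> / (2 * (\<Sum>\<sigma>\<in>S. w \<sigma> * exp (u \<sigma>))\<^sup>2) \<ge> 0"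
  proof (intro divide_nonneg_nonneg sum_nonneg)
    fix \<sigma> \<tau> assume "\<sigma> \<in> S" "\<tau> \<in> S"
    then show "0 \<le> w \<sigma> * exp (u \<sigma>) * (w \<tau> * exp (u \<tau>)) * (\<Sum>e\<in>E. c e * (X e \<sigma> - X e \<tau>)\<^sup>2)"
      by (intro mult_nonneg_nonneg assms less_imp_le[OF weight_pos] exp_ge_zero)
  qed simp
  finally show ?thesis .
qed

end

section \<open>Comparison of Gaussian free energies\<close>

lemma measurable_gauss_coordinate [measurable (raw)]:
  "e \<in> E \<Longrightarrow> (\<lambda>x. x e) \<in> borel_measurable (gauss E)"
  using measurable_component_singleton[of e E "\<lambda>_. std_normal_distribution"] by simp

lemma
  assumes "e \<in> E"
  shows integrable_gauss_coordinate: "integrable (gauss E) (\<lambda>x. \<bar>x e\<bar>)"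
    and integral_gauss_coordinate: "(\<integral>x. \<bar>x e\<bar> \<partial>gauss E) = (\<integral>y. \<bar>y\<bar> \<partial>std_normal_distribution)"
proof -
  have d: "distr (gauss E) std_normal_distribution (\<lambda>x. x e) = std_normal_distribution"
    by (rule distr_PiM_component[OF prob_space_std_normal assms])
  have m: "(\<lambda>x. x e) \<in> gauss E \<rightarrow>\<^sub>M std_normal_distribution"
    using measurable_component_singleton[OF assms] .
  have "integrable (distr (gauss E) std_normal_distribution (\<lambda>x. x e)) abs"
    unfolding d by (rule integrable_std_normal_abs)
  then show "integrable (gauss E) (\<lambda>x. \<bar>x e\<bar>)"
    using m by (simp add: integrable_distr_eq)
  have "(\<integral>y. \<bar>y\<bar> \<partial>distr (gauss E) std_normal_distribution (\<lambda>x. x e)) = (\<integral>x. \<bar>x e\<bar> \<partial>gauss E)"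
    using m by (intro integral_distr) auto
  then show "(\<integral>x. \<bar>x e\<bar> \<partial>gauss E) = (\<integral>y. \<bar>y\<bar> \<partial>std_normal_distribution)"
    unfolding d by simp
qed

text \<open>
  A Gaussian field on the states that is spanned by finitely many bounded features \<open>s e\<close> with
  independent standard normal coefficients.
\<close>

locale gaussian_gibbs = finite_gibbs S w for S :: "'s set" and w :: "'s \<Rightarrow> real" +
  fixes E :: "'e set" and s :: "'e \<Rightarrow> 's \<Rightarrow> real" and B :: real
  assumes finite_E: "finite E"
    and feature_bound: "e \<in> E \<Longrightarrow> \<sigma> \<in> S \<Longrightarrow> \<bar>s e \<sigma>\<bar> \<le> B"
begin

definition field :: "('e \<Rightarrow> real) \<Rightarrow> ('e \<Rightarrow> real) \<Rightarrow> 's \<Rightarrow> real" where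
  "field a x \<sigma> = (\<Sum>e\<in>E. a e * x e * s e \<sigma>)"

definition quenched :: "('e \<Rightarrow> real) \<Rightarrow> real" where
  "quenched a = (\<integral>x. logsumexp (field a x) \<partial>gauss E)"

lemma field_update:
  assumes "e \<in> E"
  shows "field a (x(e := y)) \<sigma> = (\<Sum>i\<in>E - {e}. a i * x i * s i \<sigma>) + a e * y * s e \<sigma>"
proof -
  have "field a (x(e := y)) \<sigma> = a e * y * s e \<sigma> + (\<Sum>i\<in>E - {e}. a i * (x(e := y)) i * s i \<sigma>)"
    unfolding field_def using finite_E assms by (subst sum.remove[of E e]) auto
  also have "(\<Sum>i\<in>E - {e}. a i * (x(e := y)) i * s i \<sigma>) = (\<Sum>i\<in>E - {e}. a i * x i * s i \<sigma>)"
    by (intro sum.cong) auto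
  finally show ?thesis by (simp only: add.commute)
qed

lemma coord_lipschitz_logsumexp_field: "coord_lipschitz E (\<lambda>e. \<bar>a e\<bar> * B) (\<lambda>x. logsumexp (field a x))"
  unfolding coord_lipschitz_def
proof (intro allI ballI logsumexp_lipschitz)
  fix x e y z \<sigma> assume e: "e \<in> E" and \<sigma>: "\<sigma> \<in> S"
  have "\<bar>field a (x(e := y)) \<sigma> - field a (x(e := z)) \<sigma>\<bar> = \<bar>a e\<bar> * \<bar>y - z\<bar> * \<bar>s e \<sigma>\<bar>"
    by (simp add: field_update[OF e] abs_mult[symmetric] algebra_simps)
  also have "\<dots> \<le> \<bar>a e\<bar> * \<bar>y - z\<bar> * B"
    by (intro mult_left_mono feature_bound e \<sigma>) auto
  finally show "\<bar>field a (x(e := y)) \<sigma> - field a (x(e := z)) \<sigma>\<bar> \<le> \<bar>a e\<bar> * B * \<bar>y - z\<bar>"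
    by (simp add: algebra_simps)
qed

lemma measurable_field [measurable]: "(\<lambda>x. field a x \<sigma>) \<in> borel_measurable (gauss E)"
  unfolding field_def
  by (intro borel_measurable_sum borel_measurable_times borel_measurable_const measurable_gauss_coordinate)

lemma measurable_logsumexp_field [measurable]: "(\<lambda>x. logsumexp (field a x)) \<in> borel_measurable (gauss E)"
  unfolding logsumexp_def by measurable

lemma measurable_gibbs_mean_field [measurable]:
  "(\<lambda>x. gibbs_mean (field a x) X) \<in> borel_measurable (gauss E)"
  unfolding gibbs_mean_def by measurable

lemma integrable_logsumexp_field: "integrable (gauss E) (\<lambda>x. logsumexp (field a x))"
  by (rule coord_lipschitz_integrable[OF finite_E _ coord_lipschitz_logsumexp_field]) measurable

lemma integrable_gibbs_mean_field:
  assumes "\<And>\<sigma>. \<sigma> \<in> S \<Longrightarrow> \<bar>X \<sigma>\<bar> \<le> C"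
  shows "integrable (gauss E) (\<lambda>x. gibbs_mean (field a x) X)"
  by (rule finite_measure.integrable_const_bound[OF prob_space.finite_measure[OF prob_space_gauss], of _ C])
     (use gibbs_mean_abs_le[OF assms] in auto)

lemma feature_square_bound: "e \<in> E \<Longrightarrow> \<sigma> \<in> S \<Longrightarrow> \<bar>(s e \<sigma>)\<^sup>2\<bar> \<le> B\<^sup>2"
  using power_mono[OF feature_bound[of e \<sigma>] abs_ge_zero, of 2] by simp

abbreviation gibbs_var :: "('s \<Rightarrow> real) \<Rightarrow> 'e \<Rightarrow> real" where
  "gibbs_var u e \<equiv> gibbs_mean u (\<lambda>\<sigma>. (s e \<sigma>)\<^sup>2) - (gibbs_mean u (s e))\<^sup>2"

lemma integrable_gibbs_var: "e \<in> E \<Longrightarrow> integrable (gauss E) (\<lambda>x. gibbs_var (field a x) e)"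
proof (intro Bochner_Integration.integrable_diff)
  assume e: "e \<in> E"
  show "integrable (gauss E) (\<lambda>x. gibbs_mean (field a x) (\<lambda>\<sigma>. (s e \<sigma>)\<^sup>2))"
    by (rule integrable_gibbs_mean_field) (rule feature_square_bound[OF e])
  have "\<bar>gibbs_mean (field a x) (s e)\<bar> \<le> B" for x
    by (rule gibbs_mean_abs_le) (rule feature_bound[OF e])
  from power_mono[OF this abs_ge_zero, where n = 2] have "\<bar>(gibbs_mean (field a x) (s e))\<^sup>2\<bar> \<le> B\<^sup>2" for x
    by simp
  then show "integrable (gauss E) (\<lambda>x. (gibbs_mean (field a x) (s e))\<^sup>2)"
    by (intro finite_measure.integrable_const_bound[OF prob_space.finite_measure[OF prob_space_gauss], of _ "B\<^sup>2"]) auto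
qed

lemma integrable_coordinate_gibbs_mean:
  assumes "e \<in> E"
  shows "integrable (gauss E) (\<lambda>x. x e * gibbs_mean (field a x) (s e))"
proof (rule Bochner_Integration.integrable_bound)
  show "integrable (gauss E) (\<lambda>x. B * \<bar>x e\<bar>)"
    using integrable_gauss_coordinate[OF assms] by simp
  show "(\<lambda>x. x e * gibbs_mean (field a x) (s e)) \<in> borel_measurable (gauss E)"
    using assms by measurable
  show "AE x in gauss E. norm (x e * gibbs_mean (field a x) (s e)) \<le> norm (B * \<bar>x e\<bar>)"
  proof (rule AE_I2)
    fix x
    have "\<bar>gibbs_mean (field a x) (s e)\<bar> \<le> B"
      by (rule gibbs_mean_abs_le) (rule feature_bound[OF assms])
    then have "\<bar>x e\<bar> * \<bar>gibbs_mean (field a x) (s e)\<bar> \<le> \<bar>x e\<bar> * \<bar>B\<bar>"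
      by (intro mult_left_mono) auto
    then show "norm (x e * gibbs_mean (field a x) (s e)) \<le> norm (B * \<bar>x e\<bar>)"
      by (simp add: abs_mult mult.commute)
  qed
qed

text \<open>
  Integration by parts in the single coordinate \<open>x e\<close>, all others being fixed. The derivative of
  a Gibbs mean in the energy is a Gibbs covariance.
\<close>

lemma gibbs_mean_integration_by_parts:
  assumes e: "e \<in> E"
  shows "(\<integral>x. x e * gibbs_mean (field a x) (s e) \<partial>gauss E) = a e * (\<integral>x. gibbs_var (field a x) e \<partial>gauss E)"
proof -
  define I where "I = E - {e}"
  have E: "E = insert e I" and I: "finite I" "e \<notin> I" using e finite_E by (auto simp: I_def)
  have one: "(\<integral>y. y * gibbs_mean (field a (x(e := y))) (s e) \<partial>std_normal_distribution)
      = (\<integral>y. a e * gibbs_var (field a (x(e := y))) e \<partial>std_normal_distribution)" for x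
  proof (rule std_normal_integration_by_parts[where A = B and B = "\<bar>a e\<bar> * (2 * B\<^sup>2)"])
    fix y
    have d: "((\<lambda>y. field a (x(e := y)) \<sigma>) has_real_derivative a e * s e \<sigma>) (at y)" for \<sigma> y
      unfolding field_update[OF e] by (auto intro!: derivative_eq_intros)
    have lin: "gibbs_mean u (\<lambda>\<sigma>. X \<sigma> * (a e * s e \<sigma>)) = a e * gibbs_mean u (\<lambda>\<sigma>. X \<sigma> * s e \<sigma>)" for u X
      using gibbs_mean_sum[of u "\<lambda>_. a e" "\<lambda>_ \<sigma>. X \<sigma> * s e \<sigma>" "{e}"] by (simp add: mult.left_commute)
    have lin1: "gibbs_mean u (\<lambda>\<sigma>. a e * s e \<sigma>) = a e * gibbs_mean u (s e)" for u
      using lin[of u "\<lambda>_. 1"] by simp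
    have D: "((\<lambda>y. gibbs_mean (field a (x(e := y))) X) has_real_derivative
        a e * (gibbs_mean (field a (x(e := y))) (\<lambda>\<sigma>. X \<sigma> * s e \<sigma>)
          - gibbs_mean (field a (x(e := y))) X * gibbs_mean (field a (x(e := y))) (s e))) (at y)" for X y
      using DERIV_gibbs_mean[of "\<lambda>y. field a (x(e := y))" "\<lambda>\<sigma>. a e * s e \<sigma>" y X, OF d]
      unfolding lin lin1 right_diff_distrib by (simp only: mult.left_commute)
    show "((\<lambda>y. gibbs_mean (field a (x(e := y))) (s e)) has_real_derivative
        a e * gibbs_var (field a (x(e := y))) e) (at y)"
      using D[of "s e" y] by (simp add: power2_eq_square)
    show "isCont (\<lambda>y. a e * gibbs_var (field a (x(e := y))) e) y"
      by (intro continuous_intros DERIV_isCont[OF D])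
    show b1: "\<bar>gibbs_mean (field a (x(e := y))) (s e)\<bar> \<le> B"
      by (rule gibbs_mean_abs_le) (rule feature_bound[OF e])
    have b2: "\<bar>gibbs_mean (field a (x(e := y))) (\<lambda>\<sigma>. (s e \<sigma>)\<^sup>2)\<bar> \<le> B\<^sup>2"
      by (rule gibbs_mean_abs_le) (rule feature_square_bound[OF e])
    have "\<bar>gibbs_var (field a (x(e := y))) e\<bar> \<le> 2 * B\<^sup>2"
      using b2 power_mono[OF b1 abs_ge_zero, of 2] zero_le_power2[of "gibbs_mean (field a (x(e := y))) (s e)"]
      unfolding power2_abs by linarith
    then show "\<bar>a e * gibbs_var (field a (x(e := y))) e\<bar> \<le> \<bar>a e\<bar> * (2 * B\<^sup>2)"
      by (simp add: abs_mult mult_left_mono)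
  qed
  have "(\<integral>x. x e * gibbs_mean (field a x) (s e) \<partial>gauss E)
     = (\<integral>x. \<integral>y. y * gibbs_mean (field a (x(e := y))) (s e) \<partial>std_normal_distribution \<partial>gauss I)"
    using gauss.product_integral_insert[OF I, of "\<lambda>x. x e * gibbs_mean (field a x) (s e)"]
      integrable_coordinate_gibbs_mean[OF e, of a] by (simp add: E[symmetric])
  also have "\<dots> = (\<integral>x. \<integral>y. a e * gibbs_var (field a (x(e := y))) e \<partial>std_normal_distribution \<partial>gauss I)"
    by (simp only: one)
  also have "\<dots> = (\<integral>x. a e * gibbs_var (field a x) e \<partial>gauss E)"
    by (rule gauss.product_integral_insert[OF I, of "\<lambda>x. a e * gibbs_var (field a x) e",
          folded E, OF integrable_mult_right[OF integrable_gibbs_var[OF e]], symmetric])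
  finally show ?thesis by simp
qed

text \<open>
  The source of continuity in the amplitudes, at the ends of the interpolation and where an amplitude
  degenerates to 0.
\<close>

lemma quenched_lipschitz:
  "\<bar>quenched a - quenched b\<bar> \<le> (\<Sum>e\<in>E. \<bar>a e - b e\<bar> * B * (\<integral>y. \<bar>y\<bar> \<partial>std_normal_distribution))"
proof -
  have "\<bar>quenched a - quenched b\<bar> = \<bar>\<integral>x. logsumexp (field a x) - logsumexp (field b x) \<partial>gauss E\<bar>"
    unfolding quenched_def by (simp add: integrable_logsumexp_field)
  also have "\<dots> \<le> (\<integral>x. \<bar>logsumexp (field a x) - logsumexp (field b x)\<bar> \<partial>gauss E)"
    by (rule integral_abs_bound)
  also have "\<dots> \<le> (\<integral>x. (\<Sum>e\<in>E. \<bar>a e - b e\<bar> * B * \<bar>x e\<bar>) \<partial>gauss E)"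
  proof (rule integral_mono)
    fix x
    show "\<bar>logsumexp (field a x) - logsumexp (field b x)\<bar> \<le> (\<Sum>e\<in>E. \<bar>a e - b e\<bar> * B * \<bar>x e\<bar>)"
    proof (rule logsumexp_lipschitz)
      fix \<sigma> assume \<sigma>: "\<sigma> \<in> S"
      have "\<bar>field a x \<sigma> - field b x \<sigma>\<bar> \<le> (\<Sum>e\<in>E. \<bar>(a e - b e) * x e * s e \<sigma>\<bar>)"
        unfolding field_def sum_subtractf[symmetric] left_diff_distrib[symmetric] by (rule sum_abs)
      also have "\<dots> \<le> (\<Sum>e\<in>E. \<bar>a e - b e\<bar> * B * \<bar>x e\<bar>)"
      proof (rule sum_mono)
        fix e assume "e \<in> E"
        then have "\<bar>a e - b e\<bar> * \<bar>x e\<bar> * \<bar>s e \<sigma>\<bar> \<le> \<bar>a e - b e\<bar> * \<bar>x e\<bar> * B"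
          by (intro mult_left_mono feature_bound \<sigma>) auto
        then show "\<bar>(a e - b e) * x e * s e \<sigma>\<bar> \<le> \<bar>a e - b e\<bar> * B * \<bar>x e\<bar>"
          by (simp only: abs_mult mult_ac)
      qed
      finally show "\<bar>field a x \<sigma> - field b x \<sigma>\<bar> \<le> (\<Sum>e\<in>E. \<bar>a e - b e\<bar> * B * \<bar>x e\<bar>)" .
    qed
  qed (intro Bochner_Integration.integrable_sum integrable_gauss_coordinate integrable_logsumexp_field
        Bochner_Integration.integrable_abs Bochner_Integration.integrable_diff integrable_mult_right; assumption)+
  also have "\<dots> = (\<Sum>e\<in>E. \<bar>a e - b e\<bar> * B * (\<integral>y. \<bar>y\<bar> \<partial>std_normal_distribution))"
    by (subst Bochner_Integration.integral_sum)
       (simp_all add: integrable_gauss_coordinate integral_gauss_coordinate)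
  finally show ?thesis .
qed

lemma tendsto_quenched:
  assumes "\<And>e. e \<in> E \<Longrightarrow> ((\<lambda>t. a t e) \<longlongrightarrow> b e) F"
  shows "((\<lambda>t. quenched (a t)) \<longlongrightarrow> quenched b) F"
proof -
  have "((\<lambda>t. \<Sum>e\<in>E. \<bar>a t e - b e\<bar> * B * (\<integral>y. \<bar>y\<bar> \<partial>std_normal_distribution)) \<longlongrightarrow>
      (\<Sum>e\<in>E. \<bar>b e - b e\<bar> * B * (\<integral>y. \<bar>y\<bar> \<partial>std_normal_distribution))) F"
    by (intro tendsto_intros assms)
  then have lim: "((\<lambda>t. \<Sum>e\<in>E. \<bar>a t e - b e\<bar> * B * (\<integral>y. \<bar>y\<bar> \<partial>std_normal_distribution)) \<longlongrightarrow> 0) F"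
    by simp
  have "((\<lambda>t. quenched (a t) - quenched b) \<longlongrightarrow> 0) F"
  proof (rule Lim_null_comparison[OF always_eventually lim], rule allI)
    fix t show "norm (quenched (a t) - quenched b)
        \<le> (\<Sum>e\<in>E. \<bar>a t e - b e\<bar> * B * (\<integral>y. \<bar>y\<bar> \<partial>std_normal_distribution))"
      unfolding real_norm_def by (rule quenched_lipschitz)
  qed
  then show ?thesis by (rule LIM_zero_cancel)
qed

text \<open>
  The variances move linearly from \<open>v0\<close> to \<open>v1\<close>. Positivity keeps the square roots
  differentiable, with derivatives that are bounded uniformly in time.
\<close>

lemma gaussian_comparison_pos:
  assumes v0: "\<And>e. e \<in> E \<Longrightarrow> 0 < v0 e" and v1: "\<And>e. e \<in> E \<Longrightarrow> 0 < v1 e"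
    and increments: "\<And>\<sigma> \<tau>. \<sigma> \<in> S \<Longrightarrow> \<tau> \<in> S \<Longrightarrow> 0 \<le> (\<Sum>e\<in>E. (v1 e - v0 e) * (s e \<sigma> - s e \<tau>)\<^sup>2)"
  shows "quenched (\<lambda>e. sqrt (v0 e)) \<le> quenched (\<lambda>e. sqrt (v1 e))"
proof -
  define v where "v t e = (1 - t) * v0 e + t * v1 e" for t e
  define a where "a t e = sqrt (v t e)" for t e
  define a' where "a' t e = (v1 e - v0 e) / (2 * a t e)" for t e
  define \<delta> where "\<delta> e = min (v0 e) (v1 e)" for e
  have \<delta>: "0 < \<delta> e" if "e \<in> E" for e using v0 v1 that by (auto simp: \<delta>_def)
  have v_ge: "\<delta> e \<le> v t e" if "t \<in> {0..1}" for t e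
  proof -
    have "(1 - t) * \<delta> e + t * \<delta> e \<le> v t e"
      unfolding v_def by (intro add_mono mult_left_mono) (use that in \<open>auto simp: \<delta>_def\<close>)
    then show ?thesis by (simp add: algebra_simps)
  qed
  have a_ge: "sqrt (\<delta> e) \<le> a t e" if "t \<in> {0..1}" for t e
    using v_ge[OF that] by (simp add: a_def)
  have a_pos: "0 < a t e" if "t \<in> {0..1}" "e \<in> E" for t e
    by (rule less_le_trans[OF _ a_ge[OF that(1)]]) (simp add: \<delta>[OF that(2)])
  have deriv_a: "((\<lambda>t. a t e) has_real_derivative a' t e) (at t)" if "t \<in> {0..1}" "e \<in> E" for t e
  proof -
    have "0 < v t e" using v_ge[OF that(1), of e] \<delta>[OF that(2)] by linarith
    moreover have "((\<lambda>t. v t e) has_real_derivative v1 e - v0 e) (at t)"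
      unfolding v_def by (auto intro!: derivative_eq_intros)
    ultimately have "((\<lambda>t. sqrt (v t e)) has_real_derivative inverse (sqrt (v t e)) / 2 * (v1 e - v0 e)) (at t)"
      by (intro DERIV_chain2[OF DERIV_real_sqrt])
    moreover have "inverse (sqrt (v t e)) / 2 * (v1 e - v0 e) = a' t e"
      unfolding a'_def a_def by (simp add: inverse_eq_divide)
    ultimately show ?thesis unfolding a_def by simp
  qed
  define f' where "f' t x = gibbs_mean (field (a t) x) (\<lambda>\<sigma>. \<Sum>e\<in>E. a' t e * x e * s e \<sigma>)" for t x
  define g where "g x = (\<Sum>e\<in>E. \<bar>v1 e - v0 e\<bar> / (2 * sqrt (\<delta> e)) * B * \<bar>x e\<bar>)" for x
  have f'_alt: "f' t x = (\<Sum>e\<in>E. a' t e * (x e * gibbs_mean (field (a t) x) (s e)))" for t x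
    unfolding f'_def gibbs_mean_sum by (simp add: mult.assoc)
  have deriv: "(quenched \<circ> a has_real_derivative (\<integral>x. f' t x \<partial>gauss E)) (at t)" if t: "t \<in> {0<..<1}" for t
    unfolding comp_def quenched_def
  proof (rule DERIV_integral_dominated[OF t, where g = g])
    fix t x assume t: "t \<in> {0<..<1::real}"
    have "((\<lambda>t. field (a t) x \<sigma>) has_real_derivative (\<Sum>e\<in>E. a' t e * x e * s e \<sigma>)) (at t)" for \<sigma>
      unfolding field_def using t by (intro DERIV_sum DERIV_cmult_right deriv_a) auto
    then show "((\<lambda>t. logsumexp (field (a t) x)) has_real_derivative f' t x) (at t)"
      unfolding f'_def by (rule DERIV_logsumexp)
    show "\<bar>f' t x\<bar> \<le> g x" unfolding f'_def
    proof (rule gibbs_mean_abs_le)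
      fix \<sigma> assume \<sigma>: "\<sigma> \<in> S"
      have "\<bar>\<Sum>e\<in>E. a' t e * x e * s e \<sigma>\<bar> \<le> (\<Sum>e\<in>E. \<bar>a' t e * x e * s e \<sigma>\<bar>)" by (rule sum_abs)
      also have "\<dots> \<le> g x" unfolding g_def
      proof (rule sum_mono)
        fix e assume e: "e \<in> E"
        have t': "t \<in> {0..1}" using t by simp
        have "\<bar>a' t e\<bar> = \<bar>v1 e - v0 e\<bar> / (2 * a t e)"
          unfolding a'_def using a_pos[OF t' e] by (simp add: abs_mult)
        also have "\<dots> \<le> \<bar>v1 e - v0 e\<bar> / (2 * sqrt (\<delta> e))"
          using a_ge[OF t', of e] a_pos[OF t' e] \<delta>[OF e] by (intro divide_left_mono) auto
        finally have "\<bar>a' t e\<bar> * \<bar>s e \<sigma>\<bar> * \<bar>x e\<bar> \<le> \<bar>v1 e - v0 e\<bar> / (2 * sqrt (\<delta> e)) * B * \<bar>x e\<bar>"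
          using feature_bound[OF e \<sigma>] \<delta>[OF e] by (intro mult_right_mono mult_mono) auto
        then show "\<bar>a' t e * x e * s e \<sigma>\<bar> \<le> \<bar>v1 e - v0 e\<bar> / (2 * sqrt (\<delta> e)) * B * \<bar>x e\<bar>"
          by (simp add: abs_mult mult_ac)
      qed
      finally show "\<bar>\<Sum>e\<in>E. a' t e * x e * s e \<sigma>\<bar> \<le> g x" .
    qed
  next
    show "integrable (gauss E) g" unfolding g_def
      by (intro Bochner_Integration.integrable_sum integrable_mult_right integrable_gauss_coordinate)
    show "f' t \<in> borel_measurable (gauss E)"
      unfolding f'_alt
      by (intro borel_measurable_sum borel_measurable_times borel_measurable_const measurable_gibbs_mean_field
            measurable_gauss_coordinate)
  qed (rule integrable_logsumexp_field)
  have nonneg: "0 \<le> (\<integral>x. f' t x \<partial>gauss E)" if t: "t \<in> {0<..<1}" for t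
  proof -
    have "(\<integral>x. f' t x \<partial>gauss E) = (\<Sum>e\<in>E. a' t e * (\<integral>x. x e * gibbs_mean (field (a t) x) (s e) \<partial>gauss E))"
      unfolding f'_alt
      by (subst Bochner_Integration.integral_sum)
         (simp_all add: integrable_coordinate_gibbs_mean)
    also have "\<dots> = (\<Sum>e\<in>E. (1/2) * ((v1 e - v0 e) * (\<integral>x. gibbs_var (field (a t) x) e \<partial>gauss E)))"
    proof (rule sum.cong[OF refl])
      fix e assume e: "e \<in> E"
      have "a' t e * a t e = (v1 e - v0 e) / 2" using a_pos[of t e] t e by (simp add: a'_def)
      then show "a' t e * (\<integral>x. x e * gibbs_mean (field (a t) x) (s e) \<partial>gauss E)
         = (1/2) * ((v1 e - v0 e) * (\<integral>x. gibbs_var (field (a t) x) e \<partial>gauss E))"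
        unfolding gibbs_mean_integration_by_parts[OF e] mult.assoc[symmetric] by simp
    qed
    also have "\<dots> = (1/2) * (\<integral>x. (\<Sum>e\<in>E. (v1 e - v0 e) * gibbs_var (field (a t) x) e) \<partial>gauss E)"
      by (subst Bochner_Integration.integral_sum)
         (simp_all add: integrable_gibbs_var sum_distrib_left)
    also have "\<dots> \<ge> 0"
      by (intro mult_nonneg_nonneg Bochner_Integration.integral_nonneg weighted_gibbs_variance_nonneg increments) auto
    finally show ?thesis .
  qed
  have "(quenched \<circ> a) 0 \<le> (quenched \<circ> a) 1"
  proof (rule DERIV_nonneg_imp_increasing_open[where f = "quenched \<circ> a" and a = 0 and b = 1])
    show "continuous_on {0..1} (quenched \<circ> a)"
      unfolding continuous_on_def
    proof
      fix r :: real
      have "((\<lambda>t. a t e) \<longlongrightarrow> a r e) (at r within {0..1})" for e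
        unfolding a_def v_def by (intro tendsto_intros)
      then show "((quenched \<circ> a) \<longlongrightarrow> (quenched \<circ> a) r) (at r within {0..1})"
        unfolding comp_def by (rule tendsto_quenched)
    qed
    show "\<exists>y. (quenched \<circ> a has_real_derivative y) (at t) \<and> 0 \<le> y" if "0 < t" "t < 1" for t
      using deriv[of t] nonneg[of t] that by auto
  qed simp
  moreover have "a 0 = (\<lambda>e. sqrt (v0 e))" "a 1 = (\<lambda>e. sqrt (v1 e))"
    by (auto simp: a_def v_def)
  ultimately show ?thesis by simp
qed

text \<open>
  The hypothesis orders the mean square increments of the two Gaussian fields, as in the Sudakov-Fernique
  inequality; the difference of the two is
  \<open>\<Sum>e. (v1 e - v0 e) * (s e \<sigma> - s e \<tau>)\<^sup>2\<close>. Adding the same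
  \<open>\<epsilon>\<close> to both variance profiles does not change the hypothesis, so the case of zero
  variances follows by continuity.
\<close>

theorem gaussian_comparison:
  assumes v0: "\<And>e. e \<in> E \<Longrightarrow> 0 \<le> v0 e" and v1: "\<And>e. e \<in> E \<Longrightarrow> 0 \<le> v1 e"
    and increments: "\<And>\<sigma> \<tau>. \<sigma> \<in> S \<Longrightarrow> \<tau> \<in> S \<Longrightarrow> 0 \<le> (\<Sum>e\<in>E. (v1 e - v0 e) * (s e \<sigma> - s e \<tau>)\<^sup>2)"
  shows "quenched (\<lambda>e. sqrt (v0 e)) \<le> quenched (\<lambda>e. sqrt (v1 e))"
proof (rule tendsto_le)
  have "((\<lambda>\<epsilon>. quenched (\<lambda>e. sqrt (v e + \<epsilon>))) \<longlongrightarrow> quenched (\<lambda>e. sqrt (v e + 0))) (at_right 0)" for v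
    by (rule tendsto_quenched) (intro tendsto_intros)
  then show "((\<lambda>\<epsilon>. quenched (\<lambda>e. sqrt (v0 e + \<epsilon>))) \<longlongrightarrow> quenched (\<lambda>e. sqrt (v0 e))) (at_right 0)"
    "((\<lambda>\<epsilon>. quenched (\<lambda>e. sqrt (v1 e + \<epsilon>))) \<longlongrightarrow> quenched (\<lambda>e. sqrt (v1 e))) (at_right 0)"
    by simp_all
  show "\<forall>\<^sub>F \<epsilon> in at_right 0. quenched (\<lambda>e. sqrt (v0 e + \<epsilon>)) \<le> quenched (\<lambda>e. sqrt (v1 e + \<epsilon>))"
    using eventually_at_right_less[of "0::real"]
  proof eventually_elim
    case (elim \<epsilon>)
    show ?case
      by (rule gaussian_comparison_pos) (use v0 v1 elim increments in \<open>auto intro: add_nonneg_pos\<close>)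
  qed
qed simp

lemma nn_integral_exp_field:
  "(\<integral>\<^sup>+x. ennreal (exp (field a x \<sigma>)) \<partial>gauss E) = ennreal (exp ((\<Sum>e\<in>E. (a e * s e \<sigma>)\<^sup>2) / 2))"
proof -
  have "ennreal (exp (field a x \<sigma>)) = (\<Prod>e\<in>E. ennreal (exp (a e * s e \<sigma> * x e)))" for x
    unfolding field_def by (simp add: exp_sum[OF finite_E] prod_ennreal mult_ac)
  then have "(\<integral>\<^sup>+x. ennreal (exp (field a x \<sigma>)) \<partial>gauss E)
      = (\<Prod>e\<in>E. \<integral>\<^sup>+y. ennreal (exp (a e * s e \<sigma> * y)) \<partial>std_normal_distribution)"
    using gauss.product_nn_integral_prod[OF finite_E, of "\<lambda>e y. ennreal (exp (a e * s e \<sigma> * y))"] by simp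
  also have "\<dots> = ennreal (exp (\<Sum>e\<in>E. (a e * s e \<sigma>)\<^sup>2 / 2))"
    by (simp add: nn_integral_exp_std_normal exp_sum[OF finite_E] prod_ennreal)
  finally show ?thesis by (simp add: sum_divide_distrib)
qed

text \<open>
  Jensen's inequality in the form of a tangent: \<open>ln z \<le> z / c - 1 + ln c\<close>, where
  \<open>c\<close> is the upper bound for the mean of the partition function.
\<close>

lemma quenched_le_annealed:
  "quenched a \<le> ln (\<Sum>\<sigma>\<in>S. w \<sigma>) + (\<Sum>e\<in>E. (a e * B)\<^sup>2) / 2"
proof -
  define Z where "Z x = (\<Sum>\<sigma>\<in>S. w \<sigma> * exp (field a x \<sigma>))" for x
  define W where "W = (\<Sum>\<sigma>\<in>S. w \<sigma>)"
  define c where "c = W * exp ((\<Sum>e\<in>E. (a e * B)\<^sup>2) / 2)"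
  have W: "0 < W" using Z_pos[of "\<lambda>_. 0"] by (simp add: W_def)
  then have c: "0 < c" by (simp add: c_def)
  have Zpos: "0 < Z x" for x unfolding Z_def by (rule Z_pos)
  have mZ [measurable]: "Z \<in> borel_measurable (gauss E)" unfolding Z_def by measurable
  have "(\<integral>\<^sup>+x. ennreal (Z x) \<partial>gauss E) = (\<Sum>\<sigma>\<in>S. ennreal (w \<sigma>) * (\<integral>\<^sup>+x. ennreal (exp (field a x \<sigma>)) \<partial>gauss E))"
    unfolding Z_def using weight_pos
    by (simp add: sum_ennreal[symmetric] ennreal_mult less_imp_le nn_integral_sum nn_integral_cmult)
  also have "\<dots> \<le> (\<Sum>\<sigma>\<in>S. ennreal (w \<sigma>) * ennreal (exp ((\<Sum>e\<in>E. (a e * B)\<^sup>2) / 2)))"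
  proof (intro sum_mono mult_left_mono)
    fix \<sigma> assume \<sigma>: "\<sigma> \<in> S"
    have "(a e * s e \<sigma>)\<^sup>2 \<le> (a e * B)\<^sup>2" if "e \<in> E" for e
      using feature_square_bound[OF that \<sigma>] by (simp add: power_mult_distrib mult_left_mono)
    then show "(\<integral>\<^sup>+x. ennreal (exp (field a x \<sigma>)) \<partial>gauss E) \<le> ennreal (exp ((\<Sum>e\<in>E. (a e * B)\<^sup>2) / 2))"
      unfolding nn_integral_exp_field by (intro ennreal_leI) (simp add: sum_mono)
  qed simp
  also have "\<dots> = ennreal c"
    using weight_pos by (simp add: c_def W_def sum_distrib_right sum_ennreal[symmetric] ennreal_mult less_imp_le)
  finally have le_c: "(\<integral>\<^sup>+x. ennreal (Z x) \<partial>gauss E) \<le> ennreal c" .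
  have int_Z: "integrable (gauss E) Z"
    using le_c Zpos by (intro integrableI_nonneg) (auto simp: less_imp_le intro: le_less_trans)
  have "(\<integral>x. Z x \<partial>gauss E) \<le> c"
    using le_c Zpos c by (simp add: nn_integral_eq_integral[OF int_Z] less_imp_le)
  have tangent: "logsumexp (field a x) \<le> Z x / c - 1 + ln c" for x
    using ln_le_minus_one[of "Z x / c"] Zpos[of x] c by (simp add: logsumexp_def Z_def[symmetric] ln_div)
  have "quenched a \<le> (\<integral>x. Z x / c - 1 + ln c \<partial>gauss E)"
    unfolding quenched_def
    by (intro integral_mono integrable_logsumexp_field tangent)
       (simp_all add: int_Z prob_space.finite_measure[OF prob_space_gauss] finite_measure.integrable_const)
  also have "\<dots> = (\<integral>x. Z x \<partial>gauss E) / c - 1 + ln c"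
    using int_Z prob_space.prob_space[OF prob_space_gauss, of E]
    by (simp add: prob_space.finite_measure[OF prob_space_gauss] finite_measure.integrable_const)
  also have "\<dots> \<le> ln c"
    using \<open>(\<integral>x. Z x \<partial>gauss E) \<le> c\<close> c by (simp add: divide_le_eq)
  also have "\<dots> = ln W + (\<Sum>e\<in>E. (a e * B)\<^sup>2) / 2"
    using W by (simp add: c_def ln_mult)
  finally show ?thesis unfolding W_def .
qed

end

section \<open>Ising and spin glass interactions on finite sets\<close>

definition configs :: "'i set \<Rightarrow> ('i \<Rightarrow> real) set" where
  "configs A = (A \<rightarrow>\<^sub>E {-1, 1})"

definition ising_weight :: "('i \<Rightarrow> 'i \<Rightarrow> real) \<Rightarrow> real \<Rightarrow> 'i set \<Rightarrow> ('i \<Rightarrow> real) \<Rightarrow> real" where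
  "ising_weight W h A \<sigma> = exp ((\<Sum>i\<in>A. \<Sum>j\<in>A. W i j * \<sigma> i * \<sigma> j) / 2 + h * (\<Sum>i\<in>A. \<sigma> i))"

text \<open>
  The parameter \<open>W i j\<close> stands for \<open>\<kappa> * K (i - j)\<close>. A general pair
  interaction on sites of any type keeps translations out of the arguments that do not need them.
\<close>

definition log_Z :: "('i \<Rightarrow> 'i \<Rightarrow> real) \<Rightarrow> real \<Rightarrow> real \<Rightarrow> 'i set \<Rightarrow> ('i \<times> 'i \<Rightarrow> real) \<Rightarrow> real" where
  "log_Z W b h A x = ln (\<Sum>\<sigma>\<in>configs A. ising_weight W h A \<sigma> *
      exp (b / sqrt (2 * real (card A)) * (\<Sum>i\<in>A. \<Sum>j\<in>A. x (i, j) * \<sigma> i * \<sigma> j)))"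

definition free_energy :: "('i \<Rightarrow> 'i \<Rightarrow> real) \<Rightarrow> real \<Rightarrow> real \<Rightarrow> 'i set \<Rightarrow> real" where
  "free_energy W b h A = (\<integral>x. log_Z W b h A x \<partial>gauss (A \<times> A))"

text \<open>
  The feature that belongs to the coupling \<open>J (i, j)\<close>.
\<close>

definition pair_spin :: "'i \<times> 'i \<Rightarrow> ('i \<Rightarrow> real) \<Rightarrow> real" where
  "pair_spin e \<sigma> = \<sigma> (fst e) * \<sigma> (snd e)"

lemma config_values: "\<sigma> \<in> configs A \<Longrightarrow> i \<in> A \<Longrightarrow> \<sigma> i = -1 \<or> \<sigma> i = 1"
  unfolding configs_def by (auto dest: PiE_mem)

lemma config_abs [simp]: "\<sigma> \<in> configs A \<Longrightarrow> i \<in> A \<Longrightarrow> \<bar>\<sigma> i\<bar> = 1"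
  using config_values by fastforce

lemma finite_configs: "finite A \<Longrightarrow> finite (configs A)"
  unfolding configs_def by (rule finite_PiE) auto

lemma configs_nonempty: "configs A \<noteq> {}"
  unfolding configs_def by (simp add: PiE_eq_empty_iff)

lemma card_configs: "finite A \<Longrightarrow> card (configs A) = 2 ^ card A"
  unfolding configs_def by (simp add: card_PiE numeral_2_eq_2)

lemma ising_weight_pos: "0 < ising_weight W h A \<sigma>"
  by (simp add: ising_weight_def)

lemma gaussian_gibbs_spins:
  assumes "finite A" "\<And>\<sigma>. 0 < w \<sigma>"
  shows "gaussian_gibbs (configs A) w (A \<times> A) pair_spin 1"
proof
  show "finite (configs A)" "finite (A \<times> A)" using assms by (auto simp: finite_configs)
  fix e \<sigma> assume "e \<in> A \<times> A" "\<sigma> \<in> configs A"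
  then show "\<bar>pair_spin e \<sigma>\<bar> \<le> 1" by (auto simp: pair_spin_def abs_mult)
qed (use assms configs_nonempty in auto)

lemma pair_sum: "(\<Sum>e\<in>A \<times> A. c * x e * pair_spin e \<sigma>) = c * (\<Sum>i\<in>A. \<Sum>j\<in>A. x (i, j) * \<sigma> i * \<sigma> j)"
  by (simp add: sum.cartesian_product sum_distrib_left pair_spin_def mult.assoc case_prod_unfold)

context
  fixes W :: "'i \<Rightarrow> 'i \<Rightarrow> real" and b h :: real and A :: "'i set"
  assumes A: "finite A"
begin

interpretation G: gaussian_gibbs "configs A" "ising_weight W h A" "A \<times> A" pair_spin 1
  by (rule gaussian_gibbs_spins[OF A ising_weight_pos])

lemma log_Z_eq_logsumexp: "log_Z W b h A x = G.logsumexp (G.field (\<lambda>_. b / sqrt (2 * real (card A))) x)"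
  unfolding log_Z_def G.logsumexp_def G.field_def pair_sum ..

lemma log_Z_eq_logsumexp': "log_Z W b h A = (\<lambda>x. G.logsumexp (G.field (\<lambda>_. b / sqrt (2 * real (card A))) x))"
  by (rule ext) (rule log_Z_eq_logsumexp)

lemma measurable_log_Z [measurable]: "log_Z W b h A \<in> borel_measurable (gauss (A \<times> A))"
  unfolding log_Z_eq_logsumexp' by measurable

lemma integrable_log_Z: "integrable (gauss (A \<times> A)) (log_Z W b h A)"
  unfolding log_Z_eq_logsumexp' by (rule G.integrable_logsumexp_field)

lemma coord_lipschitz_log_Z:
  "coord_lipschitz (A \<times> A) (\<lambda>_. \<bar>b\<bar> / sqrt (2 * real (card A))) (log_Z W b h A)"
  unfolding log_Z_eq_logsumexp'
  using G.coord_lipschitz_logsumexp_field[of "\<lambda>_. b / sqrt (2 * real (card A))"] by (simp add: abs_mult)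

text \<open>
  The annealed bound; the couplings contribute \<open>b\<^sup>2 / 4\<close> per site, as there are
  \<open>(card A)\<^sup>2\<close> of them with variance \<open>b\<^sup>2 / (2 * card A)\<close>.
\<close>

lemma free_energy_upper_bound:
  assumes W: "\<And>i. i \<in> A \<Longrightarrow> (\<Sum>j\<in>A. \<bar>W i j\<bar>) \<le> M"
  shows "free_energy W b h A \<le> (ln 2 + M / 2 + \<bar>h\<bar> + b\<^sup>2 / 4) * card A"
proof (cases "A = {}")
  case True
  then show ?thesis
    by (simp add: free_energy_def log_Z_def configs_def ising_weight_def)
next
  case False
  define n where "n = real (card A)"
  have n: "0 < n" using False A by (simp add: n_def card_gt_0_iff)
  have "ising_weight W h A \<sigma> \<le> exp (n * (M / 2 + \<bar>h\<bar>))" if \<sigma>: "\<sigma> \<in> configs A" for \<sigma>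
  proof -
    have "W i j * \<sigma> i * \<sigma> j \<le> \<bar>W i j\<bar>" if "i \<in> A" "j \<in> A" for i j
      using config_values[OF \<sigma> that(1)] config_values[OF \<sigma> that(2)] by auto
    then have "(\<Sum>i\<in>A. \<Sum>j\<in>A. W i j * \<sigma> i * \<sigma> j) \<le> (\<Sum>i\<in>A. \<Sum>j\<in>A. \<bar>W i j\<bar>)"
      by (intro sum_mono)
    also have "\<dots> \<le> (\<Sum>i\<in>A. M)" by (intro sum_mono W)
    finally have 1: "(\<Sum>i\<in>A. \<Sum>j\<in>A. W i j * \<sigma> i * \<sigma> j) \<le> n * M" by (simp add: n_def)
    have "h * \<sigma> i \<le> \<bar>h\<bar>" if "i \<in> A" for i
      using config_values[OF \<sigma> that] by auto
    then have "(\<Sum>i\<in>A. h * \<sigma> i) \<le> (\<Sum>i\<in>A. \<bar>h\<bar>)" by (intro sum_mono)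
    then have "h * (\<Sum>i\<in>A. \<sigma> i) \<le> n * \<bar>h\<bar>" by (simp add: n_def sum_distrib_left)
    with 1 show ?thesis by (simp add: ising_weight_def algebra_simps)
  qed
  then have "(\<Sum>\<sigma>\<in>configs A. ising_weight W h A \<sigma>) \<le> (\<Sum>\<sigma>\<in>configs A. exp (n * (M / 2 + \<bar>h\<bar>)))"
    by (rule sum_mono)
  also have "\<dots> = 2 ^ card A * exp (n * (M / 2 + \<bar>h\<bar>))" by (simp add: card_configs[OF A])
  finally have "ln (\<Sum>\<sigma>\<in>configs A. ising_weight W h A \<sigma>) \<le> ln (2 ^ card A * exp (n * (M / 2 + \<bar>h\<bar>)))"
    using G.Z_pos[of "\<lambda>_. 0"] by simp
  also have "\<dots> = n * (ln 2 + M / 2 + \<bar>h\<bar>)"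
    by (simp add: ln_mult ln_realpow n_def algebra_simps)
  finally have "ln (\<Sum>\<sigma>\<in>configs A. ising_weight W h A \<sigma>) \<le> n * (ln 2 + M / 2 + \<bar>h\<bar>)" .
  moreover have "(\<Sum>e\<in>A \<times> A. (b / sqrt (2 * real (card A)) * 1)\<^sup>2) / 2 = n * (b\<^sup>2 / 4)"
    using n by (simp add: n_def[symmetric] card_cartesian_product power_divide power2_eq_square field_simps)
  moreover have "free_energy W b h A = G.quenched (\<lambda>_. b / sqrt (2 * real (card A)))"
    by (simp add: free_energy_def G.quenched_def log_Z_eq_logsumexp')
  ultimately show ?thesis
    using G.quenched_le_annealed[of "\<lambda>_. b / sqrt (2 * real (card A))"] by (simp add: n_def[symmetric] algebra_simps)
qed

end

text \<open>
  A subfamily of i.i.d. variables, in any enumeration, is again such a family. This serves both for passing to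
  a subset of the couplings and for translating them.
\<close>

lemma
  fixes f :: "('j \<Rightarrow> real) \<Rightarrow> real"
  assumes "inj_on \<tau> I" "\<tau> \<in> I \<rightarrow> K" "f \<in> borel_measurable (gauss I)"
  shows integral_gauss_reindex: "(\<integral>x. f (\<lambda>e\<in>I. x (\<tau> e)) \<partial>gauss K) = (\<integral>x. f x \<partial>gauss I)"
    and integrable_gauss_reindex: "integrable (gauss I) f \<Longrightarrow> integrable (gauss K) (\<lambda>x. f (\<lambda>e\<in>I. x (\<tau> e)))"
proof -
  have d: "distr (gauss K) (gauss I) (\<lambda>x. \<lambda>e\<in>I. x (\<tau> e)) = gauss I"
    using distr_PiM_reindex[of K "\<lambda>_. std_normal_distribution" \<tau> I] assms prob_space_std_normal by simp
  have m: "(\<lambda>x. \<lambda>e\<in>I. x (\<tau> e)) \<in> gauss K \<rightarrow>\<^sub>M gauss I"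
  proof (rule measurable_restrict)
    fix e assume "e \<in> I"
    then have "\<tau> e \<in> K" using assms(2) by auto
    then show "(\<lambda>x. x (\<tau> e)) \<in> gauss K \<rightarrow>\<^sub>M std_normal_distribution"
      by (rule measurable_component_singleton)
  qed
  show "(\<integral>x. f (\<lambda>e\<in>I. x (\<tau> e)) \<partial>gauss K) = (\<integral>x. f x \<partial>gauss I)"
    using integral_distr[OF m assms(3)] unfolding d by simp
  show "integrable (gauss K) (\<lambda>x. f (\<lambda>e\<in>I. x (\<tau> e)))" if "integrable (gauss I) f"
    using integrable_distr_eq[OF m assms(3)] that unfolding d by simp
qed

lemma log_Z_cong:
  "(\<And>i j. i \<in> A \<Longrightarrow> j \<in> A \<Longrightarrow> x (i, j) = y (i, j)) \<Longrightarrow> log_Z W b h A x = log_Z W b h A y"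
  by (simp add: log_Z_def)

lemma
  assumes A: "finite A" and sub: "A \<subseteq> D"
  shows integral_log_Z: "(\<integral>x. log_Z W b h A x \<partial>gauss (D \<times> D)) = free_energy W b h A"
    and integrable_log_Z_superset: "integrable (gauss (D \<times> D)) (log_Z W b h A)"
proof -
  have restrict: "log_Z W b h A (\<lambda>e\<in>A \<times> A. x (id e)) = log_Z W b h A x" for x
    by (rule log_Z_cong) simp
  have *: "inj_on id (A \<times> A)" "id \<in> A \<times> A \<rightarrow> D \<times> D" using sub by auto
  show "(\<integral>x. log_Z W b h A x \<partial>gauss (D \<times> D)) = free_energy W b h A"
    using integral_gauss_reindex[OF * measurable_log_Z[OF A], of W b h] unfolding restrict free_energy_def .
  show "integrable (gauss (D \<times> D)) (log_Z W b h A)"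
    using integrable_gauss_reindex[OF * measurable_log_Z[OF A] integrable_log_Z[OF A], of W b h] unfolding restrict .
qed

text \<open>
  Only the law of the couplings enters, so a bijection of the sites that respects the interaction does not
  change the mean.
\<close>

lemma free_energy_bij:
  assumes A: "finite A" and g: "inj_on g A"
    and W: "\<And>i j. i \<in> A \<Longrightarrow> j \<in> A \<Longrightarrow> W (g i) (g j) = W' i j"
  shows "free_energy W b h (g ` A) = free_energy W' b h A"
proof -
  have log_Z_image: "log_Z W b h (g ` A) x = log_Z W' b h A (\<lambda>e\<in>A \<times> A. x (map_prod g g e))" for x
  proof -
    have "(\<Sum>\<tau>\<in>configs (g ` A). ising_weight W h (g ` A) \<tau> *
        exp (b / sqrt (2 * real (card (g ` A))) * (\<Sum>i\<in>g ` A. \<Sum>j\<in>g ` A. x (i, j) * \<tau> i * \<tau> j)))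
      = (\<Sum>\<sigma>\<in>configs A. ising_weight W' h A \<sigma> *
        exp (b / sqrt (2 * real (card A)) * (\<Sum>i\<in>A. \<Sum>j\<in>A. (\<lambda>e\<in>A \<times> A. x (map_prod g g e)) (i, j) * \<sigma> i * \<sigma> j)))"
    proof (rule sum.reindex_bij_witness[where j = "\<lambda>\<tau>. \<lambda>i\<in>A. \<tau> (g i)" and i = "\<lambda>\<sigma>. \<lambda>k\<in>g ` A. \<sigma> (inv_into A g k)"])
      fix \<tau> assume \<tau>: "\<tau> \<in> configs (g ` A)"
      show "(\<lambda>k\<in>g ` A. (\<lambda>i\<in>A. \<tau> (g i)) (inv_into A g k)) = \<tau>"
        using \<tau> g by (auto simp: configs_def fun_eq_iff PiE_def extensional_def)
      show "(\<lambda>i\<in>A. \<tau> (g i)) \<in> configs A" using \<tau> by (auto simp: configs_def PiE_iff)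
      show "ising_weight W' h A (\<lambda>i\<in>A. \<tau> (g i)) *
          exp (b / sqrt (2 * real (card A)) * (\<Sum>i\<in>A. \<Sum>j\<in>A. (\<lambda>e\<in>A \<times> A. x (map_prod g g e)) (i, j) * (\<lambda>i\<in>A. \<tau> (g i)) i * (\<lambda>i\<in>A. \<tau> (g i)) j))
        = ising_weight W h (g ` A) \<tau> * exp (b / sqrt (2 * real (card (g ` A))) * (\<Sum>i\<in>g ` A. \<Sum>j\<in>g ` A. x (i, j) * \<tau> i * \<tau> j))"
        using g W by (simp add: ising_weight_def sum.reindex card_image)
    next
      fix \<sigma> assume \<sigma>: "\<sigma> \<in> configs A"
      show "(\<lambda>i\<in>A. (\<lambda>k\<in>g ` A. \<sigma> (inv_into A g k)) (g i)) = \<sigma>"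
        using \<sigma> g by (auto simp: configs_def fun_eq_iff PiE_def extensional_def)
      show "(\<lambda>k\<in>g ` A. \<sigma> (inv_into A g k)) \<in> configs (g ` A)"
        using \<sigma> g by (auto simp: configs_def PiE_iff)
    qed
    then show ?thesis by (simp add: log_Z_def)
  qed
  have "inj_on (map_prod g g) (A \<times> A)" "map_prod g g \<in> A \<times> A \<rightarrow> (g ` A) \<times> (g ` A)"
    using g by (auto simp: inj_on_def)
  from integral_gauss_reindex[OF this measurable_log_Z[OF A]] show ?thesis
    unfolding free_energy_def log_Z_image .
qed

lemma sum_PiE_disjoint_product:
  fixes p q :: "('i \<Rightarrow> 'v) \<Rightarrow> real"
  assumes disj: "B \<inter> C = {}"
    and p: "\<And>\<sigma> \<tau>. (\<And>i. i \<in> B \<Longrightarrow> \<sigma> i = \<tau> i) \<Longrightarrow> p \<sigma> = p \<tau>"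
    and q: "\<And>\<sigma> \<tau>. (\<And>i. i \<in> C \<Longrightarrow> \<sigma> i = \<tau> i) \<Longrightarrow> q \<sigma> = q \<tau>"
  shows "(\<Sum>\<sigma>\<in>(B \<union> C) \<rightarrow>\<^sub>E T. p \<sigma> * q \<sigma>) = (\<Sum>\<sigma>\<in>B \<rightarrow>\<^sub>E T. p \<sigma>) * (\<Sum>\<sigma>\<in>C \<rightarrow>\<^sub>E T. q \<sigma>)"
proof -
  have "(\<Sum>\<sigma>\<in>(B \<union> C) \<rightarrow>\<^sub>E T. p \<sigma> * q \<sigma>) = (\<Sum>z\<in>(B \<rightarrow>\<^sub>E T) \<times> (C \<rightarrow>\<^sub>E T). p (fst z) * q (snd z))"
  proof (rule sum.reindex_bij_witness[where j = "\<lambda>\<sigma>. (restrict \<sigma> B, restrict \<sigma> C)" and i = "merge B C"])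
    fix \<sigma> assume \<sigma>: "\<sigma> \<in> (B \<union> C) \<rightarrow>\<^sub>E T"
    show "merge B C (restrict \<sigma> B, restrict \<sigma> C) = \<sigma>"
      using \<sigma> by (auto simp: merge_def fun_eq_iff PiE_def extensional_def)
    show "(restrict \<sigma> B, restrict \<sigma> C) \<in> (B \<rightarrow>\<^sub>E T) \<times> (C \<rightarrow>\<^sub>E T)"
      using \<sigma> by (auto simp: PiE_iff)
    show "p (fst (restrict \<sigma> B, restrict \<sigma> C)) * q (snd (restrict \<sigma> B, restrict \<sigma> C)) = p \<sigma> * q \<sigma>"
      using p[of "restrict \<sigma> B" \<sigma>] q[of "restrict \<sigma> C" \<sigma>] by simp
  next
    fix z assume z: "z \<in> (B \<rightarrow>\<^sub>E T) \<times> (C \<rightarrow>\<^sub>E T)"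
    then show "merge B C z \<in> (B \<union> C) \<rightarrow>\<^sub>E T"
      by (auto simp: merge_def PiE_iff extensional_def split: prod.splits)
    show "(restrict (merge B C z) B, restrict (merge B C z) C) = z"
      using z disj by (auto simp: merge_def fun_eq_iff PiE_def extensional_def split: prod.splits)
  qed
  then show ?thesis by (simp add: sum_product sum.cartesian_product case_prod_unfold)
qed

lemma sum_square_split:
  fixes p q :: "'i \<times> 'i \<Rightarrow> real"
  assumes "finite B" "finite C" "B \<inter> C = {}"
  shows "(\<Sum>e\<in>(B \<union> C) \<times> (B \<union> C). if e \<in> B \<times> B then p e else if e \<in> C \<times> C then q e else 0)
    = (\<Sum>e\<in>B \<times> B. p e) + (\<Sum>e\<in>C \<times> C. q e)"
proof -
  let ?f = "\<lambda>e. if e \<in> B \<times> B then p e else if e \<in> C \<times> C then q e else 0"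
  have disj: "(B \<times> B) \<inter> (C \<times> C) = {}" using assms(3) by auto
  have "(\<Sum>e\<in>(B \<union> C) \<times> (B \<union> C). ?f e) = (\<Sum>e\<in>B \<times> B \<union> C \<times> C. ?f e)"
    by (rule sum.mono_neutral_right) (use assms in auto)
  also have "\<dots> = (\<Sum>e\<in>B \<times> B. ?f e) + (\<Sum>e\<in>C \<times> C. ?f e)"
    by (rule sum.union_disjoint) (use assms disj in auto)
  also have "(\<Sum>e\<in>B \<times> B. ?f e) = (\<Sum>e\<in>B \<times> B. p e)" by (rule sum.cong) auto
  also have "(\<Sum>e\<in>C \<times> C. ?f e) = (\<Sum>e\<in>C \<times> C. q e)"
    using disj by (intro sum.cong) auto
  finally show ?thesis .
qed

text \<open>
  For signs
  \<open>(\<sigma>\<^sub>i\<sigma>\<^sub>j - \<tau>\<^sub>i\<tau>\<^sub>j)\<^sup>2 = 2 - 2 * (\<sigma>\<^sub>i\<tau>\<^sub>i) * (\<sigma>\<^sub>j\<tau>\<^sub>j)\<close>,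
  and the second term sums to the square of the overlap.
\<close>

lemma sum_pair_spin_increments:
  assumes "\<sigma> \<in> configs A" "\<tau> \<in> configs A" "D \<subseteq> A"
  shows "(\<Sum>e\<in>D \<times> D. (pair_spin e \<sigma> - pair_spin e \<tau>)\<^sup>2) = 2 * (real (card D))\<^sup>2 - 2 * (\<Sum>i\<in>D. \<sigma> i * \<tau> i)\<^sup>2"
proof -
  have "(pair_spin e \<sigma> - pair_spin e \<tau>)\<^sup>2 = 2 - 2 * ((\<sigma> (fst e) * \<tau> (fst e)) * (\<sigma> (snd e) * \<tau> (snd e)))"
    if "e \<in> D \<times> D" for e
  proof -
    have "fst e \<in> A" "snd e \<in> A" using that assms(3) by auto
    then show ?thesis
      using config_values[OF assms(1), of "fst e"] config_values[OF assms(1), of "snd e"]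
        config_values[OF assms(2), of "fst e"] config_values[OF assms(2), of "snd e"]
      by (auto simp: pair_spin_def)
  qed
  then have "(\<Sum>e\<in>D \<times> D. (pair_spin e \<sigma> - pair_spin e \<tau>)\<^sup>2)
     = (\<Sum>e\<in>D \<times> D. 2 - 2 * ((\<sigma> (fst e) * \<tau> (fst e)) * (\<sigma> (snd e) * \<tau> (snd e))))"
    by (rule sum.cong[OF refl])
  also have "\<dots> = 2 * (real (card D))\<^sup>2 - 2 * (\<Sum>e\<in>D \<times> D. (\<sigma> (fst e) * \<tau> (fst e)) * (\<sigma> (snd e) * \<tau> (snd e)))"
    by (simp add: sum_subtractf sum_distrib_left card_cartesian_product power2_eq_square)
  also have "(\<Sum>e\<in>D \<times> D. (\<sigma> (fst e) * \<tau> (fst e)) * (\<sigma> (snd e) * \<tau> (snd e))) = (\<Sum>i\<in>D. \<sigma> i * \<tau> i)\<^sup>2"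
    by (simp add: power2_eq_square sum_product sum.cartesian_product case_prod_unfold)
  finally show ?thesis .
qed

lemma ising_weight_split:
  fixes W :: "'i \<Rightarrow> 'i \<Rightarrow> real"
  assumes "finite B" "finite C" "B \<inter> C = {}" and \<sigma>: "\<sigma> \<in> configs (B \<union> C)"
  shows "ising_weight W h B \<sigma> * ising_weight W h C \<sigma> \<le>
    ising_weight W h (B \<union> C) \<sigma> * exp ((\<Sum>i\<in>B. \<Sum>j\<in>C. \<bar>W i j\<bar> + \<bar>W j i\<bar>) / 2)"
proof -
  let ?u = "\<lambda>i j. W i j * \<sigma> i * \<sigma> j"
  have "(\<Sum>i\<in>B \<union> C. \<Sum>j\<in>B \<union> C. ?u i j)
    = (\<Sum>i\<in>B. \<Sum>j\<in>B. ?u i j) + (\<Sum>i\<in>C. \<Sum>j\<in>C. ?u i j)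
      + (\<Sum>i\<in>B. \<Sum>j\<in>C. ?u i j + ?u j i)"
    using assms by (simp add: sum.union_disjoint sum.distrib sum.swap[of _ C B])
  moreover have "- (\<Sum>i\<in>B. \<Sum>j\<in>C. \<bar>W i j\<bar> + \<bar>W j i\<bar>) \<le> (\<Sum>i\<in>B. \<Sum>j\<in>C. ?u i j + ?u j i)"
    unfolding sum_negf[symmetric]
  proof (intro sum_mono)
    fix i j assume "i \<in> B" "j \<in> C"
    then show "- (\<bar>W i j\<bar> + \<bar>W j i\<bar>) \<le> ?u i j + ?u j i"
      using config_values[OF \<sigma>, of i] config_values[OF \<sigma>, of j] by auto
  qed
  ultimately show ?thesis
    using assms by (simp add: ising_weight_def exp_add[symmetric] sum.union_disjoint algebra_simps add_divide_distrib)
qed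

text \<open>
  The comparison is applied on \<open>B \<union> C\<close> with weights that omit the Ising terms between
  \<open>B\<close> and \<open>C\<close>. For the profile \<open>v0\<close> the partition function factorises
  into those of \<open>B\<close> and \<open>C\<close>; for \<open>v1\<close> it is that of
  \<open>B \<union> C\<close> up to the omitted terms.
\<close>

theorem free_energy_superadditive:
  fixes W :: "'i \<Rightarrow> 'i \<Rightarrow> real"
  assumes B: "finite B" and C: "finite C" and disj: "B \<inter> C = {}" and b: "0 \<le> b"
  shows "free_energy W b h B + free_energy W b h C
    \<le> free_energy W b h (B \<union> C) + (\<Sum>i\<in>B. \<Sum>j\<in>C. \<bar>W i j\<bar> + \<bar>W j i\<bar>) / 2"
proof (cases "B = {} \<or> C = {}")
  case True
  have "free_energy W b h {} = 0"
    by (simp add: free_energy_def log_Z_def configs_def ising_weight_def)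
  with True show ?thesis by auto
next
  case False
  define A where "A = B \<union> C"
  have A: "finite A" "B \<subseteq> A" "C \<subseteq> A" using B C by (auto simp: A_def)
  have pos: "0 < card B" "0 < card C" "card A = card B + card C"
    using False B C disj by (auto simp: card_gt_0_iff A_def card_Un_disjoint)
  define D where "D = (\<Sum>i\<in>B. \<Sum>j\<in>C. \<bar>W i j\<bar> + \<bar>W j i\<bar>) / 2"
  define w where "w \<sigma> = ising_weight W h B \<sigma> * ising_weight W h C \<sigma>" for \<sigma>
  interpret split: gaussian_gibbs "configs A" w "A \<times> A" pair_spin 1
    by (rule gaussian_gibbs_spins[OF A(1)]) (simp add: w_def ising_weight_pos)
  (* v0 belongs to independent spin glasses on B and on C, v1 to the one on their union. *)
  define v0 where "v0 e = (if e \<in> B \<times> B then b\<^sup>2 / (2 * real (card B)) else if e \<in> C \<times> C then b\<^sup>2 / (2 * real (card C)) else 0)"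
    for e
  define v1 where "v1 e = b\<^sup>2 / (2 * real (card A))" for e :: "'i \<times> 'i"
  have sqrt_v: "sqrt (b\<^sup>2 / (2 * real (card X))) = b / sqrt (2 * real (card X))" for X :: "'i set"
    using b by (simp add: real_sqrt_divide)
  have compare: "split.quenched (\<lambda>e. sqrt (v0 e)) \<le> split.quenched (\<lambda>e. sqrt (v1 e))"
  proof (rule split.gaussian_comparison)
    fix \<sigma> \<tau> assume \<sigma>: "\<sigma> \<in> configs A" and \<tau>: "\<tau> \<in> configs A"
    let ?\<Delta> = "\<lambda>e. (pair_spin e \<sigma> - pair_spin e \<tau>)\<^sup>2"
    define y z where "y = (\<Sum>i\<in>B. \<sigma> i * \<tau> i)" and "z = (\<Sum>i\<in>C. \<sigma> i * \<tau> i)"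
    define \<beta> \<gamma> where "\<beta> = real (card B)" and "\<gamma> = real (card C)"
    have pos': "0 < \<beta>" "0 < \<gamma>" using pos by (simp_all add: \<beta>_def \<gamma>_def)
    have overlap: "(\<Sum>i\<in>A. \<sigma> i * \<tau> i) = y + z"
      using B C disj by (simp add: A_def y_def z_def sum.union_disjoint)
    have "(\<Sum>e\<in>A \<times> A. v1 e * ?\<Delta> e) = b\<^sup>2 / (2 * (\<beta> + \<gamma>)) * (2 * (\<beta> + \<gamma>)\<^sup>2 - 2 * (y + z)\<^sup>2)"
      using sum_pair_spin_increments[OF \<sigma> \<tau>, of A]
      unfolding v1_def sum_distrib_left[symmetric] by (simp add: overlap pos \<beta>_def \<gamma>_def)
    moreover have "(\<Sum>e\<in>A \<times> A. v0 e * ?\<Delta> e)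
      = b\<^sup>2 / (2 * \<beta>) * (2 * \<beta>\<^sup>2 - 2 * y\<^sup>2) + b\<^sup>2 / (2 * \<gamma>) * (2 * \<gamma>\<^sup>2 - 2 * z\<^sup>2)"
    proof -
      have "(\<Sum>e\<in>A \<times> A. v0 e * ?\<Delta> e) = (\<Sum>e\<in>A \<times> A. if e \<in> B \<times> B then b\<^sup>2 / (2 * real (card B)) * ?\<Delta> e
          else if e \<in> C \<times> C then b\<^sup>2 / (2 * real (card C)) * ?\<Delta> e else 0)"
        by (rule sum.cong) (auto simp: v0_def)
      also have "\<dots> = (\<Sum>e\<in>B \<times> B. b\<^sup>2 / (2 * real (card B)) * ?\<Delta> e) + (\<Sum>e\<in>C \<times> C. b\<^sup>2 / (2 * real (card C)) * ?\<Delta> e)"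
        unfolding A_def by (rule sum_square_split[OF B C disj])
      finally show ?thesis
        using sum_pair_spin_increments[OF \<sigma> \<tau> A(2)] sum_pair_spin_increments[OF \<sigma> \<tau> A(3)]
        unfolding sum_distrib_left[symmetric] by (simp add: y_def z_def \<beta>_def \<gamma>_def)
    qed
    (* The defect in the convexity of the square, as an explicit square. *)
    moreover have "b\<^sup>2 / (2 * (\<beta> + \<gamma>)) * (2 * (\<beta> + \<gamma>)\<^sup>2 - 2 * (y + z)\<^sup>2)
       - (b\<^sup>2 / (2 * \<beta>) * (2 * \<beta>\<^sup>2 - 2 * y\<^sup>2) + b\<^sup>2 / (2 * \<gamma>) * (2 * \<gamma>\<^sup>2 - 2 * z\<^sup>2))
       = b\<^sup>2 * (\<gamma> * y - \<beta> * z)\<^sup>2 / (\<beta> * \<gamma> * (\<beta> + \<gamma>))"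
      using pos' by (simp add: divide_simps power2_eq_square) algebra
    moreover have "0 \<le> b\<^sup>2 * (\<gamma> * y - \<beta> * z)\<^sup>2 / (\<beta> * \<gamma> * (\<beta> + \<gamma>))"
      using pos' by (intro divide_nonneg_nonneg mult_nonneg_nonneg) auto
    ultimately show "0 \<le> (\<Sum>e\<in>A \<times> A. (v1 e - v0 e) * ?\<Delta> e)"
      by (simp add: left_diff_distrib sum_subtractf)
  qed (simp_all add: v0_def v1_def)
  have factor: "split.logsumexp (split.field (\<lambda>e. sqrt (v0 e)) x) = log_Z W b h B x + log_Z W b h C x" for x
  proof -
    define p where "p X \<sigma> = ising_weight W h X \<sigma> * exp (b / sqrt (2 * real (card X)) * (\<Sum>i\<in>X. \<Sum>j\<in>X. x (i, j) * \<sigma> i * \<sigma> j))"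
      for X \<sigma>
    have field: "split.field (\<lambda>e. sqrt (v0 e)) x \<sigma>
       = b / sqrt (2 * real (card B)) * (\<Sum>i\<in>B. \<Sum>j\<in>B. x (i, j) * \<sigma> i * \<sigma> j)
         + b / sqrt (2 * real (card C)) * (\<Sum>i\<in>C. \<Sum>j\<in>C. x (i, j) * \<sigma> i * \<sigma> j)" for \<sigma>
    proof -
      have "split.field (\<lambda>e. sqrt (v0 e)) x \<sigma> = (\<Sum>e\<in>A \<times> A. if e \<in> B \<times> B then b / sqrt (2 * real (card B)) * x e * pair_spin e \<sigma>
          else if e \<in> C \<times> C then b / sqrt (2 * real (card C)) * x e * pair_spin e \<sigma> else 0)"
        unfolding split.field_def by (rule sum.cong) (auto simp: v0_def sqrt_v)
      then show ?thesis
        unfolding A_def sum_square_split[OF B C disj] pair_sum .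
    qed
    have "w \<sigma> * exp (split.field (\<lambda>e. sqrt (v0 e)) x \<sigma>) = p B \<sigma> * p C \<sigma>" for \<sigma>
      unfolding field w_def p_def exp_add by (simp only: mult_ac)
    then have "(\<Sum>\<sigma>\<in>configs A. w \<sigma> * exp (split.field (\<lambda>e. sqrt (v0 e)) x \<sigma>)) = (\<Sum>\<sigma>\<in>configs A. p B \<sigma> * p C \<sigma>)"
      by simp
    also have "\<dots> = (\<Sum>\<sigma>\<in>configs B. p B \<sigma>) * (\<Sum>\<sigma>\<in>configs C. p C \<sigma>)"
      unfolding configs_def A_def
      by (rule sum_PiE_disjoint_product[OF disj]) (simp_all add: p_def ising_weight_def)
    also have "ln \<dots> = log_Z W b h B x + log_Z W b h C x"
    proof -
      have "0 < (\<Sum>\<sigma>\<in>configs X. p X \<sigma>)" if "finite X" for X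
        by (intro sum_pos finite_configs that configs_nonempty) (simp add: p_def ising_weight_pos)
      from ln_mult_pos[OF this[OF B] this[OF C]] show ?thesis
        by (simp add: log_Z_def p_def)
    qed
    finally show ?thesis by (simp add: split.logsumexp_def)
  qed
  have "split.quenched (\<lambda>e. sqrt (v0 e)) = free_energy W b h B + free_energy W b h C"
    unfolding split.quenched_def factor
    using integral_log_Z[OF B A(2), of W b h] integral_log_Z[OF C A(3), of W b h]
      integrable_log_Z_superset[OF B A(2), of W b h] integrable_log_Z_superset[OF C A(3), of W b h]
    by simp
  moreover have "split.quenched (\<lambda>e. sqrt (v1 e)) \<le> free_energy W b h A + D"
  proof -
    have "split.logsumexp (split.field (\<lambda>e. sqrt (v1 e)) x) \<le> log_Z W b h A x + D" for x
    proof -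
      have field: "split.field (\<lambda>e. sqrt (v1 e)) x \<sigma> = b / sqrt (2 * real (card A)) * (\<Sum>i\<in>A. \<Sum>j\<in>A. x (i, j) * \<sigma> i * \<sigma> j)" for \<sigma>
        unfolding split.field_def v1_def sqrt_v pair_sum ..
      let ?u = "split.field (\<lambda>e. sqrt (v1 e)) x"
      have "(\<Sum>\<sigma>\<in>configs A. w \<sigma> * exp (?u \<sigma>)) \<le> (\<Sum>\<sigma>\<in>configs A. ising_weight W h A \<sigma> * exp (?u \<sigma>) * exp D)"
      proof (rule sum_mono)
        fix \<sigma> assume "\<sigma> \<in> configs A"
        then have "w \<sigma> \<le> ising_weight W h A \<sigma> * exp D"
          unfolding w_def D_def A_def by (rule ising_weight_split[OF B C disj])
        from mult_right_mono[OF this, of "exp (?u \<sigma>)"]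
        show "w \<sigma> * exp (?u \<sigma>) \<le> ising_weight W h A \<sigma> * exp (?u \<sigma>) * exp D" by (simp add: mult_ac)
      qed
      then have "ln (\<Sum>\<sigma>\<in>configs A. w \<sigma> * exp (?u \<sigma>)) \<le> ln ((\<Sum>\<sigma>\<in>configs A. ising_weight W h A \<sigma> * exp (?u \<sigma>)) * exp D)"
        using split.Z_pos[of ?u] by (simp add: sum_distrib_right)
      also have "\<dots> = ln (\<Sum>\<sigma>\<in>configs A. ising_weight W h A \<sigma> * exp (?u \<sigma>)) + D"
      proof -
        have "0 < (\<Sum>\<sigma>\<in>configs A. ising_weight W h A \<sigma> * exp (?u \<sigma>))"
          by (intro sum_pos finite_configs A configs_nonempty) (simp add: ising_weight_pos)
        then show ?thesis by (simp add: ln_mult)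
      qed
      finally show ?thesis by (simp add: split.logsumexp_def log_Z_def field)
    qed
    then have "split.quenched (\<lambda>e. sqrt (v1 e)) \<le> (\<integral>x. log_Z W b h A x + D \<partial>gauss (A \<times> A))"
      unfolding split.quenched_def
      by (intro integral_mono split.integrable_logsumexp_field)
         (simp_all add: integrable_log_Z[OF A(1)] prob_space.finite_measure[OF prob_space_gauss] finite_measure.integrable_const)
    also have "\<dots> = free_energy W b h A + D"
      using integrable_log_Z[OF A(1), of W b h] prob_space.prob_space[OF prob_space_gauss, of "A \<times> A"]
      by (simp add: free_energy_def prob_space.finite_measure[OF prob_space_gauss] finite_measure.integrable_const)
    finally show ?thesis .
  qed
  ultimately show ?thesis using compare unfolding A_def D_def by linarith
qed

text \<open>
  Blocks are joined one after the other. The cost \<open>D t\<close> bounds the interaction of a block with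
  any outside set, so it does not grow with the part that has been assembled.
\<close>

lemma free_energy_Union_ge:
  fixes W :: "'i \<Rightarrow> 'i \<Rightarrow> real" and A :: "'k \<Rightarrow> 'i set"
  assumes I: "finite I" and A: "\<And>t. t \<in> I \<Longrightarrow> finite (A t)"
    and disj: "disjoint_family_on A I" and b: "0 \<le> b"
    and boundary: "\<And>t C. t \<in> I \<Longrightarrow> finite C \<Longrightarrow> A t \<inter> C = {} \<Longrightarrow>
      (\<Sum>i\<in>A t. \<Sum>j\<in>C. \<bar>W i j\<bar> + \<bar>W j i\<bar>) / 2 \<le> D t"
  shows "(\<Sum>t\<in>I. free_energy W b h (A t) - D t) \<le> free_energy W b h (\<Union>t\<in>I. A t)"
  using assms
proof (induction I rule: finite_induct)
  case empty
  show ?case by (simp add: free_energy_def log_Z_def configs_def ising_weight_def)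
next
  case (insert t I)
  define U where "U = (\<Union>t\<in>I. A t)"
  have U: "finite U" "A t \<inter> U = {}"
    using insert by (auto simp: U_def disjoint_family_on_def)
  have "(\<Sum>t\<in>I. free_energy W b h (A t) - D t) \<le> free_energy W b h U"
    unfolding U_def
    by (rule insert.IH) (use insert.prems in \<open>auto intro: disjoint_family_on_mono[of I "insert t I"]\<close>)
  moreover have "free_energy W b h (A t) + free_energy W b h U
      \<le> free_energy W b h (A t \<union> U) + (\<Sum>i\<in>A t. \<Sum>j\<in>U. \<bar>W i j\<bar> + \<bar>W j i\<bar>) / 2"
    by (rule free_energy_superadditive) (use insert.prems U in auto)
  moreover have "(\<Sum>i\<in>A t. \<Sum>j\<in>U. \<bar>W i j\<bar> + \<bar>W j i\<bar>) / 2 \<le> D t"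
    by (rule insert.prems(4)) (use U in auto)
  ultimately show ?case using insert.hyps by (simp add: U_def)
qed

section \<open>Lattice cubes and their boundary interaction\<close>

definition lattice_cube :: "int ^ 'd \<Rightarrow> nat \<Rightarrow> (int ^ 'd) set" where
  "lattice_cube a L = {i. \<forall>k. i $ k \<in> {a $ k..<a $ k + int L}}"

text \<open>
  The sum norm on the lattice, since it counts how far a shift moves a cube across its faces.
\<close>

definition l1_norm :: "int ^ 'd \<Rightarrow> real" where
  "l1_norm i = (\<Sum>k\<in>UNIV. \<bar>real_of_int (i $ k)\<bar>)"

lemma vec_product_eq_image: "{i::'b ^ 'd. \<forall>k. i $ k \<in> Q k} = vec_lambda ` (PiE UNIV Q)"
proof (intro set_eqI iffI)
  fix i :: "'b ^ 'd" assume "i \<in> {i. \<forall>k. i $ k \<in> Q k}"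
  then show "i \<in> vec_lambda ` (PiE UNIV Q)"
    by (intro image_eqI[of _ _ "vec_nth i"]) auto
qed auto

lemma inj_vec_lambda: "inj_on vec_lambda X"
  by (rule inj_onI) (simp add: vec_lambda_inject)

lemma finite_vec_product: "(\<And>k. finite (Q k)) \<Longrightarrow> finite {i::'b ^ 'd. \<forall>k. i $ k \<in> Q k}"
  unfolding vec_product_eq_image by (intro finite_imageI finite_PiE) auto

lemma card_vec_product: "card {i::'b ^ 'd. \<forall>k. i $ k \<in> Q k} = (\<Prod>k\<in>UNIV. card (Q k))"
  unfolding vec_product_eq_image by (simp add: card_image[OF inj_vec_lambda] card_PiE)

lemma sum_prod_vec_product:
  fixes f :: "'d::finite \<Rightarrow> 'b \<Rightarrow> real"
  assumes "\<And>k. finite (Q k)"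
  shows "(\<Sum>i\<in>{i::'b ^ 'd. \<forall>k. i $ k \<in> Q k}. \<Prod>k\<in>UNIV. f k (i $ k)) = (\<Prod>k\<in>UNIV. \<Sum>z\<in>Q k. f k z)"
  unfolding vec_product_eq_image
  using assms by (simp add: sum.reindex[OF inj_vec_lambda] prod_sum_PiE)

lemma finite_lattice_cube: "finite (lattice_cube a L)"
  unfolding lattice_cube_def by (rule finite_vec_product) auto

lemma card_lattice_cube: "card (lattice_cube (a :: int ^ 'd) L) = L ^ CARD('d)"
  unfolding lattice_cube_def card_vec_product by simp

lemma lattice_box_eq_cube: "lattice_box N = lattice_cube (\<chi> k. - int N) (2 * N + 1)"
  unfolding lattice_box_def lattice_cube_def by auto

lemma finite_lattice_box: "finite (lattice_box N :: (int ^ 'd) set)"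
  unfolding lattice_box_eq_cube by (rule finite_lattice_cube)

lemma card_lattice_box: "card (lattice_box N :: (int ^ 'd) set) = (2 * N + 1) ^ CARD('d)"
  unfolding lattice_box_eq_cube by (rule card_lattice_cube)

lemma lattice_cube_translate: "lattice_cube (a + v) L = (\<lambda>i. i + v) ` lattice_cube a L"
proof (intro set_eqI iffI)
  fix i assume "i \<in> lattice_cube (a + v) L"
  then show "i \<in> (\<lambda>i. i + v) ` lattice_cube a L"
    by (intro image_eqI[of _ _ "i - v"]) (auto simp: lattice_cube_def algebra_simps)
qed (auto simp: lattice_cube_def)

lemma lattice_cube_1: "lattice_cube a 1 = {a}"
proof (intro set_eqI iffI)
  fix i assume i: "i \<in> lattice_cube a 1"
  have "i $ k = a $ k" for k
    using i unfolding lattice_cube_def mem_Collect_eq by (drule_tac spec[of _ k]) simp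
  then show "i \<in> {a}" by (simp add: vec_eq_iff)
qed (simp add: lattice_cube_def)

text \<open>
  A site that leaves the cube under the shift by \<open>- k\<close> leaves it in some coordinate
  \<open>c\<close>, and then its \<open>c\<close>-th coordinate is one of the at most
  \<open>\<bar>k $ c\<bar>\<close> values next to one of the two faces.
\<close>

lemma card_lattice_cube_leaving:
  "real (card {i \<in> lattice_cube (a :: int ^ 'd) L. i - k \<notin> lattice_cube a L}) \<le> l1_norm k * real L ^ (CARD('d) - 1)"
proof -
  define Z where "Z c = {z \<in> {a $ c..<a $ c + int L}. z - k $ c \<notin> {a $ c..<a $ c + int L}}" for c
  define P where "P c = {i::int ^ 'd. \<forall>c'. i $ c' \<in> (if c' = c then Z c else {a $ c'..<a $ c' + int L})}" for c
  have finZ: "finite (Z c)" for c unfolding Z_def by (rule finite_subset[of _ "{a $ c..<a $ c + int L}"]) auto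
  have finP: "finite (P c)" for c unfolding P_def by (rule finite_vec_product) (auto simp: finZ)
  have cardZ: "real (card (Z c)) \<le> \<bar>real_of_int (k $ c)\<bar>" for c
  proof (cases "0 \<le> k $ c")
    case True
    then have "Z c \<subseteq> {a $ c..<a $ c + k $ c}" by (auto simp: Z_def)
    then have "card (Z c) \<le> nat (k $ c)" using card_mono[of "{a $ c..<a $ c + k $ c}" "Z c"] by simp
    then show ?thesis using True by linarith
  next
    case False
    then have "Z c \<subseteq> {a $ c + int L + k $ c..<a $ c + int L}" by (auto simp: Z_def)
    then have "card (Z c) \<le> nat (- (k $ c))"
      using card_mono[of "{a $ c + int L + k $ c..<a $ c + int L}" "Z c"] by simp
    then show ?thesis using False by linarith
  qed
  have cardP: "real (card (P c)) \<le> \<bar>real_of_int (k $ c)\<bar> * real L ^ (CARD('d) - 1)" for c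
  proof -
    have "card (P c) = (\<Prod>c'\<in>UNIV. card (if c' = c then Z c else {a $ c'..<a $ c' + int L}))"
      unfolding P_def by (rule card_vec_product)
    also have "\<dots> = card (Z c) * (\<Prod>c'\<in>UNIV - {c}. card (if c' = c then Z c else {a $ c'..<a $ c' + int L}))"
      by (subst prod.remove[of UNIV c]) auto
    also have "(\<Prod>c'\<in>UNIV - {c}. card (if c' = c then Z c else {a $ c'..<a $ c' + int L})) = (\<Prod>c'\<in>UNIV - {c}. L)"
      by (rule prod.cong) auto
    also have "\<dots> = L ^ (CARD('d) - 1)" by (simp add: card_Diff_singleton)
    finally show ?thesis using mult_right_mono[OF cardZ[of c], of "real L ^ (CARD('d) - 1)"] by simp
  qed
  have "{i \<in> lattice_cube a L. i - k \<notin> lattice_cube a L} \<subseteq> (\<Union>c. P c)"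
  proof
    fix i assume i: "i \<in> {i \<in> lattice_cube a L. i - k \<notin> lattice_cube a L}"
    then obtain c where "(i - k) $ c \<notin> {a $ c..<a $ c + int L}"
      unfolding lattice_cube_def by blast
    then have "i \<in> P c" using i by (auto simp: P_def Z_def lattice_cube_def)
    then show "i \<in> (\<Union>c. P c)" by auto
  qed
  then have "card {i \<in> lattice_cube a L. i - k \<notin> lattice_cube a L} \<le> card (\<Union>c. P c)"
    by (intro card_mono) (auto simp: finP)
  also have "\<dots> \<le> (\<Sum>c\<in>UNIV. card (P c))" by (rule card_UN_le) simp
  finally have "real (card {i \<in> lattice_cube a L. i - k \<notin> lattice_cube a L}) \<le> (\<Sum>c\<in>UNIV. real (card (P c)))"
    unfolding of_nat_sum[symmetric] of_nat_le_iff .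
  also have "\<dots> \<le> (\<Sum>c\<in>UNIV. \<bar>real_of_int (k $ c)\<bar> * real L ^ (CARD('d) - 1))"
    by (intro sum_mono cardP)
  finally show ?thesis by (simp add: l1_norm_def sum_distrib_right)
qed

lemma sum_exp_abs_int_le:
  assumes "0 < a"
  shows "(\<Sum>z\<in>{- int n..int n}. exp (- a * \<bar>real_of_int z\<bar>)) \<le> 2 / (1 - exp (- a))"
proof -
  have r: "exp (- a) < 1" using assms by simp
  have geometric: "(\<Sum>m\<le>n. exp (- a * real m)) \<le> 1 / (1 - exp (- a))"
  proof -
    have "(\<Sum>m\<le>n. exp (- a * real m)) = (\<Sum>m\<le>n. exp (- a) ^ m)"
      by (simp add: exp_of_nat_mult[symmetric] mult.commute)
    also have "\<dots> \<le> (\<Sum>m. exp (- a) ^ m)"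
      by (rule sum_le_suminf) (use r in \<open>auto intro: summable_geometric\<close>)
    also have "\<dots> = 1 / (1 - exp (- a))" using r by (intro suminf_geometric) auto
    finally show ?thesis .
  qed
  let ?f = "\<lambda>z. exp (- a * \<bar>real_of_int z\<bar>)"
  have "{- int n..int n} \<subseteq> int ` {..n} \<union> (\<lambda>m. - int m) ` {..n}"
  proof
    fix z assume "z \<in> {- int n..int n}"
    then show "z \<in> int ` {..n} \<union> (\<lambda>m. - int m) ` {..n}"
      by (cases "0 \<le> z") (auto intro!: image_eqI[of _ _ "nat \<bar>z\<bar>"])
  qed
  then have "sum ?f {- int n..int n} \<le> sum ?f (int ` {..n} \<union> (\<lambda>m. - int m) ` {..n})"
    by (intro sum_mono2) auto
  also have "\<dots> \<le> sum ?f (int ` {..n}) + sum ?f ((\<lambda>m. - int m) ` {..n})"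
    by (subst sum.union_inter[symmetric]) (auto intro: sum_nonneg)
  also have "\<dots> = (\<Sum>m\<le>n. exp (- a * real m)) + (\<Sum>m\<le>n. exp (- a * real m))"
    by (subst (1 2) sum.reindex) (auto simp: inj_on_def)
  finally show ?thesis using geometric by simp
qed

lemma l1_norm_le_lattice_norm: "l1_norm (i :: int ^ 'd) \<le> real CARD('d) * lattice_norm i"
proof -
  have "\<bar>real_of_int (i $ k)\<bar> \<le> lattice_norm i" for k
    using component_le_norm_cart[of "(\<chi> k. real_of_int (i $ k)) :: real ^ 'd" k] by (simp add: lattice_norm_def)
  then show ?thesis unfolding l1_norm_def using sum_bounded_above[of UNIV "\<lambda>k. \<bar>real_of_int (i $ k)\<bar>"] by simp
qed

text \<open>
  Half of the exponential rate absorbs the weight; the rest is bounded by a product over the coordinates,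
  since each coordinate is at most the Euclidean norm, and the sum over a box becomes a power of a geometric
  series.
\<close>

lemma exponential_decay_weighted_sum_bounded:
  fixes K :: "int ^ 'd \<Rightarrow> real"
  assumes "0 < C1" "0 < C2" and K: "\<And>i. \<bar>K i\<bar> \<le> C1 * exp (- C2 * lattice_norm i)"
  shows "\<exists>S\<ge>0. \<forall>D. finite D \<longrightarrow> (\<Sum>i\<in>D. \<bar>K i\<bar> * (1 + l1_norm i)) \<le> S"
proof -
  define d where "d = real CARD('d)"
  define c where "c = C2 / (2 * d)"
  define C3 where "C3 = max 1 (1 / c)"
  define T where "T = 2 / (1 - exp (- c))"
  have d: "0 < d" by (simp add: d_def)
  then have c: "0 < c" using assms by (simp add: c_def)
  have l1_nonneg: "0 \<le> l1_norm i" for i :: "int ^ 'd" by (simp add: l1_norm_def sum_nonneg)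
  have summand: "\<bar>K i\<bar> * (1 + l1_norm i) \<le> C1 * C3 * (\<Prod>k\<in>UNIV. exp (- c * \<bar>real_of_int (i $ k)\<bar>))" for i
  proof -
    have C3: "1 \<le> C3" "1 \<le> C3 * c" using c by (auto simp: C3_def max_def field_simps)
    have "1 + l1_norm i \<le> C3 * (1 + c * l1_norm i)"
      using C3 mult_right_mono[OF C3(2) l1_nonneg[of i]] by (simp add: algebra_simps)
    also have "\<dots> \<le> C3 * exp (c * l1_norm i)"
      using C3 by (intro mult_left_mono exp_ge_add_one_self) auto
    finally have 1: "1 + l1_norm i \<le> C3 * exp (c * l1_norm i)" .
    have "2 * c * l1_norm i \<le> 2 * c * (d * lattice_norm i)"
      using l1_norm_le_lattice_norm[of i] c by (intro mult_left_mono) (auto simp: d_def)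
    also have "\<dots> = C2 * lattice_norm i" using d by (simp add: c_def)
    finally have "\<bar>K i\<bar> \<le> C1 * exp (- 2 * c * l1_norm i)"
      using assms(1) by (intro order_trans[OF K] mult_left_mono) auto
    then have "\<bar>K i\<bar> * (1 + l1_norm i) \<le> C1 * exp (- 2 * c * l1_norm i) * (C3 * exp (c * l1_norm i))"
      using 1 assms(1) l1_nonneg[of i] by (intro mult_mono) auto
    also have "\<dots> = C1 * C3 * exp (- c * l1_norm i)"
      by (simp add: exp_add[symmetric] mult_ac)
    also have "exp (- c * l1_norm i) = (\<Prod>k\<in>UNIV. exp (- c * \<bar>real_of_int (i $ k)\<bar>))"
      by (simp add: l1_norm_def sum_distrib_left exp_sum)
    finally show ?thesis .
  qed
  have T: "0 \<le> T" using c by (simp add: T_def)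
  show ?thesis
  proof (intro exI[of _ "C1 * C3 * T ^ CARD('d)"] conjI allI impI)
    show "0 \<le> C1 * C3 * T ^ CARD('d)" using assms T by (simp add: C3_def)
    fix D :: "(int ^ 'd) set" assume D: "finite D"
    (* D lies in a box of half side n. *)
    define n where "n = Max (insert 0 ((\<lambda>(i, k). nat \<bar>i $ k\<bar>) ` (D \<times> (UNIV :: 'd set))))"
    have bound: "i $ k \<in> {- int n..int n}" if "i \<in> D" for i k
    proof -
      have "nat \<bar>i $ k\<bar> \<le> n" unfolding n_def using D that by (intro Max_ge) auto
      then show ?thesis by auto
    qed
    let ?Q = "{i :: int ^ 'd. \<forall>k. i $ k \<in> {- int n..int n}}"
    have "(\<Sum>i\<in>D. \<bar>K i\<bar> * (1 + l1_norm i)) \<le> (\<Sum>i\<in>?Q. \<bar>K i\<bar> * (1 + l1_norm i))"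
      using bound l1_nonneg by (intro sum_mono2 finite_vec_product) (auto intro!: mult_nonneg_nonneg add_nonneg_nonneg)
    also have "\<dots> \<le> (\<Sum>i\<in>?Q. C1 * C3 * (\<Prod>k\<in>UNIV. exp (- c * \<bar>real_of_int (i $ k)\<bar>)))"
      by (intro sum_mono summand)
    also have "\<dots> = C1 * C3 * (\<Prod>k\<in>(UNIV :: 'd set). \<Sum>z\<in>{- int n..int n}. exp (- c * \<bar>real_of_int z\<bar>))"
      unfolding sum_distrib_left[symmetric] by (subst sum_prod_vec_product) auto
    also have "\<dots> \<le> C1 * C3 * (\<Prod>k\<in>(UNIV :: 'd set). T)"
      unfolding T_def using assms c
      by (intro mult_left_mono prod_mono conjI sum_exp_abs_int_le sum_nonneg) (auto simp: C3_def)
    finally show "(\<Sum>i\<in>D. \<bar>K i\<bar> * (1 + l1_norm i)) \<le> C1 * C3 * T ^ CARD('d)" by simp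
  qed
qed

text \<open>
  Pairs are sorted by their difference \<open>k\<close>: at most
  \<open>l1_norm k * L ^ (d - 1)\<close> sites of the cube have their partner outside. So the cost is
  that of the surface.
\<close>

lemma cube_boundary_interaction:
  fixes K :: "int ^ 'd \<Rightarrow> real"
  assumes S: "\<And>D. finite D \<Longrightarrow> (\<Sum>k\<in>D. \<bar>K k\<bar> * (1 + l1_norm k)) \<le> S"
    and C: "finite C" "lattice_cube a L \<inter> C = {}"
  shows "(\<Sum>i\<in>lattice_cube a L. \<Sum>j\<in>C. \<bar>K (i - j)\<bar> + \<bar>K (j - i)\<bar>) \<le> 2 * S * real L ^ (CARD('d) - 1)"
proof -
  let ?A = "lattice_cube a L"
  define \<phi> where "\<phi> k = \<bar>K k\<bar> + \<bar>K (- k)\<bar>" for k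
  define D where "D = (\<lambda>(i, j). i - j) ` (?A \<times> C)"
  have finD: "finite D" unfolding D_def using C finite_lattice_cube by blast
  have l1_nonneg: "0 \<le> l1_norm i" for i :: "int ^ 'd" by (simp add: l1_norm_def sum_nonneg)
  have l1_uminus: "l1_norm (- k) = l1_norm k" for k :: "int ^ 'd" by (simp add: l1_norm_def)
  have S': "(\<Sum>k\<in>D. \<bar>K k\<bar> * l1_norm k) \<le> S" if "finite D" for D
  proof -
    have "(\<Sum>k\<in>D. \<bar>K k\<bar> * l1_norm k) \<le> (\<Sum>k\<in>D. \<bar>K k\<bar> * (1 + l1_norm k))"
      by (intro sum_mono mult_left_mono) auto
    with S[OF that] show ?thesis by linarith
  qed
  have "(\<Sum>j\<in>C. \<bar>K (i - j)\<bar> + \<bar>K (j - i)\<bar>) \<le> (\<Sum>k\<in>D. if i - k \<notin> ?A then \<phi> k else 0)" if i: "i \<in> ?A" for i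
  proof -
    have "(\<Sum>j\<in>C. \<bar>K (i - j)\<bar> + \<bar>K (j - i)\<bar>) = (\<Sum>k\<in>(\<lambda>j. i - j) ` C. \<phi> k)"
      by (subst sum.reindex) (auto simp: inj_on_def \<phi>_def)
    also have "\<dots> = (\<Sum>k\<in>(\<lambda>j. i - j) ` C. if i - k \<notin> ?A then \<phi> k else 0)"
      using C by (intro sum.cong) auto
    also have "\<dots> \<le> (\<Sum>k\<in>D. if i - k \<notin> ?A then \<phi> k else 0)"
      using i by (intro sum_mono2 finD) (auto simp: D_def \<phi>_def)
    finally show ?thesis .
  qed
  then have "(\<Sum>i\<in>?A. \<Sum>j\<in>C. \<bar>K (i - j)\<bar> + \<bar>K (j - i)\<bar>)
     \<le> (\<Sum>i\<in>?A. \<Sum>k\<in>D. if i - k \<notin> ?A then \<phi> k else 0)"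
    by (rule sum_mono)
  also have "\<dots> = (\<Sum>k\<in>D. \<Sum>i\<in>?A. if i - k \<notin> ?A then \<phi> k else 0)" by (rule sum.swap)
  also have "\<dots> = (\<Sum>k\<in>D. \<phi> k * real (card {i \<in> ?A. i - k \<notin> ?A}))"
    by (simp add: sum.inter_filter[symmetric] finite_lattice_cube mult.commute)
  also have "\<dots> \<le> (\<Sum>k\<in>D. \<phi> k * (l1_norm k * real L ^ (CARD('d) - 1)))"
    by (intro sum_mono mult_left_mono card_lattice_cube_leaving) (simp add: \<phi>_def)
  also have "\<dots> = ((\<Sum>k\<in>D. \<bar>K k\<bar> * l1_norm k) + (\<Sum>k\<in>uminus ` D. \<bar>K k\<bar> * l1_norm k)) * real L ^ (CARD('d) - 1)"
    by (subst sum.reindex)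
       (auto simp: inj_on_def \<phi>_def l1_uminus sum_distrib_left sum_distrib_right sum.distrib[symmetric] algebra_simps)
  also have "\<dots> \<le> (S + S) * real L ^ (CARD('d) - 1)"
    by (intro mult_right_mono add_mono S' finD finite_imageI) simp
  finally show ?thesis by simp
qed

section \<open>Convergence of the mean pressure\<close>

text \<open>
  A value close to the upper limit is attained at arbitrarily late \<open>M\<close>, and eventually the
  sequence stays above it up to \<open>\<epsilon>\<close>.
\<close>

lemma almost_increasing_bounded_converges:
  fixes p :: "nat \<Rightarrow> real"
  assumes bdd: "\<And>n. p n \<le> B"
    and incr: "\<And>\<epsilon>. 0 < \<epsilon> \<Longrightarrow> \<forall>\<^sub>F M in sequentially. \<forall>\<^sub>F N in sequentially. p M - \<epsilon> \<le> p N"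
  shows "\<exists>l. p \<longlonglongrightarrow> l"
proof -
  define U where "U = {x. \<forall>\<^sub>F N in sequentially. p N \<le> x}"
  define l where "l = Inf U"
  have "B \<in> U" using bdd by (simp add: U_def)
  obtain M0 where M0: "\<forall>\<^sub>F N in sequentially. p M0 - 1 \<le> p N"
    using eventually_happens'[OF sequentially_bot incr[of 1]] by auto
  have "p M0 - 1 \<le> x" if "x \<in> U" for x
  proof -
    have "\<forall>\<^sub>F N in sequentially. p M0 - 1 \<le> x"
      using M0 that unfolding U_def mem_Collect_eq by eventually_elim linarith
    then show ?thesis by simp
  qed
  then have bdd_U: "bdd_below U" by (rule bdd_belowI)
  have "p \<longlonglongrightarrow> l"
  proof (rule LIMSEQ_I)
    fix r :: real assume r: "0 < r"
    have upper: "\<forall>\<^sub>F N in sequentially. p N < l + r"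
    proof -
      obtain x where "x \<in> U" "x < l + r"
        using cInf_lessD[of U "l + r"] \<open>B \<in> U\<close> r by (auto simp: l_def)
      then show ?thesis unfolding U_def mem_Collect_eq by (auto elim: eventually_mono)
    qed
    have "l - r / 2 \<notin> U" using cInf_lower[OF _ bdd_U, of "l - r / 2"] r by (auto simp: l_def)
    then have "\<exists>\<^sub>F M in sequentially. l - r / 2 < p M"
      by (simp add: U_def frequently_def not_less)
    moreover have "\<forall>\<^sub>F M in sequentially. \<forall>\<^sub>F N in sequentially. p M - r / 2 \<le> p N" using incr[of "r / 2"] r by simp
    ultimately have "\<exists>\<^sub>F M in sequentially. (\<forall>\<^sub>F N in sequentially. p M - r / 2 \<le> p N) \<and> l - r / 2 < p M"
      by (rule frequently_eventually_conj)
    then obtain M where M: "l - r / 2 < p M" "\<forall>\<^sub>F N in sequentially. p M - r / 2 \<le> p N"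
      by (auto dest: frequently_ex)
    from M(2) upper have "\<forall>\<^sub>F N in sequentially. norm (p N - l) < r"
    proof eventually_elim
      case (elim N)
      then show ?case using M(1) unfolding real_norm_def by linarith
    qed
    then show "\<exists>no. \<forall>N\<ge>no. norm (p N - l) < r" by (simp add: eventually_sequentially)
  qed
  then show ?thesis ..
qed

lemma free_energy_translate:
  fixes K :: "int ^ 'd \<Rightarrow> real"
  shows "free_energy (\<lambda>i j. \<kappa> * K (i - j)) b h (lattice_cube a L)
    = free_energy (\<lambda>i j. \<kappa> * K (i - j)) b h (lattice_cube c L)"
proof -
  have "lattice_cube a L = (\<lambda>i. i + (a - c)) ` lattice_cube c L"
    using lattice_cube_translate[of c "a - c" L] by simp
  then show ?thesis
    by (simp only:) (rule free_energy_bij[OF finite_lattice_cube], auto simp: inj_on_def)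
qed

text \<open>
  The box of side \<open>2 * N + 1\<close> is cut into \<open>m\<close> cubes of side
  \<open>2 * M + 1\<close> in each direction and single sites for what is left over. A single site is a
  cube of side 1, so its cost is covered by the same estimate.
\<close>

lemma free_energy_box_tiling:
  fixes K :: "int ^ 'd \<Rightarrow> real" and \<kappa> b h :: real
  defines "F \<equiv> free_energy (\<lambda>i j. \<kappa> * K (i - j)) b h"
  assumes \<kappa>: "0 \<le> \<kappa>" and b: "0 \<le> b"
    and S: "\<And>D. finite D \<Longrightarrow> (\<Sum>k\<in>D. \<bar>K k\<bar> * (1 + l1_norm k)) \<le> S"
    and m: "m * (2 * M + 1) \<le> 2 * N + 1"
  shows "real (m ^ CARD('d)) * (F (lattice_box M) - \<kappa> * S * real (2 * M + 1) ^ (CARD('d) - 1))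
      + real ((2 * N + 1) ^ CARD('d) - (m * (2 * M + 1)) ^ CARD('d)) * (F {0} - \<kappa> * S)
     \<le> F (lattice_box N)"
proof -
  define L where "L = 2 * M + 1"
  define T where "T = {t :: int ^ 'd. \<forall>k. t $ k \<in> {0..<int m}}"
  define corner :: "int ^ 'd \<Rightarrow> int ^ 'd" where "corner t = (\<chi> k. - int N + int L * t $ k)" for t
  define U where "U = (\<Union>t\<in>T. lattice_cube (corner t) L)"
  define Rest where "Rest = lattice_box N - U"
  have L: "0 < L" by (simp add: L_def)
  have finT: "finite T" and cardT: "card T = m ^ CARD('d)"
    unfolding T_def by (rule finite_vec_product, simp) (subst card_vec_product, simp)
  have finU: "finite U" unfolding U_def using finT finite_lattice_cube by blast
  have tile_index: "t $ k = (i $ k + int N) div int L" if "i \<in> lattice_cube (corner t) L" for i t k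
  proof -
    have "corner t $ k \<le> i $ k" "i $ k < corner t $ k + int L"
      using that by (auto simp: lattice_cube_def)
    then show ?thesis
      by (intro int_div_pos_eq[symmetric, of _ _ _ "i $ k + int N - int L * t $ k"]) (auto simp: corner_def)
  qed
  have disj: "disjoint_family_on (\<lambda>t. lattice_cube (corner t) L) T"
    unfolding disjoint_family_on_def
  proof (intro ballI impI equals0I)
    fix t t' i assume "t \<noteq> t'" "i \<in> lattice_cube (corner t) L \<inter> lattice_cube (corner t') L"
    then show False using tile_index[of i t] tile_index[of i t'] by (auto simp: vec_eq_iff)
  qed
  have cardU: "card U = (m * L) ^ CARD('d)"
    unfolding U_def using disj finT
    by (subst card_UN_disjoint)
       (auto simp: finite_lattice_cube card_lattice_cube cardT disjoint_family_on_def power_mult_distrib)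
  have sub: "U \<subseteq> lattice_box N"
  proof
    fix i assume "i \<in> U"
    then obtain t where t: "t \<in> T" and i: "i \<in> lattice_cube (corner t) L" by (auto simp: U_def)
    show "i \<in> lattice_box N" unfolding lattice_box_def mem_Collect_eq
    proof
      fix k
      have "t $ k \<in> {0..<int m}" using t unfolding T_def by blast
      then have "0 \<le> t $ k" "t $ k + 1 \<le> int m" by auto
      then have "0 \<le> int L * t $ k" "int L * (t $ k + 1) \<le> int L * int m"
        by (simp_all only: mult_nonneg_nonneg mult_left_mono of_nat_0_le_iff)
      moreover have "int L * int m \<le> 2 * int N + 1"
      proof -
        have "int (m * L) \<le> int (2 * N + 1)" using m unfolding L_def[symmetric] of_nat_le_iff .
        then show ?thesis by (simp add: mult.commute)
      qed
      moreover have "- int N + int L * t $ k \<le> i $ k" "i $ k < - int N + int L * t $ k + int L"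
        using i by (auto simp: lattice_cube_def corner_def)
      ultimately show "i $ k \<in> {- int N..int N}"
        unfolding atLeastAtMost_iff distrib_left mult_1_right by linarith
    qed
  qed
  have fin_Rest: "finite Rest"
    unfolding Rest_def by (intro finite_Diff finite_lattice_box)
  have card_Rest: "card Rest = (2 * N + 1) ^ CARD('d) - (m * L) ^ CARD('d)"
    unfolding Rest_def using sub finU cardU by (simp add: card_Diff_subset card_lattice_box)
  have F_singleton: "F {r} = F {0}" for r
    using free_energy_translate[of \<kappa> K b h r 1 0] unfolding F_def lattice_cube_1 .
  have F_tile: "F (lattice_cube (corner t) L) = F (lattice_box M)" for t
    unfolding F_def L_def lattice_box_eq_cube by (rule free_energy_translate)
  (* The blocks are indexed by a disjoint sum: tiles on the left, leftover sites on the right. *)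
  define A where "A = case_sum (\<lambda>t. lattice_cube (corner t) L) (\<lambda>r. {r})"
  define D where "D = case_sum (\<lambda>_ :: int ^ 'd. \<kappa> * S * real L ^ (CARD('d) - 1)) (\<lambda>_ :: int ^ 'd. \<kappa> * S)"
  have cost: "(\<Sum>i\<in>lattice_cube a l. \<Sum>j\<in>C. \<bar>\<kappa> * K (i - j)\<bar> + \<bar>\<kappa> * K (j - i)\<bar>) / 2 \<le> \<kappa> * S * real l ^ (CARD('d) - 1)"
    if "finite C" "lattice_cube a l \<inter> C = {}" for a l C
  proof -
    have "(\<Sum>i\<in>lattice_cube a l. \<Sum>j\<in>C. \<bar>\<kappa> * K (i - j)\<bar> + \<bar>\<kappa> * K (j - i)\<bar>)
      = \<kappa> * (\<Sum>i\<in>lattice_cube a l. \<Sum>j\<in>C. \<bar>K (i - j)\<bar> + \<bar>K (j - i)\<bar>)"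
      using \<kappa> by (simp add: sum_distrib_left abs_mult algebra_simps)
    also have "\<dots> \<le> \<kappa> * (2 * S * real l ^ (CARD('d) - 1))"
      by (intro mult_left_mono cube_boundary_interaction S that \<kappa>)
    finally show ?thesis by simp
  qed
  have "(\<Sum>s\<in>T <+> Rest. F (A s) - D s) \<le> F (\<Union>s\<in>T <+> Rest. A s)"
    unfolding F_def
  proof (rule free_energy_Union_ge[OF _ _ _ b])
    show "finite (T <+> Rest)" using finT fin_Rest by simp
    show "finite (A s)" for s by (cases s) (auto simp: A_def finite_lattice_cube)
    show "disjoint_family_on A (T <+> Rest)"
      using disj unfolding disjoint_family_on_def A_def Rest_def U_def by (auto split: sum.splits)
    show "(\<Sum>i\<in>A s. \<Sum>j\<in>C. \<bar>\<kappa> * K (i - j)\<bar> + \<bar>\<kappa> * K (j - i)\<bar>) / 2 \<le> D s"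
      if "finite C" "A s \<inter> C = {}" for s C
    proof (cases s)
      case (Inl t)
      then show ?thesis using cost[of C "corner t" L] that by (simp add: A_def D_def)
    next
      case (Inr r)
      then show ?thesis using cost[of C r 1] that unfolding lattice_cube_1 by (simp add: A_def D_def)
    qed
  qed
  moreover have "(\<Union>s\<in>T <+> Rest. A s) = lattice_box N"
    using sub unfolding A_def Rest_def U_def by (auto simp: Plus_def)
  moreover have "(\<Sum>s\<in>T <+> Rest. F (A s) - D s)
     = real (card T) * (F (lattice_box M) - \<kappa> * S * real L ^ (CARD('d) - 1)) + real (card Rest) * (F {0} - \<kappa> * S)"
  proof -
    have "F (A (Inl t)) = F (lattice_box M)" for t unfolding A_def sum.case by (rule F_tile)
    moreover have "F (A (Inr r)) = F {0}" for r unfolding A_def sum.case by (rule F_singleton)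
    ultimately show ?thesis using finT fin_Rest by (simp add: sum.Plus D_def comp_def)
  qed
  ultimately show ?thesis unfolding cardT card_Rest L_def by simp
qed

text \<open>
  With \<open>m\<close> as large as possible, the fraction \<open>\<theta> N\<close> of the box that the
  tiles cover tends to 1.
\<close>

lemma mean_pressure_converges:
  fixes K :: "int ^ 'd \<Rightarrow> real"
  assumes \<kappa>: "0 \<le> \<kappa>" and b: "0 \<le> b"
    and S: "\<And>D. finite D \<Longrightarrow> (\<Sum>k\<in>D. \<bar>K k\<bar> * (1 + l1_norm k)) \<le> S"
  shows "\<exists>p. (\<lambda>N. free_energy (\<lambda>i j. \<kappa> * K (i - j)) b h (lattice_box N) / card (lattice_box N :: (int ^ 'd) set)) \<longlonglongrightarrow> p"
proof -
  define F where "F = free_energy (\<lambda>i j. \<kappa> * K (i - j)) b h"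
  define d where "d = CARD('d)"
  define R where "R N = real (2 * N + 1)" for N
  define p where "p N = F (lattice_box N) / R N ^ d" for N
  have R: "0 < R N" for N by (simp add: R_def)
  have R_at_top: "filterlim R at_top sequentially"
    unfolding R_def
    by (rule filterlim_compose[OF filterlim_real_sequentially filterlim_subseq]) (simp add: strict_mono_def)
  have card_box: "real (card (lattice_box N :: (int ^ 'd) set)) = R N ^ d" for N
    by (simp add: card_lattice_box R_def d_def)
  have d: "0 < d" by (simp add: d_def)
  have S0: "0 \<le> S" using S[of "{}"] by simp
  have bdd: "p N \<le> ln 2 + \<kappa> * S / 2 + \<bar>h\<bar> + b\<^sup>2 / 4" for N
  proof -
    have "(\<Sum>j\<in>lattice_box N. \<bar>\<kappa> * K (i - j)\<bar>) \<le> \<kappa> * S" for i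
    proof -
      have "(\<Sum>j\<in>lattice_box N. \<bar>\<kappa> * K (i - j)\<bar>) = \<kappa> * (\<Sum>k\<in>(\<lambda>j. i - j) ` lattice_box N. \<bar>K k\<bar>)"
        using \<kappa> by (subst sum.reindex) (auto simp: inj_on_def abs_mult sum_distrib_left)
      also have "\<dots> \<le> \<kappa> * (\<Sum>k\<in>(\<lambda>j. i - j) ` lattice_box N. \<bar>K k\<bar> * (1 + l1_norm k))"
        by (intro mult_left_mono sum_mono \<kappa>) (simp add: algebra_simps l1_norm_def sum_nonneg)
      also have "\<dots> \<le> \<kappa> * S" by (intro mult_left_mono \<kappa> S finite_imageI finite_lattice_box)
      finally show ?thesis .
    qed
    from free_energy_upper_bound[OF finite_lattice_box this, where h = h and b = b] show ?thesis
      using R[of N] by (simp add: p_def F_def card_box divide_le_eq)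
  qed
  have lower: "\<forall>\<^sub>F N in sequentially. p M - \<kappa> * S / R M - \<epsilon> \<le> p N" if "0 < \<epsilon>" for M \<epsilon>
  proof -
    define m where "m N = (2 * N + 1) div (2 * M + 1)" for N
    define \<theta> where "\<theta> N = (real (m N) * R M / R N) ^ d" for N
    define c0 where "c0 = F {0} - \<kappa> * S"
    have m_le: "m N * (2 * M + 1) \<le> 2 * N + 1" for N unfolding m_def by (rule div_times_less_eq_dividend)
    have bound: "\<theta> N * (p M - \<kappa> * S / R M) + (1 - \<theta> N) * c0 \<le> p N" for N
    proof -
      have mono: "(m N * (2 * M + 1)) ^ d \<le> (2 * N + 1) ^ d" by (rule power_mono[OF m_le]) simp
      have "R M ^ d = R M * R M ^ (d - 1)" using d by (cases d) auto
      then have "real (m N ^ d) * (F (lattice_box M) - \<kappa> * S * R M ^ (d - 1))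
         = (real (m N) * R M) ^ d * (p M - \<kappa> * S / R M)"
        using R[of M] by (simp add: p_def power_mult_distrib field_simps)
      moreover have "real ((2 * N + 1) ^ d - (m N * (2 * M + 1)) ^ d) = R N ^ d - (real (m N) * R M) ^ d"
        using mono by (subst of_nat_diff) (auto simp: R_def algebra_simps)
      ultimately have "(real (m N) * R M) ^ d * (p M - \<kappa> * S / R M) + (R N ^ d - (real (m N) * R M) ^ d) * c0
           \<le> F (lattice_box N)"
        using free_energy_box_tiling[OF \<kappa> b S m_le[of N], of h]
        unfolding F_def[symmetric] c0_def d_def[symmetric] R_def[symmetric] by simp
      then have "((real (m N) * R M) ^ d * (p M - \<kappa> * S / R M) + (R N ^ d - (real (m N) * R M) ^ d) * c0) / R N ^ d
           \<le> p N"
        unfolding p_def using R[of N] by (intro divide_right_mono) auto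
      then show ?thesis using R[of N] by (simp add: \<theta>_def power_divide add_divide_distrib diff_divide_distrib left_diff_distrib)
    qed
    have ratio: "(\<lambda>N. real (m N) * R M / R N) \<longlonglongrightarrow> 1"
    proof (rule tendsto_sandwich[of "\<lambda>N. 1 - R M / R N" _ _ "\<lambda>_. 1"])
      have "(\<lambda>N. 1 - R M / R N) \<longlonglongrightarrow> 1 - 0"
        by (intro tendsto_diff tendsto_const real_tendsto_divide_at_top[OF tendsto_const R_at_top])
      then show "(\<lambda>N. 1 - R M / R N) \<longlonglongrightarrow> 1" by simp
      have "1 - R M / R N \<le> real (m N) * R M / R N" for N
      proof -
        have "2 * N + 1 \<le> m N * (2 * M + 1) + (2 * M + 1)"
          unfolding m_def using dividend_less_div_times[of "2 * M + 1" "2 * N + 1"] by simp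
        then have "real (2 * N + 1) \<le> real (m N * (2 * M + 1) + (2 * M + 1))" by (simp only: of_nat_le_iff)
        then have "R N - R M \<le> real (m N) * R M" by (simp add: R_def algebra_simps)
        then have "(R N - R M) / R N \<le> real (m N) * R M / R N"
          using R[of N] by (intro divide_right_mono) auto
        moreover have "(R N - R M) / R N = 1 - R M / R N"
          using R[of N] by (simp add: diff_divide_distrib)
        ultimately show ?thesis by simp
      qed
      then show "\<forall>\<^sub>F N in sequentially. 1 - R M / R N \<le> real (m N) * R M / R N" by simp
      have "real (m N) * R M \<le> R N" for N
        using m_le[of N] unfolding R_def of_nat_mult[symmetric] of_nat_le_iff .
      then show "\<forall>\<^sub>F N in sequentially. real (m N) * R M / R N \<le> 1"
        using R by (simp add: divide_le_eq)
    qed simp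
    have "(\<lambda>N. \<theta> N * (p M - \<kappa> * S / R M) + (1 - \<theta> N) * c0) \<longlonglongrightarrow> 1 ^ d * (p M - \<kappa> * S / R M) + (1 - 1 ^ d) * c0"
      unfolding \<theta>_def by (intro tendsto_intros ratio)
    then have "(\<lambda>N. \<theta> N * (p M - \<kappa> * S / R M) + (1 - \<theta> N) * c0) \<longlonglongrightarrow> p M - \<kappa> * S / R M" by simp
    then have "\<forall>\<^sub>F N in sequentially. p M - \<kappa> * S / R M - \<epsilon> < \<theta> N * (p M - \<kappa> * S / R M) + (1 - \<theta> N) * c0"
      using that by (intro order_tendstoD(1)) auto
    then show ?thesis
    proof eventually_elim
      case (elim N)
      then show ?case using bound[of N] by linarith
    qed
  qed
  have "\<exists>l. p \<longlonglongrightarrow> l"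
  proof (rule almost_increasing_bounded_converges[OF bdd])
    fix \<epsilon> :: real assume \<epsilon>: "0 < \<epsilon>"
    have "(\<lambda>M. \<kappa> * S / R M) \<longlonglongrightarrow> 0"
      by (intro real_tendsto_divide_at_top[OF tendsto_const R_at_top])
    then have "\<forall>\<^sub>F M in sequentially. \<kappa> * S / R M < \<epsilon> / 2"
      using \<epsilon> by (intro order_tendstoD(2)) auto
    then show "\<forall>\<^sub>F M in sequentially. \<forall>\<^sub>F N in sequentially. p M - \<epsilon> \<le> p N"
    proof eventually_elim
      case (elim M)
      have "\<forall>\<^sub>F N in sequentially. p M - \<kappa> * S / R M - \<epsilon> / 2 \<le> p N" using lower \<epsilon> by simp
      then show ?case
      proof eventually_elim
        case (elim N)
        then show ?case using \<open>\<kappa> * S / R M < \<epsilon> / 2\<close> by linarith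
      qed
    qed
  qed
  then show ?thesis unfolding p_def F_def card_box .
qed

section \<open>From exponential moments to convergence\<close>

lemma (in prob_space) distr_iid_std_normal:
  fixes J :: "'e \<Rightarrow> 'a \<Rightarrow> real"
  assumes indep: "indep_vars (\<lambda>_. borel) J UNIV"
    and law: "\<And>e. distributed M lborel (J e) std_normal_density"
    and E: "E \<noteq> {}"
  shows "(\<lambda>\<omega>. \<lambda>e\<in>E. J e \<omega>) \<in> M \<rightarrow>\<^sub>M gauss E"
    and "distr M (gauss E) (\<lambda>\<omega>. \<lambda>e\<in>E. J e \<omega>) = gauss E"
proof -
  have rv: "random_variable borel (J e)" for e
    using distributed_measurable[OF law[of e]] by simp
  show "(\<lambda>\<omega>. \<lambda>e\<in>E. J e \<omega>) \<in> M \<rightarrow>\<^sub>M gauss E"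
    using rv by (intro measurable_restrict) simp
  have "distr M borel (J e) = std_normal_distribution" for e
    using distributed_distr_eq_density[OF law[of e]] by (subst distr_cong[of M M borel lborel]) auto
  moreover have "indep_vars (\<lambda>_. borel) J E"
    by (rule indep_vars_subset[OF indep]) simp
  ultimately have "distr M (PiM E (\<lambda>_. borel)) (\<lambda>\<omega>. \<lambda>e\<in>E. J e \<omega>) = gauss E"
    using indep_vars_iff_distr_eq_PiM'[OF E, where M' = "\<lambda>_. borel" and X = J] rv by simp
  then show "distr M (gauss E) (\<lambda>\<omega>. \<lambda>e\<in>E. J e \<omega>) = gauss E"
    by (subst distr_cong[OF refl sets_gauss refl])
qed

text \<open>
  The constant comes from \<open>ln (u / q) \<le> u / q - 1\<close>, and is the best possible.
\<close>

lemma powr_le_exp: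
  fixes u q :: real
  assumes "0 \<le> u" "0 < q"
  shows "u powr q \<le> exp (q * ln q - q) * exp u"
proof (cases "u = 0")
  case False
  then have u: "0 < u" using assms by simp
  have "ln (u / q) \<le> u / q - 1" using u assms by (intro ln_le_minus_one) simp
  then have "q * (ln u - ln q) \<le> q * (u / q - 1)" using u assms by (intro mult_left_mono) (auto simp: ln_div)
  then have "q * ln u \<le> (q * ln q - q) + u" using assms by (simp add: algebra_simps)
  then have "exp (q * ln u) \<le> exp ((q * ln q - q) + u)" by (rule exp_le_cancel_iff[THEN iffD2])
  then show ?thesis using u by (simp only: powr_def exp_add) simp
qed (use assms in simp)

text \<open>
  The modulus in \<open>exp (s * \<bar>X\<bar>)\<close> is resolved by adding the exponentials for both
  signs.
\<close>

lemma (in prob_space) moments_from_exponential_moments: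
  fixes X :: "'a \<Rightarrow> real"
  assumes X: "random_variable borel X"
    and mgf: "\<And>t. t = s \<or> t = - s \<Longrightarrow> (\<integral>\<^sup>+\<omega>. ennreal (exp (t * X \<omega>)) \<partial>M) \<le> ennreal C"
    and s: "0 < s" and q: "0 < q" and C: "0 \<le> C"
  shows "integrable M (\<lambda>\<omega>. \<bar>X \<omega>\<bar> powr q)"
    and "expectation (\<lambda>\<omega>. \<bar>X \<omega>\<bar> powr q) \<le> 2 * C * exp (q * ln q - q) / s powr q"
proof -
  define c where "c = exp (q * ln q - q) / s powr q"
  have c: "0 < c" using s by (simp add: c_def)
  have pointwise: "\<bar>X \<omega>\<bar> powr q \<le> c * (exp (s * X \<omega>) + exp (- s * X \<omega>))" for \<omega>
  proof -
    have "s powr q * \<bar>X \<omega>\<bar> powr q = (s * \<bar>X \<omega>\<bar>) powr q" using s by (simp add: powr_mult)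
    also have "\<dots> \<le> exp (q * ln q - q) * exp (s * \<bar>X \<omega>\<bar>)"
      using s q by (intro powr_le_exp) auto
    also have "exp (s * \<bar>X \<omega>\<bar>) \<le> exp (s * X \<omega>) + exp (- s * X \<omega>)"
      by (cases "0 \<le> X \<omega>") (simp_all add: abs_if)
    finally have "s powr q * \<bar>X \<omega>\<bar> powr q \<le> exp (q * ln q - q) * (exp (s * X \<omega>) + exp (- s * X \<omega>))"
      by simp
    then show ?thesis using s by (simp add: c_def field_simps)
  qed
  note [measurable] = X
  have "(\<integral>\<^sup>+\<omega>. ennreal (\<bar>X \<omega>\<bar> powr q) \<partial>M)
     \<le> (\<integral>\<^sup>+\<omega>. ennreal c * (ennreal (exp (s * X \<omega>)) + ennreal (exp (- s * X \<omega>))) \<partial>M)"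
  proof (rule nn_integral_mono)
    fix \<omega>
    have "ennreal (\<bar>X \<omega>\<bar> powr q) \<le> ennreal (c * (exp (s * X \<omega>) + exp (- s * X \<omega>)))"
      by (rule ennreal_leI[OF pointwise])
    also have "\<dots> = ennreal c * (ennreal (exp (s * X \<omega>)) + ennreal (exp (- s * X \<omega>)))"
      using c by (simp add: ennreal_mult ennreal_plus)
    finally show "ennreal (\<bar>X \<omega>\<bar> powr q) \<le> ennreal c * (ennreal (exp (s * X \<omega>)) + ennreal (exp (- s * X \<omega>)))" .
  qed
  also have "\<dots> = ennreal c * ((\<integral>\<^sup>+\<omega>. ennreal (exp (s * X \<omega>)) \<partial>M) + (\<integral>\<^sup>+\<omega>. ennreal (exp (- s * X \<omega>)) \<partial>M))"
    by (subst nn_integral_cmult, measurable) (subst nn_integral_add, measurable)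
  also have "\<dots> \<le> ennreal c * (ennreal C + ennreal C)"
    by (intro mult_left_mono add_mono mgf) auto
  also have "\<dots> = ennreal (2 * C * c)"
    using c C by (simp add: ennreal_mult[symmetric] ennreal_plus[symmetric] mult_ac del: ennreal_plus)
  finally have *: "(\<integral>\<^sup>+\<omega>. ennreal (\<bar>X \<omega>\<bar> powr q) \<partial>M) \<le> ennreal (2 * C * c)" .
  show int: "integrable M (\<lambda>\<omega>. \<bar>X \<omega>\<bar> powr q)"
    using * by (intro integrableI_nonneg) (auto intro: le_less_trans)
  show "expectation (\<lambda>\<omega>. \<bar>X \<omega>\<bar> powr q) \<le> 2 * C * exp (q * ln q - q) / s powr q"
    using * c C by (simp add: nn_integral_eq_integral[OF int] c_def)
qed

text \<open>
  The sum of the \<open>\<bar>X N\<bar> powr q\<close> has finite mean, so it converges almost surely and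
  its terms tend to 0.
\<close>

lemma (in prob_space) AE_tendsto_0_of_summable_moments:
  fixes X :: "nat \<Rightarrow> 'a \<Rightarrow> real"
  assumes X: "\<And>N. random_variable borel (X N)" and q: "0 < q"
    and int: "\<And>N. integrable M (\<lambda>\<omega>. \<bar>X N \<omega>\<bar> powr q)"
    and bound: "\<And>N. expectation (\<lambda>\<omega>. \<bar>X N \<omega>\<bar> powr q) \<le> c N" and c: "summable c"
  shows "AE \<omega> in M. (\<lambda>N. X N \<omega>) \<longlonglongrightarrow> 0"
proof -
  note [measurable] = X
  have c_nonneg: "0 \<le> c N" for N
    by (rule order_trans[OF Bochner_Integration.integral_nonneg bound]) simp
  have "(\<integral>\<^sup>+\<omega>. (\<Sum>N. ennreal (\<bar>X N \<omega>\<bar> powr q)) \<partial>M) = (\<Sum>N. \<integral>\<^sup>+\<omega>. ennreal (\<bar>X N \<omega>\<bar> powr q) \<partial>M)"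
    by (rule nn_integral_suminf) measurable
  also have "\<dots> \<le> (\<Sum>N. ennreal (c N))"
    using bound by (intro suminf_le) (auto simp: nn_integral_eq_integral[OF int] intro!: ennreal_leI)
  also have "\<dots> = ennreal (\<Sum>N. c N)" by (rule suminf_ennreal2[OF c_nonneg c])
  finally have "(\<integral>\<^sup>+\<omega>. (\<Sum>N. ennreal (\<bar>X N \<omega>\<bar> powr q)) \<partial>M) \<noteq> \<infinity>" by (auto simp: top_unique)
  then have "AE \<omega> in M. (\<Sum>N. ennreal (\<bar>X N \<omega>\<bar> powr q)) \<noteq> \<infinity>"
    by (intro nn_integral_PInf_AE) measurable
  then show ?thesis
  proof eventually_elim
    case (elim \<omega>)
    then have "summable (\<lambda>N. \<bar>X N \<omega>\<bar> powr q)" by (intro summable_suminf_not_top) auto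
    then have "(\<lambda>N. \<bar>X N \<omega>\<bar> powr q) \<longlonglongrightarrow> 0" by (rule summable_LIMSEQ_zero)
    then have "(\<lambda>N. (\<bar>X N \<omega>\<bar> powr q) powr (1 / q)) \<longlonglongrightarrow> 0"
      by (rule tendsto_zero_powrI[OF _ tendsto_const]) (use q in auto)
    then have "(\<lambda>N. \<bar>X N \<omega>\<bar>) \<longlonglongrightarrow> 0" using q by (simp add: powr_powr)
    then show ?case by (rule tendsto_rabs_zero_cancel)
  qed
qed

lemma abs_add_powr_le:
  fixes a b q :: real
  assumes "0 < q"
  shows "\<bar>a + b\<bar> powr q \<le> 2 powr q * (\<bar>a\<bar> powr q + \<bar>b\<bar> powr q)"
proof -
  have "\<bar>a + b\<bar> powr q \<le> (2 * max \<bar>a\<bar> \<bar>b\<bar>) powr q"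
    using assms by (intro powr_mono2) auto
  also have "\<dots> = 2 powr q * max \<bar>a\<bar> \<bar>b\<bar> powr q" by (simp add: powr_mult)
  also have "max \<bar>a\<bar> \<bar>b\<bar> powr q \<le> \<bar>a\<bar> powr q + \<bar>b\<bar> powr q" by (simp add: max_def)
  finally show ?thesis by simp
qed

text \<open>
  The random part \<open>X N - e N\<close> and the deterministic part \<open>e N - p\<close> are
  separated by \<open>abs_add_powr_le\<close>.
\<close>

lemma (in prob_space) converges_in_Lp_of_centred_moments:
  fixes X :: "nat \<Rightarrow> 'a \<Rightarrow> real"
  assumes X: "\<And>N. random_variable borel (X N)" and q: "1 \<le> q"
    and int: "\<And>N. integrable M (\<lambda>\<omega>. \<bar>X N \<omega> - e N\<bar> powr q)"
    and moments: "(\<lambda>N. expectation (\<lambda>\<omega>. \<bar>X N \<omega> - e N\<bar> powr q)) \<longlonglongrightarrow> 0"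
    and e: "e \<longlonglongrightarrow> p"
  shows "converges_in_Lp M q X (\<lambda>_. p)"
  unfolding converges_in_Lp_def
proof (intro conjI allI)
  note [measurable] = X
  have q0: "0 < q" using q by simp
  have shift: "\<bar>X N \<omega> - r\<bar> powr q \<le> 2 powr q * (\<bar>X N \<omega> - e N\<bar> powr q + \<bar>e N - r\<bar> powr q)" for N \<omega> r
    using abs_add_powr_le[OF q0, of "X N \<omega> - e N" "e N - r"] by simp
  have int_shift: "integrable M (\<lambda>\<omega>. \<bar>X N \<omega> - r\<bar> powr q)" for N r
  proof (rule Bochner_Integration.integrable_bound)
    show "integrable M (\<lambda>\<omega>. 2 powr q * (\<bar>X N \<omega> - e N\<bar> powr q + \<bar>e N - r\<bar> powr q))"
      using int by simp
    show "AE \<omega> in M. norm (\<bar>X N \<omega> - r\<bar> powr q) \<le> norm (2 powr q * (\<bar>X N \<omega> - e N\<bar> powr q + \<bar>e N - r\<bar> powr q))"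
      using shift by (intro AE_I2) simp
  qed measurable
  show "in_Lp M q (X N)" for N using int_shift[of N 0] by (simp add: in_Lp_def)
  show "in_Lp M q (\<lambda>_. p)" by (simp add: in_Lp_def)
  have "(\<lambda>N. \<bar>e N - p\<bar> powr q) \<longlonglongrightarrow> 0"
    using LIM_zero[OF e] q0 by (intro tendsto_zero_powrI[where b = q] tendsto_const tendsto_rabs_zero) auto
  then have "(\<lambda>N. 2 powr q * (expectation (\<lambda>\<omega>. \<bar>X N \<omega> - e N\<bar> powr q) + \<bar>e N - p\<bar> powr q)) \<longlonglongrightarrow> 2 powr q * (0 + 0)"
    by (intro tendsto_intros moments)
  then have upper: "(\<lambda>N. 2 powr q * (expectation (\<lambda>\<omega>. \<bar>X N \<omega> - e N\<bar> powr q) + \<bar>e N - p\<bar> powr q)) \<longlonglongrightarrow> 0" by simp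
  have "(\<lambda>N. expectation (\<lambda>\<omega>. \<bar>X N \<omega> - p\<bar> powr q)) \<longlonglongrightarrow> 0"
  proof (rule tendsto_sandwich[OF _ _ tendsto_const upper])
    have "expectation (\<lambda>\<omega>. \<bar>X N \<omega> - p\<bar> powr q)
       \<le> expectation (\<lambda>\<omega>. 2 powr q * (\<bar>X N \<omega> - e N\<bar> powr q + \<bar>e N - p\<bar> powr q))" for N
      using int by (intro integral_mono int_shift shift) simp
    then show "\<forall>\<^sub>F N in sequentially. expectation (\<lambda>\<omega>. \<bar>X N \<omega> - p\<bar> powr q)
       \<le> 2 powr q * (expectation (\<lambda>\<omega>. \<bar>X N \<omega> - e N\<bar> powr q) + \<bar>e N - p\<bar> powr q)"
      using int by (simp add: prob_space)
  qed (simp add: Bochner_Integration.integral_nonneg)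
  then show "(\<lambda>N. Lp_norm M q (\<lambda>\<omega>. X N \<omega> - p)) \<longlonglongrightarrow> 0"
    unfolding Lp_norm_def using q0
    by (intro tendsto_zero_powrI[where b = "1 / q"] tendsto_const)
       (auto simp: Bochner_Integration.integral_nonneg)
qed

lemma pressure_eq_log_Z:
  fixes K :: "int ^ 'd \<Rightarrow> real"
  shows "pressure K \<kappa> \<beta> h N J
    = log_Z (\<lambda>i j. \<kappa> * K (i - j)) \<beta> h (lattice_box N) J / card (lattice_box N :: (int ^ 'd) set)"
  unfolding pressure_def partition_function_def log_Z_def ising_weight_def H_Ising_def H_SK_def
    spins_def configs_def exp_add[symmetric]
  by (simp add: sum_distrib_left sum_divide_distrib sum_negf algebra_simps)

theorem theorem1:
  fixes M :: "'a measure"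
    and J :: "(int ^ 'd) \<times> (int ^ 'd) \<Rightarrow> 'a \<Rightarrow> real"
    and K :: "int ^ 'd \<Rightarrow> real"
    and C1 C2 h \<kappa> \<beta> :: real
  assumes "prob_space M"
    and "prob_space.indep_vars M (\<lambda>_. borel) J UNIV"
    and "\<And>e. distributed M lborel (J e) std_normal_density"
    and "C1 > 0" and "C2 > 0"
    and "\<And>i. \<bar>K i\<bar> \<le> C1 * exp (- C2 * lattice_norm i)"
    and "\<kappa> > 0" and "\<beta> > 0"
  shows "\<exists>p :: real.
      (\<forall>N. integrable M (\<lambda>\<omega>. pressure K \<kappa> \<beta> h N (\<lambda>e. J e \<omega>))) \<and>
      (\<lambda>N. \<integral>\<omega>. pressure K \<kappa> \<beta> h N (\<lambda>e. J e \<omega>) \<partial>M) \<longlonglongrightarrow> p \<and>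
      (AE \<omega> in M. (\<lambda>N. pressure K \<kappa> \<beta> h N (\<lambda>e. J e \<omega>)) \<longlonglongrightarrow> p) \<and>
      (\<forall>q\<ge>1. converges_in_Lp M q (\<lambda>N \<omega>. pressure K \<kappa> \<beta> h N (\<lambda>e. J e \<omega>)) (\<lambda>_. p))"
proof -
  interpret prob_space M by fact
  define W where "W i j = \<kappa> * K (i - j)" for i j
  define n where "n N = real (card (lattice_box N :: (int ^ 'd) set))" for N
  define E where "E N = (lattice_box N :: (int ^ 'd) set) \<times> (lattice_box N :: (int ^ 'd) set)" for N
  define f where "f N x = 1 / n N * log_Z W \<beta> h (lattice_box N) x" for N x
  define P where "P N \<omega> = pressure K \<kappa> \<beta> h N (\<lambda>e. J e \<omega>)" for N \<omega>
  define e where "e N = free_energy W \<beta> h (lattice_box N) / n N" for N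
  have n_eq: "n N = real (2 * N + 1) ^ CARD('d)" for N by (simp add: n_def card_lattice_box)
  have n_ge: "real (2 * N + 1) \<le> n N" for N
    unfolding n_eq by (rule self_le_power) auto
  then have n_pos: "0 < n N" for N by (rule less_le_trans[rotated]) simp
  have E_ne: "E N \<noteq> {}" for N
    using n_pos[of N] by (auto simp: E_def n_def)
  have P_eq: "P N \<omega> = f N (\<lambda>e\<in>E N. J e \<omega>)" for N \<omega>
  proof -
    have "log_Z W \<beta> h (lattice_box N) (\<lambda>e. J e \<omega>) = log_Z W \<beta> h (lattice_box N) (\<lambda>e\<in>E N. J e \<omega>)"
      by (rule log_Z_cong) (simp add: E_def)
    then show ?thesis by (simp add: P_def f_def pressure_eq_log_Z W_def[abs_def] n_def)
  qed
  note restricted = distr_iid_std_normal[OF assms(2,3) E_ne]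
  have f_meas [measurable]: "f N \<in> borel_measurable (gauss (E N))" for N
    unfolding f_def E_def
    by (intro borel_measurable_times borel_measurable_const measurable_log_Z finite_lattice_box)
  have P_meas: "random_variable borel (P N)" for N
    unfolding P_eq using measurable_compose[OF restricted(1) f_meas] .
  have f_int: "integrable (gauss (E N)) (f N)" for N
    unfolding f_def E_def by (intro integrable_mult_right integrable_log_Z finite_lattice_box)
  have P_int: "integrable M (P N)" for N
    using integrable_distr_eq[OF restricted(1) f_meas, of N] f_int[of N]
    unfolding restricted(2) P_eq by simp
  have f_mean: "(\<integral>x. f N x \<partial>gauss (E N)) = e N" for N
    unfolding f_def e_def free_energy_def E_def by simp
  have P_mean: "expectation (P N) = e N" for N
    using integral_distr[OF restricted(1) f_meas, of N]
    unfolding restricted(2) P_eq f_mean by simp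
  (* The scale sqrt (n N) of t makes the bound independent of N. *)
  have P_mgf: "(\<integral>\<^sup>+\<omega>. ennreal (exp (t * (P N \<omega> - e N))) \<partial>M) \<le> ennreal (exp (\<beta>\<^sup>2 / 2))"
    if t: "t = sqrt (n N) \<or> t = - sqrt (n N)" for t N
  proof -
    have lip: "coord_lipschitz (E N) (\<lambda>_. 1 / n N * (\<bar>\<beta>\<bar> / sqrt (2 * n N))) (f N)"
      unfolding f_def[abs_def] E_def n_def
      by (rule coord_lipschitz_scale[OF coord_lipschitz_log_Z[OF finite_lattice_box]]) simp
    have "(\<integral>\<^sup>+\<omega>. ennreal (exp (t * (P N \<omega> - e N))) \<partial>M)
        = (\<integral>\<^sup>+x. ennreal (exp (t * (f N x - e N))) \<partial>distr M (gauss (E N)) (\<lambda>\<omega>. \<lambda>e\<in>E N. J e \<omega>))"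
      unfolding P_eq by (subst nn_integral_distr[OF restricted(1)]) (auto intro!: measurable_compose[OF f_meas])
    also have "\<dots> \<le> ennreal (exp (t\<^sup>2 * (\<Sum>i\<in>E N. (1 / n N * (\<bar>\<beta>\<bar> / sqrt (2 * n N)))\<^sup>2)))"
      unfolding restricted(2) f_mean[symmetric]
      by (rule gaussian_concentration[OF _ f_meas lip]) (simp add: E_def finite_lattice_box)
    also have "t\<^sup>2 * (\<Sum>i\<in>E N. (1 / n N * (\<bar>\<beta>\<bar> / sqrt (2 * n N)))\<^sup>2) = \<beta>\<^sup>2 / 2"
    proof -
      have "t\<^sup>2 = n N" using t n_pos[of N] by auto
      moreover have "real (card (E N)) = n N * n N" by (simp add: E_def n_def card_cartesian_product)
      ultimately show ?thesis
        using n_pos[of N] by (simp add: power_mult_distrib power_divide power2_eq_square field_simps)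
    qed
    finally show ?thesis .
  qed
  define C where "C = exp (\<beta>\<^sup>2 / 2)"
  have moments: "integrable M (\<lambda>\<omega>. \<bar>P N \<omega> - e N\<bar> powr q)"
    "expectation (\<lambda>\<omega>. \<bar>P N \<omega> - e N\<bar> powr q) \<le> 2 * C * exp (q * ln q - q) / sqrt (n N) powr q" if "0 < q" for N q
  proof -
    have "random_variable borel (\<lambda>\<omega>. P N \<omega> - e N)" using P_meas by simp
    note * = moments_from_exponential_moments[where s = "sqrt (n N)", OF this P_mgf _ that, folded C_def]
    show "integrable M (\<lambda>\<omega>. \<bar>P N \<omega> - e N\<bar> powr q)"
      using n_pos[of N] by (intro *(1)) (auto simp: C_def)
    show "expectation (\<lambda>\<omega>. \<bar>P N \<omega> - e N\<bar> powr q) \<le> 2 * C * exp (q * ln q - q) / sqrt (n N) powr q"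
      using n_pos[of N] by (intro *(2)) (auto simp: C_def)
  qed
  obtain S where S: "\<And>D. finite D \<Longrightarrow> (\<Sum>i\<in>D. \<bar>K i\<bar> * (1 + l1_norm i)) \<le> S"
    using exponential_decay_weighted_sum_bounded[OF assms(4-6)] by blast
  obtain p where p: "e \<longlonglongrightarrow> p"
    using mean_pressure_converges[of \<kappa> \<beta> K S h] S assms(7,8)
    unfolding e_def[abs_def] n_def W_def[abs_def] by auto
  have "AE \<omega> in M. (\<lambda>N. P N \<omega> - e N) \<longlonglongrightarrow> 0"
  (* The fourth moment is of order 1 / n\<^sup>2; second moments would not be summable for d = 1. *)
  proof (rule AE_tendsto_0_of_summable_moments[where q = 4])
    define c where "c = 2 * C * exp (4 * ln 4 - 4)"
    have c: "0 \<le> c" by (simp add: c_def C_def)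
    show "expectation (\<lambda>\<omega>. \<bar>P N \<omega> - e N\<bar> powr 4) \<le> c * inverse (real (Suc N) ^ 2)" for N
    proof -
      have "real (Suc N) \<le> n N" using n_ge[of N] by simp
      then have "real (Suc N) ^ 2 \<le> n N ^ 2" by (intro power_mono) auto
      also have "n N ^ 2 = sqrt (n N) powr 4"
        using n_pos[of N] by (simp add: powr_half_sqrt[symmetric] powr_powr)
      finally have "c / sqrt (n N) powr 4 \<le> c / real (Suc N) ^ 2"
        by (intro divide_left_mono c) (use n_pos[of N] in auto)
      with moments(2)[of 4 N] show ?thesis by (simp add: c_def divide_inverse)
    qed
    show "summable (\<lambda>N. c * inverse (real (Suc N) ^ 2))"
      by (intro summable_mult summable_Suc_iff[THEN iffD2] inverse_power_summable) simp
    show "random_variable borel (\<lambda>\<omega>. P N \<omega> - e N)" for N using P_meas by simp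
    show "integrable M (\<lambda>\<omega>. \<bar>P N \<omega> - e N\<bar> powr 4)" for N by (rule moments(1)) simp
  qed simp
  then have ae: "AE \<omega> in M. (\<lambda>N. P N \<omega>) \<longlonglongrightarrow> p"
  proof eventually_elim
    case (elim \<omega>)
    from tendsto_add[OF this p] show ?case by simp
  qed
  have Lq: "converges_in_Lp M q P (\<lambda>_. p)" if q: "1 \<le> q" for q
  proof (rule converges_in_Lp_of_centred_moments[OF P_meas q _ _ p])
    have q0: "0 < q" using q by simp
    show "integrable M (\<lambda>\<omega>. \<bar>P N \<omega> - e N\<bar> powr q)" for N by (rule moments(1)[OF q0])
    have "filterlim n at_top sequentially"
      using n_ge
      by (intro filterlim_at_top_mono[OF filterlim_compose[OF filterlim_real_sequentially
              filterlim_subseq[of "\<lambda>N. 2 * N + 1"]]] always_eventually) (auto simp: strict_mono_def)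
    then have "filterlim (\<lambda>N. sqrt (n N)) at_top sequentially"
      by (rule filterlim_compose[OF sqrt_at_top])
    from tendsto_neg_powr[OF _ this, of "- q"] q0
    have "(\<lambda>N. sqrt (n N) powr (- q)) \<longlonglongrightarrow> 0" by simp
    from tendsto_mult_right_zero[OF this, of "2 * C * exp (q * ln q - q)"]
    have upper: "(\<lambda>N. 2 * C * exp (q * ln q - q) / sqrt (n N) powr q) \<longlonglongrightarrow> 0"
      by (simp only: powr_minus divide_inverse)
    show "(\<lambda>N. expectation (\<lambda>\<omega>. \<bar>P N \<omega> - e N\<bar> powr q)) \<longlonglongrightarrow> 0"
    proof (rule tendsto_sandwich[OF _ _ tendsto_const upper])
      show "\<forall>\<^sub>F N in sequentially. expectation (\<lambda>\<omega>. \<bar>P N \<omega> - e N\<bar> powr q)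
          \<le> 2 * C * exp (q * ln q - q) / sqrt (n N) powr q"
        by (intro always_eventually allI moments(2)[OF q0])
    qed (simp add: Bochner_Integration.integral_nonneg)
  qed
  have "(\<lambda>N. expectation (P N)) \<longlonglongrightarrow> p" unfolding P_mean by (rule p)
  with P_int ae Lq show ?thesis unfolding P_def by blast
qed

end
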